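(* For $t>0$, $g\in SL(2,\mathbb C)$, $h\in SU(2)$ let $$\psi^t_g(h)=\sum_{j=0,\frac12,1,\dots}(2j+1)\,e^{-\frac t2j(j+1)}\chi_j(gh^{-1})$$ and $p^t_g(h):=|\psi^t_g(h)|^2/\|\psi^t_g\|^2$, with norm in $L_2(SU(2),d\mu_H)$. Let $H=\exp(-ip^j\tau_j/2)$ with $\vec p\in\mathbb R^3$, $p=|\vec p|$, and $h=\exp(\theta^j\tau_j)\in SU(2)$ with $\vec\theta\in\mathbb R^3$, $\theta=|\vec\theta|\in[0,\pi]$; let $\alpha\in[0,\pi]$ satisfy $\cos\alpha=\vec p\cdot\vec\theta/(p\theta)$. Put $x=\cosh(p/2)\cos\theta+i\sinh(p/2)\sin\theta\cos\alpha$, $\operatorname{arcosh}(x):=s+i\phi$ with $s\in\mathbb R$, $\phi\in[0,\pi]$, $\cosh(s+i\phi)=x$, and $\delta^2:=\frac{p^2}{4}-s^2+\phi^2-\theta^2$. There exist positive $K_t,K'_t,K''_t$, depending only on $t$ (not on $H,h$) and decaying exponentially fast to $0$ as $t\to0$, such that for every $t>0$ with $K_t<1$: (i) if $0\le\phi\le31\pi/32$, then $$p^t_H(h)\le\frac{\frac{16\sqrt\pi}{t^{3/2}}\frac{|\operatorname{arcosh}(x)|^2}{|x^2-1|}e^{-\frac{4(\theta^2+\delta^2)}{t}}(1+K'_t)}{\frac{p}{\sinh p}(1-K_t)};$$ (ii) if $31\pi/32\le\phi\le\pi$, then $$p^t_H(h)\le\frac{\frac{16\sqrt\pi}{t^{3/2}}\frac{|\operatorname{arcosh}(x)-i\pi|^2}{|x^2-1|}e^{-\frac{2(\theta^2+2\delta^2)}{t}}(1+K''_t)}{\frac{p}{\sinh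 p}(1-K_t)}.$$
   Context: $\tau_j=-i\sigma_j$ with $\sigma_j$ the Pauli matrices; $\mu_H$ is the normalized Haar measure on $SU(2)$; $\chi_j$ is the character of the spin-$j$ irreducible representation of dimension $2j+1$, extended holomorphically to $SL(2,\mathbb C)$. For every complex $x$ the pair $(s,\phi)$ exists; $\phi$ and $|s|$ are unique, and only when $x$ is real with $|x|>1$ is the sign of $s$ ambiguous, in which case one takes $s>0$. If $p=0$ or $\theta=0$ the angle $\alpha$ is arbitrary. $p/\sinh p:=1$ at $p=0$, and at $x=\pm1$ the expressions are understood by continuous extension in $x$. "Decaying exponentially fast to $0$ as $t\to0$" means: there are $C,c,t_0>0$ with $0<K_t\le Ce^{-c/t}$ for $0<t<t_0$. *)

theory Defs
  imports "HOL-Analysis.Analysis" "HOL-Probability.Probability"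
    "HOL-Computational_Algebra.Polynomial"
begin

definition conj_transpose :: "complex^2^2 \<Rightarrow> complex^2^2" where
  "conj_transpose A = (\<chi> i j. cnj (A $ j $ i))"

definition SU2 :: "(complex^2^2) set" where
  "SU2 = {A. A ** conj_transpose A = mat 1 \<and> conj_transpose A ** A = mat 1 \<and> det A = 1}"

(* Borel probability measure on the compact group SU(2), invariant under left translations. *)
definition normalized_haar_SU2 :: "(complex^2^2) measure \<Rightarrow> bool" where
  "normalized_haar_SU2 M \<longleftrightarrow>
     prob_space M \<and> space M = SU2 \<and> sets M = sets (restrict_space borel SU2) \<and>
     (\<forall>g\<in>SU2. distr M M (\<lambda>h. g ** h) = M)"

definition cscale :: "complex \<Rightarrow> complex^2^2 \<Rightarrow> complex^2^2" where
  "cscale c A = (\<chi> i j. c * A $ i $ j)"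

(* The exponential series for the matrix product; the class-based exp is not
   available for this type. *)
definition matrix_exp :: "complex^2^2 \<Rightarrow> complex^2^2" where
  "matrix_exp A = (\<Sum>n. (1 / fact n) *\<^sub>R (((**) A) ^^ n) (mat 1))"

definition pauli :: "3 \<Rightarrow> complex^2^2" where
  "pauli j =
     (if j = 1 then vector [vector [0, 1], vector [1, 0]]
      else if j = 2 then vector [vector [0, - \<i>], vector [\<i>, 0]]
      else vector [vector [1, 0], vector [0, - 1]])"

definition tau :: "3 \<Rightarrow> complex^2^2" where
  "tau j = cscale (- \<i>) (pauli j)"

definition tau_vec :: "real^3 \<Rightarrow> complex^2^2" where
  "tau_vec v = (\<Sum>j\<in>UNIV. (v $ j) *\<^sub>R tau j)"

(* The spin-j representation, n = 2j, realised on the homogeneous polynomials of degree n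
   in (z1, z2) by (g P)(z) = P(z g), z a row vector. The monomial z1^k z2^(n-k) is sent to
   (g11 z1 + g21 z2)^k (g12 z1 + g22 z2)^(n-k); setting z2 = 1, spin_rep n g l k is the
   coefficient of z1^l z2^(n-l) in it, for l, k in {0..n}. The entries are polynomials in
   those of g, so the same formula gives the holomorphic extension from SU(2) to SL(2,C). *)
definition spin_rep :: "nat \<Rightarrow> complex^2^2 \<Rightarrow> nat \<Rightarrow> nat \<Rightarrow> complex" where
  "spin_rep n g l k =
     coeff ([: g $ 2 $ 1, g $ 1 $ 1 :] ^ k * [: g $ 2 $ 2, g $ 1 $ 2 :] ^ (n - k)) l"

definition spin_char :: "nat \<Rightarrow> complex^2^2 \<Rightarrow> complex" where
  "spin_char n g = (\<Sum>k\<le>n. spin_rep n g k k)"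

(* The sum over j = 0, 1/2, 1, ... is indexed by n = 2j. *)
definition psi :: "real \<Rightarrow> complex^2^2 \<Rightarrow> complex^2^2 \<Rightarrow> complex" where
  "psi t g h =
     (\<Sum>n. let j = real n / 2 in
        of_real ((2 * j + 1) * exp (- (t / 2) * j * (j + 1))) * spin_char n (g ** matrix_inv h))"

definition psi_norm_sq :: "(complex^2^2) measure \<Rightarrow> real \<Rightarrow> complex^2^2 \<Rightarrow> real" where
  "psi_norm_sq M t g = (\<integral>h. (cmod (psi t g h))\<^sup>2 \<partial>M)"

definition prob_density :: "(complex^2^2) measure \<Rightarrow> real \<Rightarrow> complex^2^2 \<Rightarrow> complex^2^2 \<Rightarrow> real" where
  "prob_density M t g h = (cmod (psi t g h))\<^sup>2 / psi_norm_sq M t g"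

(* The branch with imaginary part in [0, pi]; it differs from the principal branch arcosh. *)
definition Arcosh :: "complex \<Rightarrow> complex" where
  "Arcosh x = (THE w. cosh w = x \<and> 0 \<le> Im w \<and> Im w \<le> pi \<and>
                 (x \<in> \<real> \<and> cmod x > 1 \<longrightarrow> Re w > 0))"

(* F, with its values at 1 and -1 replaced by those of the continuous extension. *)
definition extend_pm1 :: "(complex \<Rightarrow> real) \<Rightarrow> complex \<Rightarrow> real" where
  "extend_pm1 F x = (if x = 1 \<or> x = - 1 then Lim (at x) F else F x)"

definition p_over_sinh :: "real \<Rightarrow> real" where
  "p_over_sinh p = (if p = 0 then 1 else p / sinh p)"

definition exp_decaying :: "(real \<Rightarrow> real) \<Rightarrow> bool" where
  "exp_decaying K \<longleftrightarrow>
     (\<exists>C c t0. C > 0 \<and> c > 0 \<and> t0 > 0 \<and>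
        (\<forall>t. 0 < t \<and> t < t0 \<longrightarrow> 0 < K t \<and> K t \<le> C * exp (- c / t)))"

end

theory Submission
  imports Defs "HOL-Complex_Analysis.Conformal_Mappings"
begin

text \<open>
  Write \<open>2 cosh w\<close> for the trace of \<open>g h\<^sup>-\<^sup>1\<close>. Then \<open>\<psi>\<^sup>t\<close> is a function of \<open>w\<close> alone, and Schur orthogonality
  shows that the squared norm is the same function at time \<open>2t\<close> and \<open>w = p\<close>.
  Poisson summation turns \<open>sinh w\<close> times this function into a multiple of
  \<open>\<Sum>\<^sub>k (w + 2\<pi>ik) exp (2(w + 2\<pi>ik)\<^sup>2/t)\<close>. Pairing the terms \<open>k\<close> and \<open>-k\<close> extracts a factor \<open>w\<close> and leaves the
  term \<open>k = 0\<close> dominant as long as \<open>\<phi>\<close> stays away from \<open>\<pi>\<close>. For \<open>\<phi>\<close> close to \<open>\<pi>\<close> the terms \<open>k\<close> and \<open>-1-k\<close> are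
  paired, which extracts \<open>w - i\<pi>\<close>; the polynomial loss in \<open>1/t\<close> is absorbed by \<open>exp (2\<theta>\<^sup>2/t)\<close>, because
  \<open>cos \<phi> < 0\<close> forces \<open>\<theta> > \<pi>/2\<close>.
\<close>

section \<open>Fourier series and the Poisson summation formula\<close>

text \<open>The bounds must be uniform in H and h, but the Poisson formula yields only the product
  of the series with \<open>sinh w\<close>, which vanishes at x = 1 and x = -1. An absolute error
  estimate would be useless there: every error term must carry the same factor w (or w - i pi) as
  the bound, and the zeros themselves are reached by continuity in w. The threshold 31 pi / 32
  leaves a fixed share of the Gaussian decay, -8 pi^2 k^2 + 8 pi k phi <= - pi^2 k^2 / 4 for k >= 1;
  half of it pays for polynomial factors, the other half sums to a tail of order exp (-c / t). For
  the norm, at time 2t and a real argument, a lower bound is needed. The quotient of the prefactors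
  is 16 sqrt pi / t^(3/2), and the exponents 4 (s^2 - phi^2) / t and p^2 / t combine to -4 (theta^2
  + delta^2) / t. The Poisson formula comes from uniqueness of Fourier coefficients on the imaginary
  axis and analytic continuation; it is differentiated because the weights 2j + 1 are what the
  derivative of a theta series produces.\<close>

text \<open>On the circle a linear form is a combination of \<open>cis y\<close> and
  \<open>cis (- y)\<close>, so multiplying by it only shifts the frequency j by one in each
  direction. The premises on f belong to the induction claim because in the product case the second
  factor acts on f times the first.\<close>

lemma fourier_shift_real_polynomial:
  fixes q :: "complex \<Rightarrow> real"
  assumes "real_polynomial_function q"
  shows "continuous_on UNIV f \<Longrightarrow> (\<And>j::int. integral {0..2*pi} (\<lambda>y. f y * cis (of_int j * y)) = 0) \<Longrightarrow>
     continuous_on UNIV (\<lambda>y. f y * of_real (q (cis y))) \<and>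
     (\<forall>j::int. integral {0..2*pi} (\<lambda>y. f y * of_real (q (cis y)) * cis (of_int j * y)) = 0)"
  using assms
proof (induction arbitrary: f)
  case (linear q)
  have int: "(\<lambda>y. f y * cis (of_int j * y)) integrable_on {0..2*pi}" for j :: int
    by (intro integrable_continuous_interval continuous_intros continuous_on_subset[OF linear(2)]) auto
  have q: "complex_of_real (q (cis y)) = (of_real (q 1) / 2 - \<i> * of_real (q \<i>) / 2) * cis y
       + (of_real (q 1) / 2 + \<i> * of_real (q \<i>) / 2) * cis (- y)" for y
  proof -
    interpret q: bounded_linear q by fact
    have "q (cis y) = q (cos y *\<^sub>R 1 + sin y *\<^sub>R \<i>)"
      by (rule arg_cong[where f=q]) (simp add: complex_eq_iff)
    also have "\<dots> = cos y * q 1 + sin y * q \<i>"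
      by (simp only: q.add q.scaleR) simp
    finally show ?thesis by (simp add: complex_eq_iff field_simps)
  qed
  have "integral {0..2*pi} (\<lambda>y. f y * of_real (q (cis y)) * cis (of_int j * y)) = 0" for j :: int
  proof -
    define A where "A = complex_of_real (q 1) / 2 - \<i> * of_real (q \<i>) / 2"
    define B where "B = complex_of_real (q 1) / 2 + \<i> * of_real (q \<i>) / 2"
    have eq: "(\<lambda>y. f y * of_real (q (cis y)) * cis (of_int j * y)) =
       (\<lambda>y. A * (f y * cis (of_int (j + 1) * y)) + B * (f y * cis (of_int (j - 1) * y)))"
      by (rule ext, subst q, fold A_def B_def)
         (simp add: cis_mult[symmetric] cis_divide[symmetric] divide_inverse algebra_simps)
    have "integral {0..2*pi} (\<lambda>y. A * (f y * cis (of_int (j + 1) * y)) + B * (f y * cis (of_int (j - 1) * y))) = A * integral {0..2*pi} (\<lambda>y. f y * cis (of_int (j + 1) * y))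
       + B * integral {0..2*pi} (\<lambda>y. f y * cis (of_int (j - 1) * y))"
      by (subst integral_add) (intro integrable_on_mult_right int refl | simp only: integral_mult_right)+
    then show ?thesis unfolding eq by (simp only: linear(3)) simp
  qed
  moreover have "continuous_on UNIV (\<lambda>y. f y * of_real (q (cis y)))"
    by (intro continuous_intros linear(2) bounded_linear.continuous_on[OF linear(1)])
  ultimately show ?case by blast
next
  case (const c)
  have "integral {0..2*pi} (\<lambda>y. f y * of_real c * cis (of_int j * y)) = 0" for j :: int
  proof -
    have "(\<lambda>y. f y * of_real c * cis (of_int j * y)) = (\<lambda>y. of_real c * (f y * cis (of_int j * y)))"
      by (simp add: mult_ac)
    then show ?thesis by (simp add: const(2) del: mult.assoc)
  qed
  then show ?case using const by (auto intro!: continuous_intros)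
next
  case (add q r)
  note q = add.IH(1)[OF add.prems] and r = add.IH(2)[OF add.prems]
  have "integral {0..2*pi} (\<lambda>y. f y * of_real (q (cis y) + r (cis y)) * cis (of_int j * y)) = 0" for j :: int
  proof -
    have *: "continuous_on {0..2*pi} (\<lambda>y. f y * of_real (q (cis y)))"
      "continuous_on {0..2*pi} (\<lambda>y. f y * of_real (r (cis y)))"
      using q r continuous_on_subset by blast+
    have "(\<lambda>y. f y * of_real (q (cis y) + r (cis y)) * cis (of_int j * y)) =
      (\<lambda>y. f y * of_real (q (cis y)) * cis (of_int j * y) + f y * of_real (r (cis y)) * cis (of_int j * y))"
      by (simp add: algebra_simps)
    then show ?thesis
      by (simp only:, subst integral_add)
         (auto intro!: integrable_continuous_interval continuous_on_mult * continuous_intros simp: q r)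
  qed
  moreover have "continuous_on UNIV (\<lambda>y. f y * of_real (q (cis y) + r (cis y)))"
    using continuous_on_add[OF conjunct1[OF q] conjunct1[OF r]] by (simp add: algebra_simps)
  ultimately show ?case by blast
next
  case (mult q r)
  note q = mult.IH(1)[OF mult.prems]
  show ?case
    using mult.IH(2)[OF conjunct1[OF q] conjunct2[OF q, rule_format]] by (simp add: mult.assoc)
qed

text \<open>Carries f to the compact unit circle, where Stone-Weierstrass applies. Periodicity is
  what makes the composite continuous across the cut of \<open>Ln\<close>.\<close>

lemma periodic_Arg:
  fixes f :: "real \<Rightarrow> complex"
  assumes cont: "continuous_on UNIV f" and per: "\<And>y. f (y + 2 * pi) = f y"
  shows "continuous_on (sphere 0 1) (\<lambda>z. f (Im (Ln z)))" and "f (Im (Ln (cis y))) = f y"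
proof -
  have pern: "f (y + 2 * pi * of_nat n) = f y" for y n
  proof (induction n)
    case (Suc n) then show ?case using per[of "y + 2 * pi * of_nat n"] by (simp add: algebra_simps)
  qed simp
  have peri: "f (y + 2 * pi * of_int k) = f y" for y k
  proof (cases k)
    case (nonneg n) then show ?thesis using pern[of y n] by simp
  next
    case (neg n)
    then have "y + 2 * pi * of_int k + 2 * pi * of_nat (Suc n) = y"
      by (simp only: of_int_minus of_int_of_nat_eq)
    then show ?thesis using pern[of "y + 2 * pi * of_int k" "Suc n"] by (simp only:)
  qed
  have eq: "f a = f b" if "cis a = cis b" for a b
  proof -
    have "exp (\<i> * of_real a) = exp (\<i> * of_real b)" using that by (simp add: cis_conv_exp)
    then obtain k :: int where "\<i> * of_real a = \<i> * of_real b + of_int (2 * k) * pi * \<i>"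
      by (auto simp: exp_eq)
    then have "a = b + 2 * pi * of_int k" by (auto simp: complex_eq_iff)
    then show ?thesis using peri by simp
  qed
  show "f (Im (Ln (cis y))) = f y"
  proof (rule eq)
    have "exp (Ln (cis y)) = cis y" by (intro exp_Ln) auto
    moreover have "Re (Ln (cis y)) = 0" by (subst Re_Ln) auto
    ultimately show "cis (Im (Ln (cis y))) = cis y" by (simp add: exp_eq_polar)
  qed
  have cu: "isCont f y" for y using cont continuous_on_eq_continuous_at[OF open_UNIV] by blast
  show "continuous_on (sphere 0 1) (\<lambda>z. f (Im (Ln z)))"
  proof (intro continuous_at_imp_continuous_on ballI)
    fix z :: complex assume z: "z \<in> sphere 0 1"
    show "isCont (\<lambda>z. f (Im (Ln z))) z"
    proof (cases "z \<in> \<real>\<^sub>\<le>\<^sub>0")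
      case False
      then show ?thesis
        by (intro continuous_intros isCont_o2[OF _ cu]) auto
    next
      \<comment> \<open>On the cut the argument of -u is used instead: it is continuous there, and
        adding pi gives an argument of u modulo 2 pi.\<close>
      case True
      moreover have "z \<noteq> 0" using z by auto
      ultimately have nz: "- z \<notin> \<real>\<^sub>\<le>\<^sub>0" by (auto simp: complex_nonpos_Reals_iff complex_eq_iff)
      have "eventually (\<lambda>u. u \<noteq> 0) (nhds z)" using z
        by (intro t1_space_nhds) auto
      then have ev: "eventually (\<lambda>u. f (Im (Ln u)) = f (Im (Ln (- u)) + pi)) (nhds z)"
      proof eventually_elim
        case (elim u)
        have "of_real (exp (Re (Ln u))) * cis (Im (Ln u)) = - (of_real (exp (Re (Ln (-u)))) * cis (Im (Ln (-u))))"
          using elim exp_Ln[of u] exp_Ln[of "-u"] by (simp add: exp_eq_polar)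
        then have "of_real (cmod u) * cis (Im (Ln u)) = of_real (cmod u) * (- cis (Im (Ln (-u))))"
          using elim by (simp add: Re_Ln)
        then have "cis (Im (Ln u)) = - cis (Im (Ln (-u)))" using elim by (simp only: mult_cancel_left) simp
        then have "cis (Im (Ln u)) = cis (Im (Ln (- u)) + pi)" by (simp flip: cis_mult)
        then show ?case by (rule eq)
      qed
      have "isCont (\<lambda>u. f (Im (Ln (- u)) + pi)) z"
        using nz by (intro continuous_intros isCont_o2[OF _ cu]) auto
      then show ?thesis by (subst isCont_cong[OF ev])
    qed
  qed
qed

text \<open>f is orthogonal to every polynomial g in \<open>cis y\<close>, so the integral of |f|^2
  equals that of f times the conjugate of f - g. For g uniformly within e this is at most e times
  the integral of |f|.\<close>

lemma fourier_unique:
  fixes f :: "real \<Rightarrow> complex"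
  assumes cont: "continuous_on UNIV f" and per: "\<And>y. f (y + 2 * pi) = f y"
    and coef: "\<And>j::int. integral {0..2*pi} (\<lambda>y. f y * cis (of_int j * y)) = 0"
  shows "f y = 0"
proof -
  note contI = continuous_on_subset[OF cont subset_UNIV]
  define M where "M = integral {0..2*pi} (\<lambda>y. cmod (f y))"
  have M0: "M \<ge> 0" unfolding M_def by (intro integral_nonneg integrable_continuous_interval continuous_intros contI) auto
  have "integral {0..2*pi} (\<lambda>y. (cmod (f y))\<^sup>2) \<le> e * M" if e: "e > 0" for e
  proof -
    obtain g where g: "polynomial_function g" and ge: "\<forall>z\<in>sphere 0 1. norm (f (Im (Ln z)) - g z) < e"
      using Stone_Weierstrass_polynomial_function[OF compact_sphere periodic_Arg(1)[OF cont per] e] by blast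
    have gi: "norm (f y - g (cis y)) < e" for y
      using ge[rule_format, of "cis y"] periodic_Arg(2)[OF cont per] by simp
    have rp: "real_polynomial_function (Re \<circ> g)" "real_polynomial_function (Im \<circ> g)"
      using g bounded_linear_Re bounded_linear_Im unfolding polynomial_function_def by blast+
    note a = fourier_shift_real_polynomial[OF rp(1) cont coef] fourier_shift_real_polynomial[OF rp(2) cont coef]
    have cg: "continuous_on S (\<lambda>y. g (cis y))" for S
      by (intro continuous_on_compose2[OF continuous_on_polymonial_function[OF g]] continuous_intros) auto
    have "((\<lambda>y. f y * cnj (g (cis y))) has_integral (0 - \<i> * 0)) {0..2*pi}"
    proof -
      have "(\<lambda>y. f y * cnj (g (cis y))) = (\<lambda>y. f y * of_real ((Re \<circ> g) (cis y)) - \<i> * (f y * of_real ((Im \<circ> g) (cis y))))"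
        by (auto simp: complex_eq_iff algebra_simps)
      moreover have "((\<lambda>y. f y * of_real ((Re \<circ> g) (cis y))) has_integral 0) {0..2*pi}"
        using conjunct2[OF a(1), rule_format, of 0] integrable_continuous_interval[OF continuous_on_subset[OF conjunct1[OF a(1)] subset_UNIV]]
        by (simp add: has_integral_integrable_integral)
      moreover have "((\<lambda>y. f y * of_real ((Im \<circ> g) (cis y))) has_integral 0) {0..2*pi}"
        using conjunct2[OF a(2), rule_format, of 0] integrable_continuous_interval[OF continuous_on_subset[OF conjunct1[OF a(2)] subset_UNIV]]
        by (simp add: has_integral_integrable_integral)
      ultimately show ?thesis
        by (simp only:) (intro has_integral_diff has_integral_mult_right)
    qed
    then have z: "integral {0..2*pi} (\<lambda>y. f y * cnj (g (cis y))) = 0" by (simp add: integral_unique)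
    have "of_real (integral {0..2*pi} (\<lambda>y. (cmod (f y))\<^sup>2)) = integral {0..2*pi} (\<lambda>y. complex_of_real ((cmod (f y))\<^sup>2))"
      by (intro integral_linear[OF _ bounded_linear_of_real, unfolded o_def, symmetric] integrable_continuous_interval continuous_intros contI)
    also have "\<dots> = integral {0..2*pi} (\<lambda>y. f y * cnj (f y))"
      by (simp only: complex_norm_square)
    also have "\<dots> = integral {0..2*pi} (\<lambda>y. f y * cnj (f y)) - integral {0..2*pi} (\<lambda>y. f y * cnj (g (cis y)))"
      using z by simp
    also have "\<dots> = integral {0..2*pi} (\<lambda>y. f y * cnj (f y) - f y * cnj (g (cis y)))"
      by (intro integral_diff[symmetric] integrable_continuous_interval continuous_intros contI cg)
    also have "cmod \<dots> \<le> integral {0..2*pi} (\<lambda>y. e * cmod (f y))"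
    proof (intro integral_norm_bound_integral integrable_continuous_interval continuous_intros contI cg)
      fix y
      have "cmod (f y * cnj (f y) - f y * cnj (g (cis y))) = cmod (f y) * cmod (f y - g (cis y))"
        by (metis complex_cnj_diff complex_mod_cnj norm_mult right_diff_distrib)
      also have "\<dots> \<le> cmod (f y) * e" using gi[of y] by (intro mult_left_mono) auto
      finally show "cmod (f y * cnj (f y) - f y * cnj (g (cis y))) \<le> e * cmod (f y)" by (simp add: mult_ac)
    qed
    also have "\<dots> = e * M" by (simp add: M_def)
    finally show ?thesis by simp
  qed
  note le = this
  have "integral {0..2*pi} (\<lambda>y. (cmod (f y))\<^sup>2) \<le> 0"
  proof (rule field_le_epsilon)
    fix e :: real assume "e > 0"
    then have "integral {0..2*pi} (\<lambda>y. (cmod (f y))\<^sup>2) \<le> (e / (M + 1)) * M" using M0 by (intro le) auto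
    also have "\<dots> \<le> e" using M0 \<open>e > 0\<close> by (simp add: field_simps)
    finally show "integral {0..2*pi} (\<lambda>y. (cmod (f y))\<^sup>2) \<le> 0 + e" by simp
  qed
  moreover have "integral {0..2*pi} (\<lambda>y. (cmod (f y))\<^sup>2) \<ge> 0"
    by (intro integral_nonneg integrable_continuous_interval continuous_intros contI) auto
  moreover have "(\<lambda>y. (cmod (f y))\<^sup>2) integrable_on {0..2*pi}"
    by (intro integrable_continuous_interval continuous_intros contI)
  ultimately have "((\<lambda>y. (cmod (f y))\<^sup>2) has_integral 0) (cbox 0 (2*pi))"
    by (auto simp: has_integral_integrable_integral)
  then have z: "f y = 0" if "y \<in> {0..2*pi}" for y
  proof -
    have "continuous_on (cbox 0 (2*pi)) (\<lambda>y. (cmod (f y))\<^sup>2)" by (intro continuous_intros contI)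
    then have "(cmod (f y))\<^sup>2 = 0"
      by (rule has_integral_0_cbox_imp_0) (use that \<open>((\<lambda>y. (cmod (f y))\<^sup>2) has_integral 0) (cbox 0 (2*pi))\<close> in \<open>auto simp: pi_gt_zero[unfolded not_le[symmetric]]\<close>)
    then show ?thesis by simp
  qed
  \<comment> \<open>Arguments lie in (-pi, pi] while vanishing is known on [0, 2 pi]; one period
    shift covers the negative half.\<close>
  define u where "u = Im (Ln (cis y))"
  have u: "- pi < u" "u \<le> pi" using mpi_less_Im_Ln[of "cis y"] Im_Ln_le_pi[of "cis y"] by (auto simp: u_def)
  have "f u = 0"
    using z[of u] z[of "u + 2*pi"] per[of u] u by force
  then show ?thesis using periodic_Arg(2)[OF cont per, of y] by (simp add: u_def)
qed


section \<open>Half theta series and their Gaussian duals\<close>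

lemma summable_exp_quadratic:
  fixes b c :: real
  assumes "b > 0"
  shows "summable (\<lambda>n::nat. exp (c * real n - b * (real n)\<^sup>2))"
proof (rule summable_comparison_test')
  show "summable (\<lambda>n::nat. exp ((c + 1)\<^sup>2 / (4 * b)) * exp (- 1) ^ n)"
    by (intro summable_mult summable_geometric) auto
  fix n :: nat
  \<comment> \<open>The square is centred so that completing it leaves the exponent -n, hence a
    geometric majorant.\<close>
  have "0 \<le> b * (real n - (c + 1) / (2 * b))\<^sup>2" using assms by simp
  also have "\<dots> = b * (real n)\<^sup>2 - (c + 1) * real n + (c + 1)\<^sup>2 / (4 * b)"
    using assms by (simp add: field_simps power2_eq_square)
  finally have "exp (c * real n - b * (real n)\<^sup>2) \<le> exp ((c + 1)\<^sup>2 / (4 * b) + real n * (- 1))"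
    by (simp add: algebra_simps)
  then show "norm (exp (c * real n - b * (real n)\<^sup>2)) \<le> exp ((c + 1)\<^sup>2 / (4 * b)) * exp (- 1) ^ n"
    by (simp only: exp_add exp_of_nat_mult) simp
qed

text \<open>The terms of one half of a Jacobi theta series. If T is their sum, the sum over all
  integers is T w + T (-w) - 1.\<close>

definition theta_half :: "real \<Rightarrow> nat \<Rightarrow> complex \<Rightarrow> complex" where
  "theta_half a n w = exp (of_nat n * w - of_real a * (of_nat n)\<^sup>2)"

text \<open>Translates by 2 pi i n of the Gaussian dual to the theta series. Taking w and -w
  together again gives all integers, with n = 0 counted twice.\<close>

definition gauss_half :: "real \<Rightarrow> nat \<Rightarrow> complex \<Rightarrow> complex" where
  "gauss_half a n w = exp ((w + 2 * of_real pi * \<i> * of_nat n)\<^sup>2 / (4 * of_real a))"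

lemma theta_half_bound:
  assumes "cmod w \<le> R"
  shows "cmod (theta_half a n w) \<le> exp (R * real n - a * (real n)\<^sup>2)"
proof -
  have "real n * Re w \<le> real n * R"
    using assms complex_Re_le_cmod[of w] by (intro mult_left_mono) auto
  moreover have "Re (of_nat n * w - of_real a * (of_nat n)\<^sup>2) = real n * Re w - a * (real n)\<^sup>2"
    by (simp add: power2_eq_square)
  ultimately show ?thesis by (simp add: theta_half_def norm_exp_eq_Re mult.commute)
qed

lemma Re_gauss_exponent:
  "Re ((w + 2 * of_real pi * \<i> * of_nat n)\<^sup>2 / (4 * of_real a)) = ((Re w)\<^sup>2 - (Im w + 2 * pi * real n)\<^sup>2) / (4 * a)"
proof -
  have "(w + 2 * of_real pi * \<i> * of_nat n)\<^sup>2 / (4 * of_real a) = (w + 2 * of_real pi * \<i> * of_nat n)\<^sup>2 / of_real (4 * a)"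
    by simp
  then show ?thesis by (simp only: Re_divide_of_real) (simp add: power2_eq_square)
qed

text \<open>The translation is imaginary, so its square contributes Gaussian decay in n; the cross
  term is only linear in n and is controlled by R.\<close>

lemma gauss_half_bound:
  assumes "a > 0" "cmod w \<le> R"
  shows "cmod (gauss_half a n w) \<le> exp (R\<^sup>2 / (4 * a)) * exp ((pi * R / a) * real n - (pi\<^sup>2 / a) * (real n)\<^sup>2)"
proof -
  have "(Re w)\<^sup>2 \<le> R\<^sup>2" using assms abs_Re_le_cmod[of w] by (intro power2_le_iff_abs_le[THEN iffD2]) auto
  moreover have R: "- R \<le> Im w" using assms(2) abs_Im_le_cmod[of w] by linarith
  have "real n * (- R) \<le> real n * Im w" by (rule mult_left_mono[OF R]) simp
  then have "4 * pi * (real n * (- R)) \<le> 4 * pi * (real n * Im w)" by (rule mult_left_mono) simp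
  then have "0 \<le> 4 * pi * R * real n + 4 * pi * real n * Im w" by (simp add: mult_ac)
  moreover have "(Im w + 2 * pi * real n)\<^sup>2 = (Im w)\<^sup>2 + 4 * pi * real n * Im w + 4 * pi\<^sup>2 * (real n)\<^sup>2"
    by (simp add: power2_eq_square algebra_simps)
  moreover note zero_le_power2[of "Im w"]
  ultimately have "(Re w)\<^sup>2 - (Im w + 2 * pi * real n)\<^sup>2 \<le> R\<^sup>2 + 4 * pi * R * real n - 4 * pi\<^sup>2 * (real n)\<^sup>2"
    by linarith
  then have "((Re w)\<^sup>2 - (Im w + 2 * pi * real n)\<^sup>2) / (4 * a) \<le> (R\<^sup>2 + 4 * pi * R * real n - 4 * pi\<^sup>2 * (real n)\<^sup>2) / (4 * a)"
    using assms by (intro divide_right_mono) auto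
  also have "\<dots> = R\<^sup>2 / (4 * a) + ((pi * R / a) * real n - (pi\<^sup>2 / a) * (real n)\<^sup>2)"
    using assms by (simp add: field_simps)
  finally show ?thesis
    by (simp only: gauss_half_def norm_exp_eq_Re Re_gauss_exponent exp_add[symmetric]) simp
qed

lemma theta_half_deriv:
  "(theta_half a n has_field_derivative of_nat n * theta_half a n w) (at w)"
  unfolding theta_half_def[abs_def] by (auto intro!: derivative_eq_intros)

lemma gauss_half_deriv:
  assumes "a > 0"
  shows "(gauss_half a n has_field_derivative
    (w + 2 * of_real pi * \<i> * of_nat n) / (2 * of_real a) * gauss_half a n w) (at w)"
  unfolding gauss_half_def[abs_def] using assms
  by (auto intro!: derivative_eq_intros simp: field_simps)

text \<open>Summable majorants on unit balls permit termwise differentiation, so the sum is entire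
  and its derivative carries the weights n.\<close>

lemma theta_half_series:
  assumes "a > 0"
  obtains T T' where "\<And>w. (\<lambda>n. theta_half a n w) sums T w"
    "\<And>w. (\<lambda>n. of_nat n * theta_half a n w) sums T' w"
    "\<And>w. (T has_field_derivative T' w) (at w)"
proof -
  have "\<exists>g g'. \<forall>x\<in>UNIV. (\<lambda>n. theta_half a n x) sums g x \<and>
      (\<lambda>n. of_nat n * theta_half a n x) sums g' x \<and> (g has_field_derivative g' x) (at x)"
  proof (rule series_and_derivative_comparison_local[OF open_UNIV theta_half_deriv])
    fix x :: complex
    have "cmod y \<le> cmod x + 1" if "y \<in> ball x 1" for y
      using that norm_triangle_ineq2[of y x] by (simp add: dist_norm norm_minus_commute)
    then show "\<exists>d h. 0 < d \<and> summable h \<and> (\<forall>\<^sub>F n in sequentially. \<forall>y\<in>ball x d \<inter> UNIV. norm (theta_half a n y) \<le> h n)"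
      by (intro exI[of _ 1] exI[of _ "\<lambda>n. exp ((cmod x + 1) * real n - a * (real n)\<^sup>2)"])
         (auto intro!: summable_exp_quadratic always_eventually theta_half_bound assms)
  qed
  then show ?thesis using that by blast
qed

lemma gauss_half_series:
  assumes "a > 0"
  obtains G G' where "\<And>w. (\<lambda>n. gauss_half a n w) sums G w"
    "\<And>w. (\<lambda>n. (w + 2 * of_real pi * \<i> * of_nat n) / (2 * of_real a) * gauss_half a n w) sums G' w"
    "\<And>w. (G has_field_derivative G' w) (at w)"
proof -
  have "\<exists>g g'. \<forall>x\<in>UNIV. (\<lambda>n. gauss_half a n x) sums g x \<and>
      (\<lambda>n. (x + 2 * of_real pi * \<i> * of_nat n) / (2 * of_real a) * gauss_half a n x) sums g' x \<and> (g has_field_derivative g' x) (at x)"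
  proof (rule series_and_derivative_comparison_local[OF open_UNIV gauss_half_deriv[OF assms]])
    fix x :: complex
    have "cmod y \<le> cmod x + 1" if "y \<in> ball x 1" for y
      using that norm_triangle_ineq2[of y x] by (simp add: dist_norm norm_minus_commute)
    then show "\<exists>d h. 0 < d \<and> summable h \<and> (\<forall>\<^sub>F n in sequentially. \<forall>y\<in>ball x d \<inter> UNIV. norm (gauss_half a n y) \<le> h n)"
      using assms
      by (intro exI[of _ 1] exI[of _ "\<lambda>n. exp ((cmod x + 1)\<^sup>2 / (4 * a)) * exp ((pi * (cmod x + 1) / a) * real n - (pi\<^sup>2 / a) * (real n)\<^sup>2)"]
           conjI summable_mult summable_exp_quadratic always_eventually allI ballI gauss_half_bound) auto
  qed
  then show ?thesis using that by blast
qed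

section \<open>Poisson summation\<close>

text \<open>The substitution y = sqrt (2a) x turns the integral into the characteristic function of
  the standard normal distribution.\<close>

lemma gaussian_fourier_lborel:
  fixes a :: real and j :: real
  assumes a: "a > 0"
  shows "(LBINT y. of_real (exp (- y\<^sup>2 / (4 * a))) * cis (j * y)) = of_real (sqrt (4 * pi * a) * exp (- a * j\<^sup>2))"
    and "integrable lborel (\<lambda>y. complex_of_real (exp (- y\<^sup>2 / (4 * a))) * cis (j * y))"
proof -
  define s where "s = sqrt (2 * a)"
  have s: "s > 0" "s\<^sup>2 = 2 * a" using a by (auto simp: s_def)
  let ?f = "\<lambda>y. complex_of_real (exp (- y\<^sup>2 / (4 * a))) * cis (j * y)"
  have [measurable]: "cis \<in> borel_measurable borel"
    by (intro borel_measurable_continuous_onI continuous_intros)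
  have int: "integrable lborel (\<lambda>x. std_normal_density x *\<^sub>R cis (j * s * x))"
    by (rule Bochner_Integration.integrable_bound[OF integrable_normal_moment[of 1 0 0]])
       (auto simp: normal_density_nonneg )
  have eq: "?f (0 + s * x) = of_real (sqrt (2 * pi)) * (std_normal_density x *\<^sub>R cis (j * s * x))" for x
  proof -
    have "(s * x)\<^sup>2 / (4 * a) = x\<^sup>2 / 2" using s a by (simp add: power_mult_distrib)
    then show ?thesis by (simp add: std_normal_density_def scaleR_conv_of_real mult_ac)
  qed
  have "(CLBINT x. std_normal_density x *\<^sub>R cis (j * s * x)) = char std_normal_distribution (j * s)"
    unfolding char_def by (subst integral_density) (auto simp: normal_density_nonneg cis_conv_exp)
  also have "\<dots> = of_real (exp (- a * j\<^sup>2))"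
    using s by (simp add: char_std_normal_distribution power_mult_distrib)
  finally have c: "(CLBINT x. std_normal_density x *\<^sub>R cis (j * s * x)) = of_real (exp (- a * j\<^sup>2))" .
  have i: "integrable lborel (\<lambda>x. ?f (0 + s * x))"
    unfolding eq by (intro integrable_mult_right int)
  show "integrable lborel ?f"
    using lborel_integrable_real_affine_iff[of s ?f 0] i s by simp
  have "(LBINT y. ?f y) = s *\<^sub>R (LBINT x. ?f (0 + s * x))"
    using s by (subst lborel_integral_real_affine[of s _ 0]) auto
  also have "\<dots> = of_real (s * sqrt (2 * pi) * exp (- a * j\<^sup>2))"
    unfolding eq by (subst integral_mult_right_zero, subst c) (simp add: scaleR_conv_of_real)
  also have "s * sqrt (2 * pi) = sqrt (4 * pi * a)"
    unfolding s_def by (simp add: real_sqrt_mult[symmetric])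
  finally show "(LBINT y. ?f y) = of_real (sqrt (4 * pi * a) * exp (- a * j\<^sup>2))" .
qed

lemma integral_cis_period:
  "integral {0..2*pi} (\<lambda>y. cis (of_int j * y)) = (if j = 0 then of_real (2 * pi) else 0)"
proof (cases "j = 0")
  case False
  have "((\<lambda>y. cis (of_int j * y)) has_integral (cis (of_int j * (2*pi)) / (\<i> * of_int j) - cis (of_int j * 0) / (\<i> * of_int j))) {0..2*pi}"
  proof (rule fundamental_theorem_of_calculus)
    fix x :: real
    have "((\<lambda>z. exp (\<i> * of_int j * z) / (\<i> * of_int j)) has_field_derivative exp (\<i> * of_int j * of_real x)) (at (of_real x))"
      using False by (auto intro!: derivative_eq_intros)
    from has_vector_derivative_real_field[OF this]
    show "((\<lambda>y. cis (of_int j * y) / (\<i> * of_int j)) has_vector_derivative cis (of_int j * x)) (at x within {0..2*pi})"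
      by (simp add: cis_conv_exp o_def mult_ac)
  qed simp
  moreover have "cis (of_int j * (2*pi)) = 1"
    using cis_multiple_2pi[of "of_int j"] by (simp add: mult_ac)
  ultimately show ?thesis using False by (simp add: integral_unique)
qed (simp add: scaleR_conv_of_real)

lemma sums_integral_m_test:
  fixes f :: "nat \<Rightarrow> real \<Rightarrow> complex"
  assumes cont: "\<And>n. continuous_on {a..b} (f n)"
    and bound: "\<And>n y. y \<in> {a..b} \<Longrightarrow> norm (f n y) \<le> M n" and M: "summable M"
    and sums: "\<And>y. y \<in> {a..b} \<Longrightarrow> (\<lambda>n. f n y) sums F y"
  shows "(\<lambda>n. integral {a..b} (f n)) sums integral {a..b} F"
proof -
  have "uniform_limit {a..b} (\<lambda>n x. \<Sum>i<n. f i x) (\<lambda>x. \<Sum>i. f i x) sequentially"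
    by (rule Weierstrass_m_test[OF bound M])
  then have "uniform_limit {a..b} (\<lambda>n x. \<Sum>i<n. f i x) F sequentially"
    by (rule uniform_limit_cong'[THEN iffD1, rotated -1]) (auto simp: sums[THEN sums_unique, symmetric])
  from uniform_limit_integral[OF this]
  obtain I J where I: "\<And>n. ((\<lambda>x. \<Sum>i<n. f i x) has_integral I n) {a..b}" and J: "(F has_integral J) {a..b}"
    and lim: "I \<longlonglongrightarrow> J"
    using cont by (auto intro!: continuous_intros)
  have "I = (\<lambda>n. \<Sum>i<n. integral {a..b} (f i))"
  proof
    fix n show "I n = (\<Sum>i<n. integral {a..b} (f i))"
    using I[of n, THEN integral_unique]
    by (subst (asm) integral_sum) (auto intro!: integrable_continuous_interval cont)
  qed
  then show ?thesis using lim J by (simp add: sums_def integral_unique[OF J])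
qed


lemma theta_half_ii: "theta_half a n (\<i> * of_real y) = of_real (exp (- a * (real n)\<^sup>2)) * cis (of_nat n * y)"
proof -
  have "of_nat n * (\<i> * of_real y) - of_real a * (of_nat n)\<^sup>2 = of_real (- a * (real n)\<^sup>2) + \<i> * of_real (of_nat n * y)"
    by simp
  then show ?thesis unfolding theta_half_def by (simp only: exp_add cis_conv_exp exp_of_real)
qed

lemma gauss_half_ii: "gauss_half a n (\<i> * of_real y) = of_real (exp (- (y + 2 * pi * real n)\<^sup>2 / (4 * a)))"
proof -
  have "(\<i> * of_real y + 2 * of_real pi * \<i> * of_nat n)\<^sup>2 / (4 * of_real a) = of_real (- (y + 2 * pi * real n)\<^sup>2 / (4 * a))"
    by (simp add: power2_eq_square field_simps)
  then show ?thesis unfolding gauss_half_def by (simp only: exp_of_real)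
qed

text \<open>The sign s treats T at iy and at -iy at once. Orthogonality leaves the single index n =
  -s j, which is a natural number exactly when s j <= 0.\<close>

lemma theta_half_fourier:
  assumes a: "a > 0" and T: "\<And>w. (\<lambda>n. theta_half a n w) sums T w" and s: "s = 1 \<or> s = -1"
  shows "integral {0..2*pi} (\<lambda>y. T (\<i> * of_real (of_int s * y)) * cis (of_int j * y)) =
           (if s * j \<le> 0 then of_real (2 * pi * exp (- a * (of_int j)\<^sup>2)) else 0)"
proof -
  let ?f = "\<lambda>n y. theta_half a n (\<i> * of_real (of_int s * y)) * cis (of_int j * y)"
  have f: "?f n y = of_real (exp (- a * (real n)\<^sup>2)) * cis (of_int (s * int n + j) * y)" for n y
    by (simp only: theta_half_ii mult.assoc cis_mult) (simp add: algebra_simps)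
  have "(\<lambda>n. integral {0..2*pi} (?f n)) sums integral {0..2*pi} (\<lambda>y. T (\<i> * of_real (of_int s * y)) * cis (of_int j * y))"
  proof (rule sums_integral_m_test)
    show "continuous_on {0..2*pi} (?f n)" for n unfolding f by (intro continuous_intros)
    show "norm (?f n y) \<le> exp (0 * real n - a * (real n)\<^sup>2)" for n y unfolding f by (simp add: norm_mult)
    show "summable (\<lambda>n. exp (0 * real n - a * (real n)\<^sup>2))" by (rule summable_exp_quadratic[OF a])
    show "(\<lambda>n. ?f n y) sums (T (\<i> * of_real (of_int s * y)) * cis (of_int j * y))" for y by (intro sums_mult2 T)
  qed
  moreover have "integral {0..2*pi} (?f n) = (if s * int n + j = 0 then of_real (2 * pi * exp (- a * (real n)\<^sup>2)) else 0)" for n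
    unfolding f by (simp only: integral_mult_right integral_cis_period) simp
  moreover have "(\<lambda>n. if s * int n + j = 0 then of_real (2 * pi * exp (- a * (real n)\<^sup>2)) else (0::complex))
     sums (if s * j \<le> 0 then of_real (2 * pi * exp (- a * (of_int j)\<^sup>2)) else 0)"
  proof (cases "s * j \<le> 0")
    case True
    then have n: "(s * int n + j = 0) = (n = nat (- s * j))" for n using s by auto
    have "(real (nat (- s * j)))\<^sup>2 = (of_int j)\<^sup>2" using True s by auto
    then show ?thesis using True sums_single[of "nat (- s * j)" "\<lambda>n. complex_of_real (2 * pi * exp (- a * (real n)\<^sup>2))"]
      unfolding n by simp
  next
    case False
    then have n: "(s * int n + j = 0) = False" for n using s by auto
    show ?thesis using False unfolding n by simp
  qed
  ultimately show ?thesis using sums_unique2 by (simp only:)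
qed

text \<open>Unfolding: \<open>cis (of_int j * y)\<close> has period 2 pi, so each translate
  contributes the integral of one fixed function g over one window of length 2 pi. The windows tile
  the line, and what results is the Fourier transform of a Gaussian.\<close>

lemma gauss_half_fourier:
  assumes a: "a > 0" and G: "\<And>w. (\<lambda>n. gauss_half a n w) sums G w"
    and Gc: "continuous_on UNIV G"
  shows "integral {0..2*pi} (\<lambda>y. (G (\<i> * of_real y) + G (- (\<i> * of_real y)) - gauss_half a 0 (\<i> * of_real y)) * cis (of_int j * y)) =
           of_real (sqrt (4 * pi * a) * exp (- a * (of_int j)\<^sup>2))"
proof -
  define g where "g = (\<lambda>y::real. complex_of_real (exp (- y\<^sup>2 / (4 * a))) * cis (of_int j * y))"
  have gc: "continuous_on S g" for S unfolding g_def using a by (intro continuous_intros) auto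
  have gi: "g integrable_on {x..y}" for x y by (rule integrable_continuous_interval[OF gc])
  have per: "cis (of_int j * (y + 2 * pi * of_int k)) = cis (of_int j * y)" for y k
    using cis_multiple_2pi[of "of_int (j * k)"] by (simp add: ring_distribs mult_ac flip: cis_mult)
  have f1: "gauss_half a n (\<i> * of_real y) * cis (of_int j * y) = g (y + 2 * pi * real n)" for n y
    using per[of y "int n"] by (simp add: gauss_half_ii g_def)
  have f2: "gauss_half a n (- (\<i> * of_real y)) * cis (of_int j * y) = g (y + - (2 * pi * real n))" for n y
    using per[of y "- int n"] gauss_half_ii[of a n "-y"] by (simp add: g_def power2_commute)
  let ?I = "\<lambda>n. integral {0..2*pi} (\<lambda>y. g (y + 2 * pi * real n)) + integral {0..2*pi} (\<lambda>y. g (y + - (2 * pi * real n)))"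
  have bound: "cmod (gauss_half a n w) \<le> exp ((2*pi)\<^sup>2 / (4 * a)) * exp ((pi * (2*pi) / a) * real n - (pi\<^sup>2 / a) * (real n)\<^sup>2)"
    if "cmod w \<le> 2 * pi" for n w by (rule gauss_half_bound[OF a that])
  have sm: "summable (\<lambda>n. exp ((2*pi)\<^sup>2 / (4 * a)) * exp ((pi * (2*pi) / a) * real n - (pi\<^sup>2 / a) * (real n)\<^sup>2))"
    using a by (intro summable_mult summable_exp_quadratic) auto
  have s1: "(\<lambda>n. integral {0..2*pi} (\<lambda>y. g (y + 2 * pi * real n))) sums integral {0..2*pi} (\<lambda>y. G (\<i> * of_real y) * cis (of_int j * y))"
  proof (rule sums_integral_m_test[OF _ _ sm])
    show "continuous_on {0..2*pi} (\<lambda>y. g (y + 2 * pi * real n))" for n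
      by (intro continuous_on_compose2[OF gc] continuous_intros) auto
    show "norm (g (y + 2 * pi * real n)) \<le> exp ((2*pi)\<^sup>2 / (4 * a)) * exp ((pi * (2*pi) / a) * real n - (pi\<^sup>2 / a) * (real n)\<^sup>2)"
      if "y \<in> {0..2*pi}" for n y
      unfolding f1[symmetric] norm_mult using that bound[of "\<i> * of_real y"] by (simp add: norm_mult)
    show "(\<lambda>n. g (y + 2 * pi * real n)) sums (G (\<i> * of_real y) * cis (of_int j * y))" for y
      unfolding f1[symmetric] by (intro sums_mult2 G)
  qed
  have s2: "(\<lambda>n. integral {0..2*pi} (\<lambda>y. g (y + - (2 * pi * real n)))) sums integral {0..2*pi} (\<lambda>y. G (- (\<i> * of_real y)) * cis (of_int j * y))"
  proof (rule sums_integral_m_test[OF _ _ sm])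
    show "continuous_on {0..2*pi} (\<lambda>y. g (y + - (2 * pi * real n)))" for n
      by (intro continuous_on_compose2[OF gc] continuous_intros) auto
    show "norm (g (y + - (2 * pi * real n))) \<le> exp ((2*pi)\<^sup>2 / (4 * a)) * exp ((pi * (2*pi) / a) * real n - (pi\<^sup>2 / a) * (real n)\<^sup>2)"
      if "y \<in> {0..2*pi}" for n y
      unfolding f2[symmetric] norm_mult using that bound[of "- (\<i> * of_real y)"] by (simp add: norm_mult)
    show "(\<lambda>n. g (y + - (2 * pi * real n))) sums (G (- (\<i> * of_real y)) * cis (of_int j * y))" for y
      unfolding f2[symmetric] by (intro sums_mult2 G)
  qed
  have I: "?I n = integral {2 * pi * real n..2 * pi * real (Suc n)} g + integral {- 2 * pi * real n..- 2 * pi * real n + 2 * pi} g" for n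
    using integral_shift_real_ivl[of "2 * pi * real n" "2 * pi * real n" "2 * pi * real (Suc n)" g]
      integral_shift_real_ivl[of "- (2 * pi * real n)" "- (2 * pi * real n)" "- 2 * pi * real n + 2 * pi" g]
    by (simp add: algebra_simps)
  \<comment> \<open>The windows of the two half sums coincide only for n = 0. The extra copy of
    [0, 2 pi] is what subtracting \<open>gauss_half a 0\<close> removes.\<close>
  have part: "(\<Sum>n<Suc N. ?I n) = integral {- 2 * pi * real N..2 * pi * real (Suc N)} g + integral {0..2*pi} g" for N
  proof (induction N)
    case 0
    then show ?case by simp
  next
    case (Suc N)
    have "integral {- 2 * pi * real (Suc N)..- 2 * pi * real N} g + integral {- 2 * pi * real N..2 * pi * real (Suc N)} g
        = integral {- 2 * pi * real (Suc N)..2 * pi * real (Suc N)} g"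
      by (intro Henstock_Kurzweil_Integration.integral_combine gi) (auto simp: algebra_simps intro: order_trans[of _ 0])
    moreover have "integral {- 2 * pi * real (Suc N)..2 * pi * real (Suc N)} g + integral {2 * pi * real (Suc N)..2 * pi * real (Suc (Suc N))} g
        = integral {- 2 * pi * real (Suc N)..2 * pi * real (Suc (Suc N))} g"
      by (intro Henstock_Kurzweil_Integration.integral_combine gi) (auto simp: algebra_simps intro: order_trans[of _ 0])
    moreover have "- 2 * pi * real (Suc N) + 2 * pi = - 2 * pi * real N" by (simp add: algebra_simps)
    ultimately show ?case by (subst sum.lessThan_Suc, subst Suc, subst I) (simp only: add_ac)
  qed
  have gint: "integrable lborel g" unfolding g_def by (rule gaussian_fourier_lborel(2)[OF a])
  have "(\<lambda>N. LBINT y. indicator {- 2 * pi * real N..2 * pi * real (Suc N)} y *\<^sub>R g y) \<longlonglongrightarrow> (LBINT y. g y)"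
  proof (rule integral_dominated_convergence[where w="\<lambda>y. norm (g y)"])
    show "AE x in lborel. (\<lambda>N. indicator {- 2 * pi * real N..2 * pi * real (Suc N)} x *\<^sub>R g x) \<longlonglongrightarrow> g x"
    proof (rule AE_I2, rule tendsto_eventually)
      fix x :: real
      obtain N0 :: nat where "\<bar>x\<bar> < real N0" using reals_Archimedean2 by blast
      show "\<forall>\<^sub>F N in sequentially. indicator {- 2 * pi * real N..2 * pi * real (Suc N)} x *\<^sub>R g x = g x"
        using eventually_ge_at_top[of N0]
      proof eventually_elim
        case (elim N)
        have "1 * real N \<le> 2 * pi * real N" using pi_gt3 by (intro mult_right_mono) auto
        moreover have "2 * pi * real N \<le> 2 * pi * real (Suc N)" by (intro mult_left_mono) auto
        moreover have "real N0 \<le> real N" using elim by simp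
        ultimately have "x \<in> {- 2 * pi * real N..2 * pi * real (Suc N)}" using \<open>\<bar>x\<bar> < real N0\<close>
          unfolding atLeastAtMost_iff by linarith
        then show ?case by (simp only: indicator_simps scaleR_one)
      qed
    qed
  qed (use gint in \<open>auto simp: indicator_def intro!: borel_measurable_continuous_onI gc\<close>)
  moreover have "(LBINT y. indicator {x..z} y *\<^sub>R g y) = integral {x..z} g" for x z
  proof -
    have "set_integrable lborel {x..z} g"
      unfolding set_integrable_def by (rule integrable_mult_indicator[OF _ gint]) simp
    from set_borel_integral_eq_integral(2)[OF this] show ?thesis unfolding set_lebesgue_integral_def .
  qed
  ultimately have lim: "(\<lambda>N. integral {- 2 * pi * real N..2 * pi * real (Suc N)} g) \<longlonglongrightarrow> (LBINT y. g y)" by simp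
  have "(\<lambda>N. \<Sum>n<Suc N. ?I n) \<longlonglongrightarrow> (LBINT y. g y) + integral {0..2*pi} g"
    unfolding part by (intro tendsto_intros lim)
  then have "?I sums ((LBINT y. g y) + integral {0..2*pi} g)" unfolding sums_def
    by (subst (asm) filterlim_sequentially_Suc)
  from sums_unique2[OF this sums_add[OF s1 s2]]
  have e1: "(LBINT y. g y) + integral {0..2*pi} g = integral {0..2*pi} (\<lambda>y. G (\<i> * of_real y) * cis (of_int j * y)) +
    integral {0..2*pi} (\<lambda>y. G (- (\<i> * of_real y)) * cis (of_int j * y))" .
  have e2: "integral {0..2*pi} (\<lambda>y. (G (\<i> * of_real y) + G (- (\<i> * of_real y)) - gauss_half a 0 (\<i> * of_real y)) * cis (of_int j * y))
    = integral {0..2*pi} (\<lambda>y. G (\<i> * of_real y) * cis (of_int j * y)) +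
      integral {0..2*pi} (\<lambda>y. G (- (\<i> * of_real y)) * cis (of_int j * y)) - integral {0..2*pi} g"
  proof -
    have c: "(\<lambda>y. G (\<i> * of_real y) * cis (of_int j * y)) integrable_on {0..2*pi}"
      "(\<lambda>y. G (- (\<i> * of_real y)) * cis (of_int j * y)) integrable_on {0..2*pi}"
      by (intro integrable_continuous_interval continuous_intros continuous_on_compose2[OF Gc]; simp)+
    have "(\<lambda>y. (G (\<i> * of_real y) + G (- (\<i> * of_real y)) - gauss_half a 0 (\<i> * of_real y)) * cis (of_int j * y))
     = (\<lambda>y. G (\<i> * of_real y) * cis (of_int j * y) + G (- (\<i> * of_real y)) * cis (of_int j * y) - g y)"
      using f1[of 0] by (simp add: ring_distribs)
    then show ?thesis
      by (simp only: integral_diff[OF integrable_add[OF c] gi] integral_add[OF c])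
  qed
  have e3: "(LBINT y. g y) = of_real (sqrt (4 * pi * a) * exp (- a * (of_int j)\<^sup>2))"
    unfolding g_def by (rule gaussian_fourier_lborel(1)[OF a])
  show ?thesis unfolding e2 e1[symmetric] e3 by simp
qed

lemma theta_half_periodic: "theta_half a n (w + 2 * of_real pi * \<i>) = theta_half a n w"
  and theta_half_periodic': "theta_half a n (w - 2 * of_real pi * \<i>) = theta_half a n w"
proof -
  have "exp (of_nat n * (2 * of_real pi * \<i>)) = (1::complex)"
    by (simp add: exp_of_nat_mult exp_two_pi_i)
  then show "theta_half a n (w + 2 * of_real pi * \<i>) = theta_half a n w" "theta_half a n (w - 2 * of_real pi * \<i>) = theta_half a n w"
    by (simp_all add: theta_half_def ring_distribs exp_add exp_diff)
qed

lemma poisson_gaussian_derivative: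
  fixes w :: complex
  assumes a: "a > 0"
  defines "D \<equiv> \<lambda>n w. (w + 2 * of_real pi * \<i> * of_nat n) / (2 * of_real a) * gauss_half a n w"
  obtains L M where "(\<lambda>n. of_nat n * theta_half a n w) sums L" "(\<lambda>n. of_nat n * theta_half a n (-w)) sums M"
    "summable (\<lambda>n. D n w)" "summable (\<lambda>n. D n (-w))"
    "L - M = of_real (sqrt (pi / a)) * ((\<Sum>n. D n w) - (\<Sum>n. D n (-w)) - D 0 w)"
proof -
  obtain T T' where T: "\<And>w. (\<lambda>n. theta_half a n w) sums T w"
    "\<And>w. (\<lambda>n. of_nat n * theta_half a n w) sums T' w"
    "\<And>w. (T has_field_derivative T' w) (at w)" using theta_half_series[OF a] by blast
  obtain G G' where G: "\<And>w. (\<lambda>n. gauss_half a n w) sums G w"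
    "\<And>w. (\<lambda>n. D n w) sums G' w"
    "\<And>w. (G has_field_derivative G' w) (at w)" using gauss_half_series[OF a] unfolding D_def by blast
  let ?E = "gauss_half a 0"
  define c where "c = complex_of_real (sqrt (pi / a))"
  \<comment> \<open>Two-sided theta series minus c times the two-sided Gaussian sum; 1 and
    \<open>?E w\<close> remove the doubled terms n = 0. The factor c matches the Fourier
    coefficients 2 pi exp (-a j^2) and sqrt (4 pi a) exp (-a j^2).\<close>
  define F where "F = (\<lambda>w. T w + T (-w) - 1 - c * (G w + G (-w) - ?E w))"
  have minus: "((\<lambda>w. H (- w)) has_field_derivative H' (- w) * - 1) (at w)"
    if "\<And>w. (H has_field_derivative H' w) (at w)" for H H' :: "complex \<Rightarrow> complex" and w
    by (rule DERIV_chain2[OF that DERIV_minus[OF DERIV_ident]])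
  have dF: "(F has_field_derivative (T' w - T' (-w) - c * (G' w - G' (-w) - D 0 w))) (at w)" for w
  proof -
    have "(F has_field_derivative (T' w + T' (-w) * - 1 - 0 - c * (G' w + G' (-w) * - 1 - D 0 w))) (at w)"
      unfolding F_def D_def
      by (intro DERIV_diff DERIV_add DERIV_const DERIV_cmult T(3) G(3) minus gauss_half_deriv[OF a])
    then show ?thesis by (simp add: algebra_simps)
  qed
  have Tc: "continuous_on UNIV T" and Gc: "continuous_on UNIV G" and Fc: "continuous_on UNIV F"
    by (rule DERIV_continuous_on, rule has_field_derivative_at_within, rule T(3) G(3) dF)+
  have Tp: "T (w + 2 * of_real pi * \<i>) = T w" "T (w - 2 * of_real pi * \<i>) = T w" for w
    using sums_unique2[OF T(1)[of "w + 2 * of_real pi * \<i>"]] sums_unique2[OF T(1)[of "w - 2 * of_real pi * \<i>"]] T(1)[of w]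
    by (simp_all add: theta_half_periodic theta_half_periodic')
  have Gs: "gauss_half a n (w + 2 * of_real pi * \<i>) = gauss_half a (Suc n) w"
    "gauss_half a (Suc n) (w - 2 * of_real pi * \<i>) = gauss_half a n w" for n w
    by (simp_all add: gauss_half_def algebra_simps)
  \<comment> \<open>The shift by 2 pi i drops the first term of G w, and G (-w) gains one; only the
    combination in F is periodic.\<close>
  have Gp: "G (w + 2 * of_real pi * \<i>) = G w - ?E w" for w
  proof -
    have "(\<lambda>n. gauss_half a (Suc n) w) sums G (w + 2 * of_real pi * \<i>)" using G(1)[of "w + 2 * of_real pi * \<i>"] by (simp add: Gs)
    moreover have "(\<lambda>n. gauss_half a (Suc n) w) sums (G w - ?E w)"
      by (subst sums_Suc_iff) (simp add: G(1))
    ultimately show ?thesis by (rule sums_unique2)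
  qed
  have E: "?E (-w) = ?E w" for w by (simp add: gauss_half_def)
  have Fp: "F (w + 2 * of_real pi * \<i>) = F w" for w
  proof -
    have "G (- (w + 2 * of_real pi * \<i>)) = G (-w) + ?E (w + 2 * of_real pi * \<i>)"
      using Gp[of "- (w + 2 * of_real pi * \<i>)"] E[of "w + 2 * of_real pi * \<i>"] by simp
    moreover have "T (- (w + 2 * of_real pi * \<i>)) = T (-w)"
      using Tp(2)[of "-w"] by (simp add: algebra_simps)
    ultimately show ?thesis unfolding F_def by (simp only: Gp Tp) simp
  qed
  have zero: "F (\<i> * of_real y) = 0" for y
  proof (rule fourier_unique[of "\<lambda>y. F (\<i> * of_real y)" y])
    show "continuous_on UNIV (\<lambda>y. F (\<i> * complex_of_real y))"
      by (intro continuous_on_compose2[OF Fc] continuous_intros) auto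
    show "F (\<i> * of_real (y + 2 * pi)) = F (\<i> * of_real y)" for y
      using Fp[of "\<i> * of_real y"] by (simp add: algebra_simps)
    fix j :: int
    let ?t = "\<lambda>s y. T (\<i> * of_real (of_int s * y)) * cis (of_int j * y)"
    let ?g = "\<lambda>y. (G (\<i> * of_real y) + G (- (\<i> * of_real y)) - ?E (\<i> * of_real y)) * cis (of_int j * y)"
    have i1: "?t s integrable_on {0..2*pi}" for s
      by (intro integrable_continuous_interval continuous_intros continuous_on_compose2[OF Tc]) auto
    have "continuous_on UNIV ?E" by (rule DERIV_continuous_on, rule has_field_derivative_at_within, rule gauss_half_deriv[OF a])
    then have "continuous_on {0..2*pi} (\<lambda>y. ?E (\<i> * of_real y))"
      by (rule continuous_on_compose2) (auto intro!: continuous_intros)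
    moreover have "continuous_on {0..2*pi} (\<lambda>y. G (\<i> * of_real y))" "continuous_on {0..2*pi} (\<lambda>y. G (- (\<i> * of_real y)))"
      by (rule continuous_on_compose2[OF Gc]; auto intro!: continuous_intros)+
    ultimately have i2: "?g integrable_on {0..2*pi}"
      by (intro integrable_continuous_interval continuous_on_mult continuous_on_add continuous_on_diff) (auto intro!: continuous_intros)
    have i3: "(\<lambda>y. cis (of_int j * y)) integrable_on {0..2*pi}"
      by (intro integrable_continuous_interval continuous_intros)
    have "(\<lambda>y. F (\<i> * of_real y) * cis (of_int j * y)) = (\<lambda>y. ?t 1 y + ?t (-1) y - cis (of_int j * y) - c * ?g y)"
      by (simp add: F_def algebra_simps)
    then have "integral {0..2*pi} (\<lambda>y. F (\<i> * of_real y) * cis (of_int j * y))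
      = integral {0..2*pi} (?t 1) + integral {0..2*pi} (?t (-1)) - integral {0..2*pi} (\<lambda>y. cis (of_int j * y)) - c * integral {0..2*pi} ?g"
      by (simp only: integral_diff[OF integrable_diff[OF integrable_add[OF i1 i1] i3] integrable_on_mult_right[OF i2]]
          integral_diff[OF integrable_add[OF i1 i1] i3] integral_add[OF i1 i1] integral_mult_right)
    also have "integral {0..2*pi} (?t 1) + integral {0..2*pi} (?t (-1)) - integral {0..2*pi} (\<lambda>y. cis (of_int j * y))
       = of_real (2 * pi * exp (- a * (of_int j)\<^sup>2))"
      by (subst (1 2) theta_half_fourier[OF a T(1)]) (auto simp: integral_cis_period)
    also have "c * integral {0..2*pi} ?g = of_real ((sqrt (pi / a) * sqrt (4 * pi * a)) * exp (- a * (of_int j)\<^sup>2))"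
      unfolding gauss_half_fourier[OF a G(1) Gc] c_def by simp
    also have "sqrt (pi / a) * sqrt (4 * pi * a) = 2 * pi"
    proof -
      have "sqrt (pi / a) * sqrt (4 * pi * a) = sqrt ((2 * pi)\<^sup>2)"
        unfolding real_sqrt_mult[symmetric] using a by (intro arg_cong[where f=sqrt]) (simp add: power2_eq_square)
      then show ?thesis by (simp only: real_sqrt_abs) simp
    qed
    finally show "integral {0..2*pi} (\<lambda>y. F (\<i> * of_real y) * cis (of_int j * y)) = 0" by simp
  qed
  \<comment> \<open>Zeros on the imaginary axis accumulate at 0, so the identity theorem
    applies.\<close>
  have F0: "F w = 0" for w
  proof (rule analytic_continuation[of F UNIV "range (\<lambda>y. \<i> * of_real y)" 0])
    show "F holomorphic_on UNIV" using dF by (auto simp: holomorphic_on_open)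
    show "0 islimpt range (\<lambda>y. \<i> * complex_of_real y)"
      unfolding islimpt_approachable
    proof (intro allI impI)
      fix e :: real assume "e > 0"
      then show "\<exists>x'\<in>range (\<lambda>y. \<i> * complex_of_real y). x' \<noteq> 0 \<and> dist x' 0 < e"
        by (intro bexI[of _ "\<i> * of_real (e / 2)"]) (use rangeI[of "\<lambda>y. \<i> * complex_of_real y" "e / 2"] in \<open>auto simp: norm_mult\<close>)
    qed
  qed (use zero in auto)
  have "F = (\<lambda>_. 0)" using F0 by auto
  then have "T' w - T' (-w) - c * (G' w - G' (-w) - D 0 w) = 0"
    using dF[of w] by (intro DERIV_unique[OF _ DERIV_const[of 0]]) auto
  then have "T' w - T' (-w) = c * (G' w - G' (-w) - D 0 w)" by simp
  with T(2) G(2)[of w] G(2)[of "-w"] show ?thesis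
    by (intro that[of "T' w" "T' (-w)"]) (auto simp: c_def sums_iff)
qed


section \<open>Characters of the spin representations\<close>


text \<open>The homogeneous form of the substitution that defines \<open>spin_rep\<close>; in this
  form the substitutions for g and h can be composed.\<close>

lemma spin_rep_homogeneous:
  assumes "k \<le> n"
  shows "(\<Sum>l\<le>n. spin_rep n g l k * (u ^ l * v ^ (n - l))) =
           (g $ 1 $ 1 * u + g $ 2 $ 1 * v) ^ k * (g $ 1 $ 2 * u + g $ 2 $ 2 * v) ^ (n - k)"
proof -
  let ?P = "[: g $ 2 $ 1, g $ 1 $ 1 :] ^ k * [: g $ 2 $ 2, g $ 1 $ 2 :] ^ (n - k)"
  let ?L = "\<lambda>v. \<Sum>l\<le>n. spin_rep n g l k * (u ^ l * v ^ (n - l))"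
  let ?R = "\<lambda>v. (g $ 1 $ 1 * u + g $ 2 $ 1 * v) ^ k * (g $ 1 $ 2 * u + g $ 2 $ 2 * v) ^ (n - k)"
  have "degree ?P \<le> degree ([: g $ 2 $ 1, g $ 1 $ 1 :] ^ k) + degree ([: g $ 2 $ 2, g $ 1 $ 2 :] ^ (n - k))"
    by (rule degree_mult_le)
  also have "\<dots> \<le> k + (n - k)"
    by (intro add_mono order_trans[OF degree_power_le]) auto
  finally have deg: "degree ?P \<le> n" using assms by simp
  have val: "poly ?P z = (\<Sum>l\<le>n. spin_rep n g l k * z ^ l)" for z
  proof -
    have "poly ?P z = (\<Sum>l\<le>degree ?P. coeff ?P l * z ^ l)" by (rule poly_altdef)
    also have "\<dots> = (\<Sum>l\<le>n. coeff ?P l * z ^ l)"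
      using deg by (intro sum.mono_neutral_left) (auto simp: coeff_eq_0)
    finally show ?thesis by (simp only: spin_rep_def)
  qed
  have ne: "?L v = ?R v" if v: "v \<noteq> 0" for v
  proof -
    have "?L v = v ^ n * (\<Sum>l\<le>n. spin_rep n g l k * (u / v) ^ l)"
      unfolding sum_distrib_left
    proof (intro sum.cong refl)
      fix l assume "l \<in> {..n}"
      then have "v ^ n = v ^ (n - l) * v ^ l" by (simp flip: power_add)
      then show "spin_rep n g l k * (u ^ l * v ^ (n - l)) = v ^ n * (spin_rep n g l k * (u / v) ^ l)"
        using v by (simp add: power_divide)
    qed
    also have "\<dots> = (v ^ k * v ^ (n - k)) * poly ?P (u / v)"
      unfolding val power_add[symmetric] using assms by simp
    also have "\<dots> = (v * (g $ 2 $ 1 + u / v * g $ 1 $ 1)) ^ k * (v * (g $ 2 $ 2 + u / v * g $ 1 $ 2)) ^ (n - k)"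
      by (simp add: power_mult_distrib)
    also have "v * (g $ 2 $ 1 + u / v * g $ 1 $ 1) = g $ 1 $ 1 * u + g $ 2 $ 1 * v" using v by (simp add: field_simps)
    also have "v * (g $ 2 $ 2 + u / v * g $ 1 $ 2) = g $ 1 $ 2 * u + g $ 2 $ 2 * v" using v by (simp add: field_simps)
    finally show ?thesis .
  qed
  \<comment> \<open>For v = 0 the dehomogenisation by v^n fails; both sides are polynomials in v, so
    the identity survives the limit.\<close>
  show ?thesis
  proof (cases "v = 0")
    case True
    have "?L \<midarrow>0\<rightarrow> ?L 0" "?R \<midarrow>0\<rightarrow> ?R 0" by (intro tendsto_intros)+
    moreover have "?L \<midarrow>0\<rightarrow> ?R 0"
      by (rule tendsto_cong[THEN iffD1, OF _ \<open>?R \<midarrow>0\<rightarrow> ?R 0\<close>]) (use ne in \<open>auto simp: eventually_at_filter\<close>)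
    ultimately show ?thesis using LIM_unique True by blast
  qed (use ne in auto)
qed

text \<open>g moves the point (z, 1) to (u, v). Expanding the monomials in u and v once more and
  comparing coefficients of powers of z gives the matrix product.\<close>

lemma spin_rep_mult:
  assumes "l \<le> n" "k \<le> n"
  shows "spin_rep n (g ** h) l k = (\<Sum>j\<le>n. spin_rep n g l j * spin_rep n h j k)"
proof -
  have "(\<Sum>l\<le>n. spin_rep n (g ** h) l k * z ^ l) = (\<Sum>l\<le>n. (\<Sum>j\<le>n. spin_rep n g l j * spin_rep n h j k) * z ^ l)" for z
  proof -
    define u where "u = g $ 1 $ 1 * z + g $ 2 $ 1"
    define v where "v = g $ 1 $ 2 * z + g $ 2 $ 2"
    have "(\<Sum>l\<le>n. spin_rep n (g ** h) l k * z ^ l) =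
        (h $ 1 $ 1 * u + h $ 2 $ 1 * v) ^ k * (h $ 1 $ 2 * u + h $ 2 $ 2 * v) ^ (n - k)"
      using spin_rep_homogeneous[OF assms(2), of "g ** h" z 1]
      by (simp add: matrix_matrix_mult_def sum_2 u_def v_def algebra_simps)
    also have "\<dots> = (\<Sum>j\<le>n. spin_rep n h j k * (u ^ j * v ^ (n - j)))"
      by (rule spin_rep_homogeneous[OF assms(2), symmetric])
    also have "\<dots> = (\<Sum>j\<le>n. spin_rep n h j k * (\<Sum>l\<le>n. spin_rep n g l j * z ^ l))"
      using spin_rep_homogeneous[of _ n g z 1] by (intro sum.cong) (auto simp: u_def v_def)
    also have "\<dots> = (\<Sum>l\<le>n. (\<Sum>j\<le>n. spin_rep n g l j * spin_rep n h j k) * z ^ l)"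
      unfolding sum_distrib_left sum_distrib_right by (subst sum.swap) (simp add: mult_ac)
    finally show ?thesis .
  qed
  then have "\<forall>l\<le>n. spin_rep n (g ** h) l k = (\<Sum>j\<le>n. spin_rep n g l j * spin_rep n h j k)"
    by (intro polyfun_eq_coeffs[THEN iffD1] allI)
  then show ?thesis using assms(1) by simp
qed

lemma spin_char_mult_commute: "spin_char n (g ** h) = spin_char n (h ** g)"
proof -
  have "spin_char n (g ** h) = (\<Sum>k\<le>n. \<Sum>j\<le>n. spin_rep n g k j * spin_rep n h j k)" for g h
    unfolding spin_char_def by (intro sum.cong) (auto simp: spin_rep_mult)
  from this[of g h] this[of h g] show ?thesis by (simp only:) (subst sum.swap, simp add: mult.commute)
qed

lemma spin_rep_diag:
  assumes "g $ 1 $ 2 = 0" "g $ 2 $ 1 = 0" "k \<le> n"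
  shows "spin_rep n g l k = (if l = k then (g $ 1 $ 1) ^ k * (g $ 2 $ 2) ^ (n - k) else 0)"
proof -
  have "[: 0, g $ 1 $ 1 :] = monom (g $ 1 $ 1) 1" by (simp add: monom_Suc monom_0)
  then have "[: g $ 2 $ 1, g $ 1 $ 1 :] ^ k * [: g $ 2 $ 2, g $ 1 $ 2 :] ^ (n - k)
    = smult ((g $ 2 $ 2) ^ (n - k)) (monom ((g $ 1 $ 1) ^ k) k)"
    using assms by (simp add: monom_power poly_const_pow)
  then show ?thesis by (simp add: spin_rep_def)
qed

lemma spin_rep_lower_diag:
  assumes "g $ 1 $ 2 = 0" "k \<le> n"
  shows "spin_rep n g k k = (g $ 1 $ 1) ^ k * (g $ 2 $ 2) ^ (n - k)"
proof -
  have "[: g $ 2 $ 1, g $ 1 $ 1 :] ^ k * [: g $ 2 $ 2, g $ 1 $ 2 :] ^ (n - k)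
    = smult ((g $ 2 $ 2) ^ (n - k)) ([: g $ 2 $ 1, g $ 1 $ 1 :] ^ k)"
    using assms by (simp add: poly_const_pow)
  then show ?thesis by (simp add: spin_rep_def coeff_linear_poly_power)
qed

lemma matrix_eq_2x2:
  fixes A B :: "complex^2^2"
  shows "A = B \<longleftrightarrow> A $ 1 $ 1 = B $ 1 $ 1 \<and> A $ 1 $ 2 = B $ 1 $ 2 \<and> A $ 2 $ 1 = B $ 2 $ 1 \<and> A $ 2 $ 2 = B $ 2 $ 2"
  by (auto simp: vec_eq_iff forall_2)

lemma mult_2x2:
  fixes A B :: "complex^2^2"
  shows "(A ** B) $ i $ j = A $ i $ 1 * B $ 1 $ j + A $ i $ 2 * B $ 2 $ j"
  by (simp add: matrix_matrix_mult_def sum_2)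

text \<open>Conjugation to triangular form, rather than diagonalisation, also covers the
  non-diagonalisable matrices with eigenvalue 1 or -1.\<close>

lemma spin_char_eigenvalue:
  assumes det: "det g = 1" and lam: "lam \<noteq> 0" and tr: "g $ 1 $ 1 + g $ 2 $ 2 = lam + inverse lam"
  shows "spin_char n g = (\<Sum>k\<le>n. lam ^ k * inverse lam ^ (n - k))"
proof -
  have tri: "spin_char n g = (\<Sum>k\<le>n. lam ^ k * inverse lam ^ (n - k))"
    if low: "g $ 1 $ 2 = 0" and det: "det g = 1" and tr: "g $ 1 $ 1 + g $ 2 $ 2 = lam + inverse lam" for g :: "complex^2^2"
  proof -
    have eq: "spin_char n g = (\<Sum>k\<le>n. (g $ 1 $ 1) ^ k * (g $ 2 $ 2) ^ (n - k))"
      unfolding spin_char_def using low by (intro sum.cong) (auto simp: spin_rep_lower_diag)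
    have d: "g $ 1 $ 1 * g $ 2 $ 2 = 1" using det low by (simp add: det_2)
    \<comment> \<open>The entry is a root of the characteristic polynomial, hence lam or its
      inverse, and the character sum is symmetric in the two.\<close>
    have "(g $ 1 $ 1 - lam) * (g $ 1 $ 1 - inverse lam) = g $ 1 $ 1 * g $ 1 $ 1 - (lam + inverse lam) * g $ 1 $ 1 + 1"
      using lam by (simp add: algebra_simps)
    also have "\<dots> = 0" using d by (simp add: tr[symmetric] algebra_simps)
    finally consider "g $ 1 $ 1 = lam" | "g $ 1 $ 1 = inverse lam" by auto
    then show ?thesis
    proof cases
      case 1
      then have "g $ 2 $ 2 = inverse lam" using tr by simp
      then show ?thesis using 1 eq by simp
    next
      case 2
      then have "g $ 2 $ 2 = lam" using tr by simp
      then have "spin_char n g = (\<Sum>k\<le>n. inverse lam ^ k * lam ^ (n - k))" using 2 eq by simp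
      also have "\<dots> = (\<Sum>k\<le>n. lam ^ k * inverse lam ^ (n - k))"
        by (rule sum.reindex_bij_witness[of _ "\<lambda>k. n - k" "\<lambda>k. n - k"]) (auto simp: mult.commute)
      finally show ?thesis .
    qed
  qed
  show ?thesis
  proof (cases "g $ 1 $ 2 = 0")
    case True then show ?thesis using tri det tr by blast
  next
    case False
    define b where "b = g $ 1 $ 2"
    define d where "d = lam - g $ 1 $ 1"
    define S :: "complex^2^2" where "S = vector [vector [0, b], vector [1, d]]"
    (* The second column of S is an eigenvector of g for lam, so U is lower triangular. *)
    define S' :: "complex^2^2" where "S' = vector [vector [- d / b, 1], vector [inverse b, 0]]"
    define U where "U = S' ** (g ** S)"
    have b: "b \<noteq> 0" using False by (simp add: b_def)
    have SS': "S ** S' = mat 1"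
      using b by (simp add: matrix_eq_2x2 mult_2x2 S_def S'_def mat_def divide_inverse)
    have "g = (g ** S) ** S'" by (simp add: SS' flip: matrix_mul_assoc)
    moreover have "spin_char n ((g ** S) ** S') = spin_char n U" unfolding U_def by (rule spin_char_mult_commute)
    ultimately have "spin_char n g = spin_char n U" by simp
    moreover have "det U = 1"
    proof -
      have "det (S ** S') = 1" by (simp add: SS')
      then have "det S * det S' = 1" by (simp add: det_mul)
      then show ?thesis using det by (simp add: U_def det_mul mult.commute)
    qed
    moreover have "U $ 1 $ 2 = 0"
    proof -
      have "U $ 1 $ 2 = - d * (g $ 1 $ 1 + d) + (b * g $ 2 $ 1 + g $ 2 $ 2 * d)"
      proof -
        have "(g ** S) $ 1 $ 2 = b * (g $ 1 $ 1 + d)" "(g ** S) $ 2 $ 2 = b * g $ 2 $ 1 + g $ 2 $ 2 * d"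
          unfolding S_def mult_2x2 vector_2 b_def[symmetric] by (simp_all add: algebra_simps)
        moreover have "S' $ 1 $ 1 = - d / b" "S' $ 1 $ 2 = 1" unfolding S'_def vector_2 by simp_all
        ultimately show ?thesis using b unfolding U_def mult_2x2[of S'] by simp
      qed
      also have "b * g $ 2 $ 1 = g $ 1 $ 1 * g $ 2 $ 2 - 1" using det by (simp add: det_2 b_def algebra_simps)
      also have "- d * (g $ 1 $ 1 + d) + (g $ 1 $ 1 * g $ 2 $ 2 - 1 + g $ 2 $ 2 * d) = lam * (g $ 1 $ 1 + g $ 2 $ 2 - lam) - 1"
        by (simp add: d_def algebra_simps)
      finally show ?thesis using lam by (simp add: tr)
    qed
    moreover have "U $ 1 $ 1 + U $ 2 $ 2 = g $ 1 $ 1 + g $ 2 $ 2"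
    proof -
      have "(g ** S) $ 1 $ 1 = b" "(g ** S) $ 1 $ 2 = b * (g $ 1 $ 1 + d)" "(g ** S) $ 2 $ 1 = g $ 2 $ 2"
        unfolding S_def mult_2x2 vector_2 b_def[symmetric] by (simp_all add: algebra_simps)
      moreover have "S' $ 1 $ 1 = - d / b" "S' $ 1 $ 2 = 1" "S' $ 2 $ 1 = inverse b" "S' $ 2 $ 2 = 0"
        unfolding S'_def vector_2 by simp_all
      ultimately show ?thesis using b unfolding U_def mult_2x2[of S'] by (simp add: divide_inverse mult.assoc[symmetric])
    qed
    ultimately show ?thesis using tri[of U] tr by metis
  qed
qed

lemma two_cosh: "2 * cosh w = exp w + exp (- w :: complex)"
  by (simp add: cosh_def scaleR_conv_of_real)

lemma spin_char_cosh:
  assumes "det g = 1" "g $ 1 $ 1 + g $ 2 $ 2 = 2 * cosh w"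
  shows "spin_char n g = (\<Sum>k\<le>n. exp (of_nat k * w) * exp (- (of_nat (n - k) * w)))"
proof -
  have "g $ 1 $ 1 + g $ 2 $ 2 = exp w + inverse (exp w)" using assms(2) by (simp add: two_cosh exp_minus)
  from spin_char_eigenvalue[OF assms(1) _ this] show ?thesis
    by (simp add: exp_of_nat_mult exp_minus power_inverse del: of_nat_diff)
qed

lemma obtain_cosh:
  obtains w :: complex where "z = 2 * cosh w"
proof -
  have "2 * cosh (\<i> * Arccos (z / 2)) = z" by (simp add: cosh_conv_cos)
  from that[OF this[symmetric]] show ?thesis .
qed

text \<open>For determinant 1 the character depends on the trace alone, through a formula that
  commutes with conjugation.\<close>

lemma spin_char_cnj:
  assumes "det g = 1"
  shows "cnj (spin_char n g) = spin_char n (conj_transpose g)"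
proof -
  obtain w where w: "g $ 1 $ 1 + g $ 2 $ 2 = 2 * cosh w" by (rule obtain_cosh)
  have c: "cosh (cnj w) = cnj (cosh w)" by (simp add: cosh_field_def exp_cnj)
  have "det (conj_transpose g) = cnj (det g)" by (simp add: det_2 conj_transpose_def)
  moreover have "conj_transpose g $ 1 $ 1 + conj_transpose g $ 2 $ 2 = 2 * cosh (cnj w)"
    using arg_cong[OF w, of cnj] by (simp add: conj_transpose_def c)
  ultimately show ?thesis using assms w by (simp add: spin_char_cosh[where w=w] spin_char_cosh[where w="cnj w"] exp_cnj)
qed

text \<open>Either \<open>exp w\<close> has modulus at most 1, or it differs from the trace by the
  term \<open>exp (- w)\<close> of modulus at most 1. The growth in n is therefore governed by the
  trace alone.\<close>

lemma spin_char_bound: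
  assumes det: "det g = 1"
  shows "cmod (spin_char n g) \<le> (real n + 1) * (cmod (g $ 1 $ 1 + g $ 2 $ 2) + 1) ^ n"
proof -
  define tr where "tr = g $ 1 $ 1 + g $ 2 $ 2"
  obtain w where w: "tr = 2 * cosh w" by (rule obtain_cosh)
  have tr: "tr = exp w + exp (-w)" using w by (simp add: two_cosh)
  have b: "cmod (exp w) \<le> cmod tr + 1" if "tr = exp w + exp (-w)" for w
  proof (cases "Re w \<ge> 0")
    case True
    have "cmod (exp w) \<le> cmod tr + cmod (exp (-w))" using that norm_triangle_ineq4[of tr "exp (-w)"] by simp
    also have "cmod (exp (-w)) \<le> 1" using True by simp
    finally show ?thesis by simp
  next
    case False then show ?thesis by (simp add: norm_exp_eq_Re add_increasing)
  qed
  have e: "cmod (exp w) \<le> cmod tr + 1" "cmod (exp (-w)) \<le> cmod tr + 1"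
    using b[of w] b[of "-w"] tr by (auto simp: add.commute)
  have "cmod (spin_char n g) \<le> (\<Sum>k\<le>n. (cmod tr + 1) ^ n)"
    unfolding spin_char_cosh[OF det w[unfolded tr_def]]
  proof (rule sum_norm_le)
    fix k assume "k \<in> {..n}"
    have "cmod (exp (of_nat k * w) * exp (- (of_nat (n - k) * w))) = cmod (exp w) ^ k * cmod (exp (-w)) ^ (n - k)"
      by (simp only: mult_minus_right[symmetric] exp_of_nat_mult norm_mult norm_power)
    also have "\<dots> \<le> (cmod tr + 1) ^ k * (cmod tr + 1) ^ (n - k)"
      by (intro mult_mono power_mono e) auto
    also have "\<dots> = (cmod tr + 1) ^ n" using \<open>k \<in> {..n}\<close> by (simp flip: power_add)
    finally show "cmod (exp (of_nat k * w) * exp (- (of_nat (n - k) * w))) \<le> (cmod tr + 1) ^ n" .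
  qed
  then show ?thesis by (simp add: tr_def add.commute)
qed


section \<open>Intertwiners\<close>

text \<open>Differentiation coefficient by coefficient at parameter 0, since the matrix entries
  \<open>spin_rep\<close> are themselves coefficients.\<close>

definition has_poly_derivative :: "(real \<Rightarrow> complex poly) \<Rightarrow> complex poly \<Rightarrow> bool" where
  "has_poly_derivative P P' \<longleftrightarrow> (\<forall>l. ((\<lambda>t. coeff (P t) l) has_vector_derivative coeff P' l) (at 0))"

lemma has_poly_derivative_mult:
  assumes "has_poly_derivative P P'" "has_poly_derivative Q Q'"
  shows "has_poly_derivative (\<lambda>t. P t * Q t) (P 0 * Q' + P' * Q 0)"
proof -
  have "((\<lambda>t. \<Sum>i\<le>l. coeff (P t) i * coeff (Q t) (l - i)) has_vector_derivative
     (\<Sum>i\<le>l. coeff (P 0) i * coeff Q' (l - i) + coeff P' i * coeff (Q 0) (l - i))) (at 0)" for l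
    using assms unfolding has_poly_derivative_def by (intro has_vector_derivative_sum has_vector_derivative_mult) auto
  then show ?thesis by (simp add: has_poly_derivative_def coeff_mult sum.distrib)
qed

lemma has_poly_derivative_power:
  assumes "has_poly_derivative P P'"
  shows "has_poly_derivative (\<lambda>t. P t ^ k) (of_nat k * P 0 ^ (k - 1) * P')"
proof (induction k)
  case 0
  then show ?case by (simp add: has_poly_derivative_def)
next
  case (Suc k)
  have "P 0 * (of_nat k * P 0 ^ (k - 1) * P') + P' * P 0 ^ k = of_nat (Suc k) * P 0 ^ (Suc k - 1) * P'"
    by (cases k) (simp_all add: algebra_simps)
  then show ?case using has_poly_derivative_mult[OF assms Suc] by simp
qed

text \<open>Two one-parameter subgroups suffice for Schur's lemma: \<open>torus\<close> separates
  the weights, and the derivative of \<open>rot\<close> at 0 is a raising minus a lowering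
  operator.\<close>

definition rot :: "real \<Rightarrow> complex^2^2" where
  "rot t = vector [vector [of_real (cos t), of_real (sin t)], vector [- of_real (sin t), of_real (cos t)]]"

definition torus :: "real \<Rightarrow> complex^2^2" where
  "torus t = vector [vector [cis t, 0], vector [0, cis (- t)]]"

lemma rot_SU2: "rot t \<in> SU2"
proof -
  have "complex_of_real (cos t) * of_real (cos t) + of_real (sin t) * of_real (sin t) = 1"
    by (metis of_real_add of_real_mult of_real_1 power2_eq_square sin_cos_squared_add2)
  then show ?thesis
    by (simp add: SU2_def rot_def conj_transpose_def matrix_eq_2x2 mult_2x2 mat_def det_2 add.commute)
qed

lemma torus_SU2: "torus t \<in> SU2"
  by (simp add: SU2_def torus_def conj_transpose_def matrix_eq_2x2 mult_2x2 mat_def det_2 cis_cnj cis_mult)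

text \<open>The column polynomial is (z cos t - sin t)^k (cos t + z sin t)^(n-k). At t = 0 the
  product rule leaves one term in z^(k+1) and one in z^(k-1).\<close>

lemma spin_rep_rot_derivative:
  assumes "k \<le> n"
  shows "((\<lambda>t. spin_rep n (rot t) l k) has_vector_derivative
    (if l = Suc k then of_nat (n - k) else 0) - (if Suc l = k then of_nat k else 0)) (at 0)"
proof -
  have sin: "((\<lambda>t. complex_of_real (sin t)) has_vector_derivative 1) (at 0)"
  proof -
    have "(sin has_vector_derivative 1) (at (0::real))"
      by (auto simp flip: has_real_derivative_iff_has_vector_derivative intro!: derivative_eq_intros)
    from bounded_linear.has_vector_derivative[OF bounded_linear_of_real this] show ?thesis by simp
  qed
  have cos: "((\<lambda>t. complex_of_real (cos t)) has_vector_derivative 0) (at 0)"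
  proof -
    have "(cos has_vector_derivative 0) (at (0::real))"
      by (auto simp flip: has_real_derivative_iff_has_vector_derivative intro!: derivative_eq_intros)
    from bounded_linear.has_vector_derivative[OF bounded_linear_of_real this] show ?thesis by simp
  qed
  have d: "has_poly_derivative (\<lambda>t. [: - of_real (sin t), of_real (cos t) :]) [: - 1 :]"
    "has_poly_derivative (\<lambda>t. [: of_real (cos t), of_real (sin t) :]) [: 0, 1 :]"
  proof -
    have "((\<lambda>t. coeff [: - complex_of_real (sin t), of_real (cos t) :] l) has_vector_derivative coeff [: - 1 :] l) (at 0)" for l
    proof (cases l)
      case (Suc m) then show ?thesis using cos by (cases m) simp_all
    qed (use has_vector_derivative_minus[OF sin] in simp)
    moreover have "((\<lambda>t. coeff [: complex_of_real (cos t), of_real (sin t) :] l) has_vector_derivative coeff [: 0, 1 :] l) (at 0)" for l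
    proof (cases l)
      case (Suc m) then show ?thesis using sin by (cases m) simp_all
    qed (use cos in simp)
    ultimately show "has_poly_derivative (\<lambda>t. [: - of_real (sin t), of_real (cos t) :]) [: - 1 :]"
      "has_poly_derivative (\<lambda>t. [: of_real (cos t), of_real (sin t) :]) [: 0, 1 :]"
      unfolding has_poly_derivative_def by blast+
  qed
  have X: "[:0, 1:] ^ m = monom (1 :: complex) m" for m by (simp only: monom_altdef smult_1_left)
  have c: "of_nat m * p = smult (of_nat m) p" for m and p :: "complex poly" by (simp add: of_nat_poly)
  have "has_poly_derivative (\<lambda>t. [: - of_real (sin t), of_real (cos t) :] ^ k * [: of_real (cos t), of_real (sin t) :] ^ (n - k))
     ([:0, 1:] ^ k * (of_nat (n - k) * [:1:] ^ (n - k - 1) * [:0, 1:]) + of_nat k * [:0, 1:] ^ (k - 1) * [: - 1 :] * [:1:] ^ (n - k))"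
    using has_poly_derivative_mult[OF has_poly_derivative_power[OF d(1), of k] has_poly_derivative_power[OF d(2), of "n - k"]]
    by simp
  \<comment> \<open>For k = 0 the exponent k - 1 is truncated to 0, so the lowering term is set to 0
    explicitly.\<close>
  also have "[:0, 1:] ^ k * (of_nat (n - k) * [:1:] ^ (n - k - 1) * [:0, 1:]) + of_nat k * [:0, 1:] ^ (k - 1) * [: - 1 :] * [:1:] ^ (n - k)
     = monom (of_nat (n - k) :: complex) (Suc k) - (if k = 0 then 0 else monom (of_nat k) (k - 1))"
  proof -
    have "[:0, 1:] ^ k * [:0, 1:] = monom (1 :: complex) (Suc k)" unfolding X[symmetric] by (simp only: power_Suc2)
    then have "[:0, 1:] ^ k * (of_nat (n - k) * 1 * [:0, 1:]) = monom (of_nat (n - k) :: complex) (Suc k)"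
      by (simp only: mult_1_right c mult_smult_right smult_monom)
    moreover have "[:- 1 :: complex:] = - 1" by (simp add: one_pCons)
    then have "of_nat k * [:0, 1:] ^ (k - 1) * [: - 1 :] * 1 = - monom (of_nat k :: complex) (k - 1)"
      by (simp only: mult_1_right c X smult_monom mult_minus_right)
    moreover have "[:1::complex:] ^ m = 1" for m by (simp only: one_pCons[symmetric] power_one)
    ultimately show ?thesis by (simp only: ) (cases k; simp only: simp_thms if_True if_False of_nat_0 monom_0 pCons_0_0 diff_zero minus_zero add_0_right diff_conv_add_uminus; simp)
  qed
  finally have "has_poly_derivative (\<lambda>t. [: - of_real (sin t), of_real (cos t) :] ^ k * [: of_real (cos t), of_real (sin t) :] ^ (n - k))
    (monom (of_nat (n - k)) (Suc k) - (if k = 0 then 0 else monom (of_nat k) (k - 1)))" .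
  then have "((\<lambda>t. coeff ([: - complex_of_real (sin t), of_real (cos t) :] ^ k * [: of_real (cos t), of_real (sin t) :] ^ (n - k)) l)
    has_vector_derivative coeff (monom (of_nat (n - k)) (Suc k) - (if k = 0 then 0 else monom (of_nat k) (k - 1))) l) (at 0)"
    unfolding has_poly_derivative_def by blast
  also have "coeff (monom (of_nat (n - k)) (Suc k) - (if k = 0 then 0 else monom (of_nat k) (k - 1))) l =
     (if l = Suc k then of_nat (n - k) else 0) - (if Suc l = k then of_nat k else (0::complex))"
    by auto
  finally show ?thesis unfolding spin_rep_def rot_def vector_2 .
qed

lemma spin_rep_torus:
  assumes "k \<le> n"
  shows "spin_rep n (torus t) l k = (if l = k then cis ((2 * real k - real n) * t) else 0)"
proof -
  have "spin_rep n (torus t) l k = (if l = k then cis t ^ k * cis (- t) ^ (n - k) else 0)"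
    by (subst spin_rep_diag[OF _ _ assms]) (simp_all add: torus_def)
  also have "cis t ^ k * cis (- t) ^ (n - k) = cis ((2 * real k - real n) * t)"
    using assms by (simp only: Complex.DeMoivre cis_mult) (simp add: of_nat_diff algebra_simps)
  finally show ?thesis .
qed

text \<open>T has rows 0..n and columns 0..m: it is the matrix of a map from the representation of
  degree m to that of degree n.\<close>

definition intertwines :: "nat \<Rightarrow> nat \<Rightarrow> (nat \<Rightarrow> nat \<Rightarrow> complex) \<Rightarrow> bool" where
  "intertwines n m T \<longleftrightarrow> (\<forall>g\<in>SU2. \<forall>a\<le>n. \<forall>b\<le>m.
     (\<Sum>c\<le>n. spin_rep n g a c * T c b) = (\<Sum>c\<le>m. T a c * spin_rep m g c b))"

lemma intertwines_weight:
  assumes T: "intertwines n m T" and ab: "a \<le> n" "b \<le> m" and ne: "2 * int a - int n \<noteq> 2 * int b - int m"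
  shows "T a b = 0"
proof -
  define N where "N = (2 * real a - real n) - (2 * real b - real m)"
  have N: "N \<noteq> 0" using ne unfolding N_def by linarith
  \<comment> \<open>At this parameter the phases of the two unequal weights are opposite, so the
    entry equals its own negative.\<close>
  define t where "t = pi / N"
  have "(\<Sum>c\<le>n. spin_rep n (torus t) a c * T c b) = (\<Sum>c\<le>m. T a c * spin_rep m (torus t) c b)"
    using T ab torus_SU2 unfolding intertwines_def by blast
  also have "(\<Sum>c\<le>n. spin_rep n (torus t) a c * T c b) = (\<Sum>c\<le>n. if c = a then cis ((2 * real a - real n) * t) * T a b else 0)"
    by (intro sum.cong) (auto simp: spin_rep_torus)
  also have "\<dots> = cis ((2 * real a - real n) * t) * T a b" using ab by simp
  also have "(\<Sum>c\<le>m. T a c * spin_rep m (torus t) c b) = (\<Sum>c\<le>m. if c = b then cis ((2 * real b - real m) * t) * T a b else 0)"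
    using ab by (intro sum.cong) (auto simp: spin_rep_torus)
  also have "\<dots> = cis ((2 * real b - real m) * t) * T a b" using ab by simp
  also have "(2 * real a - real n) * t = (2 * real b - real m) * t + pi"
    using N by (simp add: t_def N_def field_simps)
  finally have neg: "- (cis ((2 * real b - real m) * t) * T a b) = cis ((2 * real b - real m) * t) * T a b"
    by (simp flip: cis_mult)
  have "cis ((2 * real b - real m) * t) * T a b + cis ((2 * real b - real m) * t) * T a b = 0"
    by (subst (1) neg[symmetric]) simp
  then show ?thesis by (simp flip: mult_2)
qed

text \<open>The derivative at the identity along \<^const>\<open>rot\<close>, projected to one weight by the torus relation.\<close>

lemma intertwines_raising:
  assumes T: "intertwines n m T" and ab: "a \<le> n" "b \<le> m" and eq: "2 * int a - int n = 2 * int b - int m + 2"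
  shows "(if a = 0 then 0 else of_nat (n - (a - 1)) * T (a - 1) b) = (if b = m then 0 else of_nat (m - b) * T a (Suc b))"
proof -
  have d1: "((\<lambda>t. \<Sum>c\<le>n. spin_rep n (rot t) a c * T c b) has_vector_derivative
    (\<Sum>c\<le>n. ((if a = Suc c then of_nat (n - c) else 0) - (if Suc a = c then of_nat c else 0)) * T c b)) (at 0)"
    by (intro has_vector_derivative_sum has_vector_derivative_mult_left spin_rep_rot_derivative) auto
  have d2: "((\<lambda>t. \<Sum>c\<le>m. T a c * spin_rep m (rot t) c b) has_vector_derivative
    (\<Sum>c\<le>m. T a c * ((if c = Suc b then of_nat (m - b) else 0) - (if Suc c = b then of_nat b else 0)))) (at 0)"
    by (intro has_vector_derivative_sum has_vector_derivative_mult_right spin_rep_rot_derivative ab)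
  have d12: "(\<lambda>t. \<Sum>c\<le>n. spin_rep n (rot t) a c * T c b) = (\<lambda>t. \<Sum>c\<le>m. T a c * spin_rep m (rot t) c b)"
    using T ab rot_SU2 unfolding intertwines_def by (intro ext) simp
  have "(\<Sum>c\<le>n. ((if a = Suc c then of_nat (n - c) else 0) - (if Suc a = c then of_nat c else 0)) * T c b) =
    (\<Sum>c\<le>m. T a c * ((if c = Suc b then of_nat (m - b) else 0) - (if Suc c = b then of_nat b else 0)))"
    by (rule vector_derivative_unique_at[OF d1[unfolded d12] d2])
  also have "(\<Sum>c\<le>n. ((if a = Suc c then of_nat (n - c) else 0) - (if Suc a = c then of_nat c else 0)) * T c b)
     = (\<Sum>c\<le>n. if a = Suc c then of_nat (n - (a - 1)) * T (a - 1) b else 0)"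
  proof (intro sum.cong refl)
    fix c assume "c \<in> {..n}"
    then have "T c b = 0" if "Suc a = c" using that ab eq by (intro intertwines_weight[OF T]) auto
    then show "((if a = Suc c then of_nat (n - c) else 0) - (if Suc a = c then of_nat c else 0)) * T c b
       = (if a = Suc c then of_nat (n - (a - 1)) * T (a - 1) b else 0)" by auto
  qed
  also have "\<dots> = (if a = 0 then 0 else of_nat (n - (a - 1)) * T (a - 1) b)"
    using ab by (cases a) (auto simp: sum.delta')
  also have "(\<Sum>c\<le>m. T a c * ((if c = Suc b then of_nat (m - b) else 0) - (if Suc c = b then of_nat b else 0))) =
     (\<Sum>c\<le>m. if c = Suc b then of_nat (m - b) * T a (Suc b) else 0)"
  proof (intro sum.cong refl)
    fix c assume "c \<in> {..m}"
    then have "T a c = 0" if "Suc c = b" using that ab eq by (intro intertwines_weight[OF T]) auto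
    then show "T a c * ((if c = Suc b then of_nat (m - b) else 0) - (if Suc c = b then of_nat b else 0))
       = (if c = Suc b then of_nat (m - b) * T a (Suc b) else 0)" by auto
  qed
  also have "\<dots> = (if b = m then 0 else of_nat (m - b) * T a (Suc b))"
    using ab by (auto simp: sum.delta)
  finally show ?thesis .
qed

text \<open>Equal weights and n < m force b > 0, since 2b = 2a + m - n. The raising relation then
  expresses T a b through row a - 1, and in row 0 its other side is empty.\<close>

lemma intertwines_less:
  assumes T: "intertwines n m T" and nm: "n < m" and "a \<le> n" "b \<le> m"
  shows "T a b = 0"
  using assms(3,4)
proof (induction a arbitrary: b)
  case 0
  show ?case
  proof (cases "2 * int 0 - int n = 2 * int b - int m")
    case True
    then have "b \<noteq> 0" using nm by linarith
    then obtain c where c: "b = Suc c" using not0_implies_Suc by blast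
    have e: "2 * int 0 - int n = 2 * int c - int m + 2" using True c by linarith
    have "(0::complex) = (if c = m then 0 else of_nat (m - c) * T 0 (Suc c))"
      using intertwines_raising[OF T _ _ e] 0 c by simp
    then show ?thesis using c 0 by (auto split: if_splits)
  qed (use intertwines_weight[OF T _ 0(2), of 0] in auto)
next
  case (Suc a)
  show ?case
  proof (cases "2 * int (Suc a) - int n = 2 * int b - int m")
    case True
    then have "b \<noteq> 0" using nm Suc.prems by linarith
    then obtain c where c: "b = Suc c" using not0_implies_Suc by blast
    have e: "2 * int (Suc a) - int n = 2 * int c - int m + 2" using True c by linarith
    have "of_nat (n - a) * T a c = (if c = m then 0 else of_nat (m - c) * T (Suc a) (Suc c))"
      using intertwines_raising[OF T _ _ e] Suc.prems c by (simp only: diff_Suc_1 Suc_neq_Zero if_False) auto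
    moreover have "T a c = 0" using Suc c by simp
    ultimately show ?thesis using c Suc.prems by (auto split: if_splits)
  qed (use intertwines_weight[OF T Suc.prems] in auto)
qed

text \<open>Schur's lemma: distinct indices have distinct weights, and along the diagonal the
  raising relation has the same nonzero factor n - a on both sides.\<close>

lemma intertwines_self:
  assumes T: "intertwines n n T" and "a \<le> n" "b \<le> n"
  shows "T a b = (if a = b then T 0 0 else 0)"
proof -
  have diag: "T a a = T 0 0" if "a \<le> n" for a
    using that
  proof (induction a)
    case (Suc a)
    have "of_nat (n - a) * T a a = of_nat (n - a) * T (Suc a) (Suc a)"
      using intertwines_raising[OF T, of "Suc a" a] Suc.prems by simp
    then show ?case using Suc by simp
  qed simp
  have "T a b = 0" if "a \<noteq> b" using that assms by (intro intertwines_weight[OF T]) auto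
  then show ?thesis using diag[OF assms(2)] by auto
qed


section \<open>Orthogonality with respect to Haar measure\<close>

lemma conj_transpose_mult: "conj_transpose (A ** B) = conj_transpose B ** conj_transpose A"
  by (simp add: matrix_eq_2x2 mult_2x2 conj_transpose_def mult.commute)

lemma conj_transpose_twice [simp]: "conj_transpose (conj_transpose A) = A"
  by (simp add: matrix_eq_2x2 conj_transpose_def)

lemma SU2D:
  assumes "h \<in> SU2"
  shows "h ** conj_transpose h = mat 1" "conj_transpose h ** h = mat 1" "det h = 1"
  using assms by (auto simp: SU2_def)

lemma det_conj_transpose: "det (conj_transpose A) = cnj (det A)"
  by (simp add: det_2 conj_transpose_def)

lemma matrix_inv_SU2:
  assumes "h \<in> SU2" shows "matrix_inv h = conj_transpose h"
proof -
  have "matrix_inv h ** h = mat 1"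
    unfolding matrix_inv_def by (rule someI2[of _ "conj_transpose h"]) (use SU2D[OF assms] in auto)
  then have "(matrix_inv h ** h) ** conj_transpose h = conj_transpose h" by simp
  then show ?thesis using SU2D(1)[OF assms] by (simp flip: matrix_mul_assoc)
qed

lemma SU2_mult:
  assumes "g \<in> SU2" "h \<in> SU2" shows "g ** h \<in> SU2"
proof -
  have "(g ** h) ** conj_transpose (g ** h) = g ** (h ** conj_transpose h) ** conj_transpose g"
    "conj_transpose (g ** h) ** (g ** h) = conj_transpose h ** (conj_transpose g ** g) ** h"
    by (simp_all add: conj_transpose_mult matrix_mul_assoc)
  then show ?thesis using SU2D[OF assms(1)] SU2D[OF assms(2)] by (simp add: SU2_def det_mul)
qed

lemma SU2_entry_bound:
  assumes "h \<in> SU2" shows "cmod (h $ i $ j) \<le> 1"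
proof -
  have "(h ** conj_transpose h) $ i $ i = 1" using SU2D(1)[OF assms] by (simp add: mat_def)
  then have "complex_of_real ((cmod (h $ i $ 1))\<^sup>2 + (cmod (h $ i $ 2))\<^sup>2) = 1"
    by (simp add: mult_2x2 conj_transpose_def complex_norm_square del: of_real_power)
  then have s: "(cmod (h $ i $ 1))\<^sup>2 + (cmod (h $ i $ 2))\<^sup>2 = 1" by (metis of_real_eq_1_iff)
  have "(cmod (h $ i $ 1))\<^sup>2 \<le> 1" using s zero_le_power2[of "cmod (h $ i $ 2)"] by linarith
  moreover have "(cmod (h $ i $ 2))\<^sup>2 \<le> 1" using s zero_le_power2[of "cmod (h $ i $ 1)"] by linarith
  ultimately have "(cmod (h $ i $ j))\<^sup>2 \<le> 1" using exhaust_2[of j] by (elim disjE) simp_all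
  then show ?thesis using power2_le_imp_le[of "cmod (h $ i $ j)" 1] by simp
qed

section \<open>Continuity of matrix entries and compactness of SU(2)\<close>

lemma continuous_on_matrix_mult:
  fixes F G :: "'a::topological_space \<Rightarrow> complex^2^2"
  assumes "continuous_on S F" "continuous_on S G"
  shows "continuous_on S (\<lambda>x. F x ** G x)"
  unfolding matrix_matrix_mult_def
  by (intro continuous_on_vec_lambda continuous_on_sum continuous_on_mult continuous_on_component assms)

lemma continuous_on_conj_transpose:
  fixes F :: "'a::topological_space \<Rightarrow> complex^2^2"
  assumes "continuous_on S F"
  shows "continuous_on S (\<lambda>x. conj_transpose (F x))"
  unfolding conj_transpose_def
  by (intro continuous_on_vec_lambda continuous_on_cnj continuous_on_component assms)

lemma continuous_on_spin_rep:
  fixes F :: "'a::topological_space \<Rightarrow> complex^2^2"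
  assumes "continuous_on S F"
  shows "continuous_on S (\<lambda>x. spin_rep n (F x) l k)"
proof -
  have power: "continuous_on S (\<lambda>x. coeff ([:a x, b x:] ^ m) i)"
    if "continuous_on S a" "continuous_on S b" for a b :: "'a \<Rightarrow> complex" and m i
  proof (induction m arbitrary: i)
    case (Suc m)
    have "continuous_on S (\<lambda>x. coeff [:a x, b x:] j)" for j
      using that by (cases j; cases "j - 1") (simp_all add: coeff_pCons split: nat.split)
    then show ?case unfolding power_Suc coeff_mult by (intro continuous_on_sum continuous_on_mult Suc)
  qed simp
  show ?thesis
    unfolding spin_rep_def coeff_mult
    by (intro continuous_on_sum continuous_on_mult power continuous_on_component assms)
qed

lemma continuous_on_spin_char:
  fixes F :: "'a::topological_space \<Rightarrow> complex^2^2"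
  assumes "continuous_on S F"
  shows "continuous_on S (\<lambda>x. spin_char n (F x))"
  unfolding spin_char_def by (intro continuous_on_sum continuous_on_spin_rep assms)

lemma compact_SU2: "compact SU2"
proof -
  have "closed SU2"
  proof -
    have "SU2 = {A. A ** conj_transpose A = mat 1} \<inter> {A. conj_transpose A ** A = mat 1} \<inter> {A. det A = 1}"
      by (auto simp: SU2_def)
    also have "closed \<dots>"
      unfolding det_2
      by (intro closed_Int closed_Collect_eq continuous_on_matrix_mult continuous_on_conj_transpose
          continuous_on_id continuous_on_const continuous_on_diff continuous_on_mult continuous_on_component)
    finally show ?thesis .
  qed
  moreover have "bounded SU2"
  proof (rule boundedI)
    fix h assume h: "h \<in> SU2"
    have "norm h \<le> (\<Sum>i\<in>UNIV. norm (h $ i))" unfolding norm_vec_def[of h] by (rule L2_set_le_sum) simp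
    also have "\<dots> \<le> (\<Sum>i\<in>UNIV. \<Sum>j\<in>UNIV. norm (h $ i $ j))"
      by (rule sum_mono, subst norm_vec_def, rule L2_set_le_sum) simp
    also have "\<dots> \<le> (\<Sum>i\<in>(UNIV::2 set). \<Sum>j\<in>(UNIV::2 set). 1)" by (intro sum_mono SU2_entry_bound h)
    finally show "norm h \<le> 4" by simp
  qed
  ultimately show ?thesis by (simp add: compact_eq_bounded_closed)
qed

section \<open>Coefficients and convergence of the coherent states\<close>

text \<open>With n = 2j the exponent t j (j + 1) / 2 becomes t n (n + 2) / 8.\<close>

definition coef :: "real \<Rightarrow> nat \<Rightarrow> real" where
  "coef t n = (real n + 1) * exp (- (t / 8) * (real n * (real n + 2)))"

lemma coef_pos: "coef t n > 0"
  by (simp add: coef_def add_nonneg_pos)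

text \<open>Orthogonality divides the squared coefficients by the dimension n + 1. The quotient is a
  coefficient at doubled time, which is why the squared norm is a value of the same series.\<close>

lemma coef_square: "(coef t n)\<^sup>2 / (real n + 1) = coef (2 * t) n"
proof -
  have e: "(exp (- (t / 8) * (real n * (real n + 2))))\<^sup>2 = exp (- (2 * t / 8) * (real n * (real n + 2)))"
    by (simp flip: exp_double)
  have "(coef t n)\<^sup>2 = (real n + 1) * ((real n + 1) * exp (- (2 * t / 8) * (real n * (real n + 2))))"
    unfolding coef_def power_mult_distrib e by (simp add: power2_eq_square)
  then show ?thesis by (simp add: coef_def)
qed

text \<open>Gaussian decay in n beats the geometric growth of characters; the two factors n + 1 are
  absorbed by exp n each.\<close>

lemma summable_coef:
  assumes "t > 0" "R > 0"
  shows "summable (\<lambda>n. coef t n * ((real n + 1) * R ^ n))"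
proof (rule summable_comparison_test')
  show "summable (\<lambda>n::nat. exp ((2 + ln R) * real n - t / 8 * (real n)\<^sup>2))"
    using assms by (intro summable_exp_quadratic) auto
  fix n :: nat
  have a: "real n + 1 \<le> exp (real n)" using exp_ge_add_one_self[of "real n"] by (simp add: add.commute)
  have b: "exp (- (t / 8) * (real n * (real n + 2))) \<le> exp (- (t / 8) * (real n)\<^sup>2)"
    using assms by (simp add: power2_eq_square mult_left_mono)
  have c: "R ^ n = exp (ln R * real n)" using assms by (simp add: exp_of_nat2_mult)
  have "coef t n * ((real n + 1) * R ^ n) = (real n + 1) * exp (- (t / 8) * (real n * (real n + 2))) * ((real n + 1) * exp (ln R * real n))"
    by (simp add: coef_def c)
  also have "\<dots> \<le> exp (real n) * exp (- (t / 8) * (real n)\<^sup>2) * (exp (real n) * exp (ln R * real n))"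
    by (intro mult_mono a b) auto
  also have "\<dots> = exp ((2 + ln R) * real n - t / 8 * (real n)\<^sup>2)"
    by (simp add: algebra_simps flip: exp_add)
  finally show "norm (coef t n * ((real n + 1) * R ^ n)) \<le> exp ((2 + ln R) * real n - t / 8 * (real n)\<^sup>2)"
    using assms coef_pos[of t n] by (simp add: abs_mult)
qed

lemma psi_eq: "psi t g h = (\<Sum>n. of_real (coef t n) * spin_char n (g ** matrix_inv h))"
proof -
  have "(2 * (real n / 2) + 1) * exp (- (t / 2) * (real n / 2) * (real n / 2 + 1)) = coef t n" for n
    by (simp add: coef_def field_simps)
  then show ?thesis by (simp only: psi_def Let_def)
qed

text \<open>Entries of h have modulus at most 1, so the bound is uniform over the group and can
  serve as a majorant for integration.\<close>

lemma spin_char_SU2_bound: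
  assumes "h \<in> SU2" "det g = 1"
  shows "cmod (spin_char n (g ** conj_transpose h)) \<le> (real n + 1) * ((\<Sum>i\<in>UNIV. \<Sum>j\<in>UNIV. cmod (g $ i $ j)) + 1) ^ n"
proof -
  let ?A = "g ** conj_transpose h"
  have b: "cmod (g $ i $ j * cnj (h $ i $ j)) \<le> cmod (g $ i $ j)" for i j
    using mult_left_mono[OF SU2_entry_bound[OF assms(1), of i j], of "cmod (g $ i $ j)"] by (simp add: norm_mult)
  have "?A $ 1 $ 1 + ?A $ 2 $ 2 = (\<Sum>i\<in>UNIV. \<Sum>j\<in>UNIV. g $ i $ j * cnj (h $ i $ j))"
    by (simp add: mult_2x2 conj_transpose_def sum_2)
  also have "cmod \<dots> \<le> (\<Sum>i\<in>UNIV. \<Sum>j\<in>UNIV. cmod (g $ i $ j))"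
    by (intro sum_norm_le b)
  finally have tr: "cmod (?A $ 1 $ 1 + ?A $ 2 $ 2) \<le> (\<Sum>i\<in>UNIV. \<Sum>j\<in>UNIV. cmod (g $ i $ j))" .
  have "det ?A = 1" using assms SU2D(3) by (simp add: det_mul det_conj_transpose)
  then have "cmod (spin_char n ?A) \<le> (real n + 1) * (cmod (?A $ 1 $ 1 + ?A $ 2 $ 2) + 1) ^ n" by (rule spin_char_bound)
  also have "\<dots> \<le> (real n + 1) * ((\<Sum>i\<in>UNIV. \<Sum>j\<in>UNIV. cmod (g $ i $ j)) + 1) ^ n"
    using tr by (intro mult_left_mono power_mono) auto
  finally show ?thesis .
qed

section \<open>Schur orthogonality and the squared norm\<close>

context
  fixes M assumes haar: "normalized_haar_SU2 M"
begin

lemma haar_measurable: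
  assumes "continuous_on SU2 f"
  shows "f \<in> borel_measurable M"
proof -
  have "sets M = sets (restrict_space borel SU2)" using haar by (simp add: normalized_haar_SU2_def)
  then show ?thesis
    using borel_measurable_continuous_on_restrict[OF assms] measurable_cong_sets by blast
qed

lemma haar_bounded:
  fixes f :: "complex^2^2 \<Rightarrow> complex"
  assumes "continuous_on SU2 f"
  obtains B where "\<And>h. h \<in> SU2 \<Longrightarrow> cmod (f h) \<le> B"
  using compact_imp_bounded[OF compact_continuous_image[OF assms compact_SU2]] that by (auto simp: bounded_iff)

lemma haar_space: "space M = SU2" and haar_prob: "prob_space M"
  using haar by (auto simp: normalized_haar_SU2_def)

lemma haar_integrable:
  fixes f :: "complex^2^2 \<Rightarrow> complex"
  assumes "continuous_on SU2 f"
  shows "integrable M f"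
proof -
  obtain B where B: "\<And>h. h \<in> SU2 \<Longrightarrow> cmod (f h) \<le> B" using haar_bounded[OF assms] by blast
  interpret prob_space M by (rule haar_prob)
  show ?thesis
    by (rule integrable_const_bound[of _ B]) (auto intro!: AE_I2 B haar_measurable assms simp: haar_space)
qed

lemma haar_translate:
  fixes f :: "complex^2^2 \<Rightarrow> complex"
  assumes f: "continuous_on SU2 f" and g: "g \<in> SU2"
  shows "(\<integral>h. f (g ** h) \<partial>M) = (\<integral>h. f h \<partial>M)"
proof -
  have s: "sets M = sets (restrict_space borel SU2)" using haar by (simp add: normalized_haar_SU2_def)
  have "(\<lambda>h. g ** h) \<in> measurable (restrict_space borel SU2) (restrict_space borel SU2)"
    using SU2_mult[OF g]
    by (intro measurable_restrict_space2 borel_measurable_continuous_on_restrict continuous_on_matrix_mult continuous_on_id continuous_on_const)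
       (auto simp: space_restrict_space)
  then have m: "(\<lambda>h. g ** h) \<in> measurable M M" using measurable_cong_sets[OF s s] by blast
  have "distr M M (\<lambda>h. g ** h) = M" using haar g by (simp add: normalized_haar_SU2_def)
  then have "(\<integral>h. f h \<partial>M) = (\<integral>h. f h \<partial>distr M M (\<lambda>h. g ** h))" by simp
  also have "\<dots> = (\<integral>h. f (g ** h) \<partial>M)" by (rule integral_distr[OF m haar_measurable[OF f]])
  finally show ?thesis by simp
qed

lemmas SU2_continuous = continuous_on_matrix_mult continuous_on_conj_transpose continuous_on_spin_rep
  continuous_on_spin_char continuous_on_id continuous_on_const continuous_on_mult continuous_on_sum

text \<open>The matrix is the average over h of h E h^-1, with E the matrix unit at (d, b).
  Invariance of the measure makes such an average commute with the group.\<close>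

lemma intertwines_haar:
  assumes d: "d \<le> n" and b: "b \<le> m"
  shows "intertwines n m (\<lambda>c a. \<integral>h. spin_rep n h c d * spin_rep m (conj_transpose h) b a \<partial>M)"
  unfolding intertwines_def
proof (intro ballI allI impI)
  fix g a e assume g: "g \<in> SU2" and a: "a \<le> n" and e: "e \<le> m"
  let ?F = "\<lambda>h. spin_rep n h a d * spin_rep m (conj_transpose h ** g) b e"
  have "(\<Sum>c\<le>n. spin_rep n g a c * (\<integral>h. spin_rep n h c d * spin_rep m (conj_transpose h) b e \<partial>M))
     = (\<Sum>c\<le>n. \<integral>h. spin_rep n g a c * (spin_rep n h c d * spin_rep m (conj_transpose h) b e) \<partial>M)"
    by simp
  also have "\<dots> = (\<integral>h. (\<Sum>c\<le>n. spin_rep n g a c * (spin_rep n h c d * spin_rep m (conj_transpose h) b e)) \<partial>M)"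
    by (intro Bochner_Integration.integral_sum[symmetric] haar_integrable SU2_continuous)
  also have "\<dots> = (\<integral>h. ?F (g ** h) \<partial>M)"
  proof (intro Bochner_Integration.integral_cong refl)
    fix h assume "h \<in> space M"
    \<comment> \<open>Passing from h to g h moves g from the left factor of the integrand to the
      right one.\<close>
    have "conj_transpose (g ** h) ** g = conj_transpose h ** (conj_transpose g ** g)"
      by (simp add: conj_transpose_mult matrix_mul_assoc)
    also have "\<dots> = conj_transpose h" using SU2D(2)[OF g] by simp
    finally show "(\<Sum>c\<le>n. spin_rep n g a c * (spin_rep n h c d * spin_rep m (conj_transpose h) b e)) = ?F (g ** h)"
      by (simp add: spin_rep_mult[OF a d] sum_distrib_right mult.assoc)
  qed
  also have "\<dots> = (\<integral>h. ?F h \<partial>M)"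
    by (intro haar_translate g SU2_continuous)
  also have "\<dots> = (\<integral>h. (\<Sum>c\<le>m. spin_rep n h a d * spin_rep m (conj_transpose h) b c * spin_rep m g c e) \<partial>M)"
    by (simp add: spin_rep_mult[OF b e] sum_distrib_left mult.assoc)
  also have "\<dots> = (\<Sum>c\<le>m. \<integral>h. spin_rep n h a d * spin_rep m (conj_transpose h) b c * spin_rep m g c e \<partial>M)"
    by (intro Bochner_Integration.integral_sum haar_integrable SU2_continuous)
  finally show "(\<Sum>c\<le>n. spin_rep n g a c * (\<integral>h. spin_rep n h c d * spin_rep m (conj_transpose h) b e \<partial>M)) =
      (\<Sum>c\<le>m. (\<integral>h. spin_rep n h a d * spin_rep m (conj_transpose h) b c \<partial>M) * spin_rep m g c e)"
    by simp
qed

text \<open>By Schur the average is a scalar, and the trace determines it: summing over c contracts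
  h^-1 h to the identity, so n + 1 times the scalar is 1 or 0.\<close>

lemma haar_matrix_elements:
  assumes nm: "n \<le> m" and le: "c \<le> n" "d \<le> n" "a \<le> m" "b \<le> m"
  shows "(\<integral>h. spin_rep n h c d * spin_rep m (conj_transpose h) b a \<partial>M) =
    (if n = m \<and> c = a \<and> d = b then 1 / of_nat (n + 1) else 0)"
proof (cases "n = m")
  case False
  then show ?thesis using intertwines_less[OF intertwines_haar[of d n b m], of c a] nm le by simp
next
  case True
  define T where "T = (\<lambda>c a. \<integral>h. spin_rep n h c d * spin_rep n (conj_transpose h) b a \<partial>M)"
  have "intertwines n n T" unfolding T_def using le True by (intro intertwines_haar) auto
  note T = intertwines_self[OF this]
  have "of_nat (n + 1) * T 0 0 = (\<Sum>c\<le>n. T c c)"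
  proof -
    have "(\<Sum>c\<le>n. T c c) = (\<Sum>c\<le>n. T 0 0)" by (intro sum.cong refl) (subst T, auto)
    then show ?thesis by simp
  qed
  also have "\<dots> = (\<integral>h. (\<Sum>c\<le>n. spin_rep n h c d * spin_rep n (conj_transpose h) b c) \<partial>M)"
    unfolding T_def by (intro Bochner_Integration.integral_sum[symmetric] haar_integrable SU2_continuous)
  also have "\<dots> = (\<integral>h. (if b = d then 1 else 0) \<partial>M)"
  proof (intro Bochner_Integration.integral_cong refl)
    fix h assume "h \<in> space M"
    then have "conj_transpose h ** h = mat 1" using SU2D haar_space by blast
    then have "(\<Sum>c\<le>n. spin_rep n (conj_transpose h) b c * spin_rep n h c d) = spin_rep n (mat 1) b d"
      using le True by (subst spin_rep_mult[symmetric]) auto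
    also have "\<dots> = (if b = d then 1 else 0)"
      using le by (subst spin_rep_diag) (auto simp: mat_def)
    finally show "(\<Sum>c\<le>n. spin_rep n h c d * spin_rep n (conj_transpose h) b c) = (if b = d then 1 else 0)"
      by (simp add: mult.commute)
  qed
  also have "\<dots> = (if b = d then 1 else 0)"
    using prob_space.prob_space[OF haar_prob] by simp
  finally have "T 0 0 = (if b = d then 1 / of_nat (n + 1) else 0)"
    by (simp add: field_simps split: if_splits del: of_nat_Suc of_nat_add)
  moreover have "T c a = (if c = a then T 0 0 else 0)" using T le True by blast
  ultimately show ?thesis using True by (auto simp: T_def)
qed

text \<open>With g' the conjugate transpose of g, the second factor is the conjugate of
  \<open>spin_char n (g ** conj_transpose h)\<close>, so these integrals are the inner products of
  the terms of \<open>psi\<close>.\<close>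

lemma haar_characters:
  assumes nm: "n \<le> m"
  shows "(\<integral>h. spin_char m (g ** conj_transpose h) * spin_char n (h ** g') \<partial>M) =
    (if n = m then spin_char n (g ** g') / of_nat (n + 1) else 0)"
proof -
  have ch: "spin_char k (A ** B) = (\<Sum>p\<le>k. \<Sum>b\<le>k. spin_rep k A p b * spin_rep k B b p)" for k A B
    unfolding spin_char_def by (intro sum.cong) (auto simp: spin_rep_mult)
  have "(\<integral>h. spin_char m (g ** conj_transpose h) * spin_char n (h ** g') \<partial>M) =
    (\<integral>h. (\<Sum>p\<le>m. \<Sum>b\<le>m. \<Sum>c\<le>n. \<Sum>d\<le>n. (spin_rep m g p b * spin_rep n g' d c) *
        (spin_rep n h c d * spin_rep m (conj_transpose h) b p)) \<partial>M)"
    unfolding ch sum_distrib_right unfolding sum_distrib_left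
    by (intro Bochner_Integration.integral_cong sum.cong refl) (simp add: mult_ac)
  also have "\<dots> = (\<Sum>p\<le>m. \<Sum>b\<le>m. \<Sum>c\<le>n. \<Sum>d\<le>n. (spin_rep m g p b * spin_rep n g' d c) *
        (\<integral>h. spin_rep n h c d * spin_rep m (conj_transpose h) b p \<partial>M))"
    by (subst Bochner_Integration.integral_sum, intro haar_integrable SU2_continuous)+ simp
  also have "\<dots> = (\<Sum>p\<le>m. \<Sum>b\<le>m. \<Sum>c\<le>n. \<Sum>d\<le>n. (spin_rep m g p b * spin_rep n g' d c) *
        (if n = m \<and> c = p \<and> d = b then 1 / of_nat (n + 1) else 0))"
    by (intro sum.cong refl) (simp add: haar_matrix_elements[OF nm])
  also have "\<dots> = (if n = m then spin_char n (g ** g') / of_nat (n + 1) else 0)"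
  proof (cases "n = m")
    case True
    have "(\<Sum>c\<le>n. \<Sum>d\<le>n. (spin_rep n g p b * spin_rep n g' d c) * (if n = n \<and> c = p \<and> d = b then 1 / of_nat (n + 1) else 0))
      = spin_rep n g p b * spin_rep n g' b p / of_nat (n + 1)" if "p \<le> n" "b \<le> n" for p b
    proof -
      have "(\<Sum>c\<le>n. \<Sum>d\<le>n. (spin_rep n g p b * spin_rep n g' d c) * (if n = n \<and> c = p \<and> d = b then 1 / of_nat (n + 1) else 0))
       = (\<Sum>c\<le>n. \<Sum>d\<le>n. if c = p then if d = b then spin_rep n g p b * spin_rep n g' b p / of_nat (n + 1) else 0 else 0)"
        by (intro sum.cong refl) auto
      also have "\<dots> = (\<Sum>c\<le>n. if c = p then (\<Sum>d\<le>n. if d = b then spin_rep n g p b * spin_rep n g' b p / of_nat (n + 1) else 0) else 0)"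
        by (intro sum.cong refl) simp
      finally have eq: "(\<Sum>c\<le>n. \<Sum>d\<le>n. (spin_rep n g p b * spin_rep n g' d c) * (if n = n \<and> c = p \<and> d = b then 1 / of_nat (n + 1) else 0))
       = \<dots>" .
      show ?thesis by (rule trans[OF eq]) (use that in simp)
    qed
    then have "(\<Sum>p\<le>n. \<Sum>b\<le>n. \<Sum>c\<le>n. \<Sum>d\<le>n. (spin_rep n g p b * spin_rep n g' d c) *
        (if n = n \<and> c = p \<and> d = b then 1 / of_nat (n + 1) else 0)) = (\<Sum>p\<le>n. \<Sum>b\<le>n. spin_rep n g p b * spin_rep n g' b p / of_nat (n + 1))"
      by (intro sum.cong refl) auto
    then show ?thesis using True by (simp add: ch sum_divide_distrib)
  qed simp
  finally show ?thesis .
qed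

lemma haar_norm_partial_sum:
  fixes N :: nat and t :: real
  assumes det: "det g = 1"
  defines "S \<equiv> \<lambda>h. \<Sum>n<N. of_real (coef t n) * spin_char n (g ** conj_transpose h)"
  shows "(\<integral>h. S h * cnj (S h) \<partial>M) = (\<Sum>n<N. of_real (coef (2 * t) n) * spin_char n (g ** conj_transpose g))"
proof -
  let ?X = "\<lambda>m h. spin_char m (g ** conj_transpose h)"
  have c: "cnj (?X n h) = spin_char n (h ** conj_transpose g)" if "h \<in> SU2" for n h
    using that det SU2D(3)[OF that] by (subst spin_char_cnj) (auto simp: conj_transpose_mult det_mul det_conj_transpose)
  have le: "(\<integral>h. ?X m h * cnj (?X n h) \<partial>M) = (if n = m then spin_char n (g ** conj_transpose g) / of_nat (n + 1) else 0)"
    if "n \<le> m" for n m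
  proof -
    have "(\<integral>h. ?X m h * cnj (?X n h) \<partial>M) = (\<integral>h. ?X m h * spin_char n (h ** conj_transpose g) \<partial>M)"
      by (intro Bochner_Integration.integral_cong refl) (simp add: c haar_space)
    then show ?thesis using haar_characters[OF that] by simp
  qed
  \<comment> \<open>The order n > m, outside the orthogonality lemma, follows by conjugating the
    integral.\<close>
  have X: "(\<integral>h. ?X m h * cnj (?X n h) \<partial>M) = (if n = m then spin_char n (g ** conj_transpose g) / of_nat (n + 1) else 0)" for n m
  proof (cases "n \<le> m")
    case False
    have "(\<integral>h. ?X m h * cnj (?X n h) \<partial>M) = (\<integral>h. cnj (?X n h * cnj (?X m h)) \<partial>M)"
      by (simp add: mult.commute)
    also have "\<dots> = cnj (\<integral>h. ?X n h * cnj (?X m h) \<partial>M)" by (rule Bochner_Integration.integral_cnj)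
    finally show ?thesis using le[of m n] False by auto
  qed (rule le)
  have "(\<integral>h. S h * cnj (S h) \<partial>M) = (\<integral>h. (\<Sum>m<N. \<Sum>n<N. of_real (coef t m * coef t n) * (?X m h * cnj (?X n h))) \<partial>M)"
    unfolding S_def by (simp add: sum_product mult_ac)
  also have "\<dots> = (\<Sum>m<N. \<Sum>n<N. of_real (coef t m * coef t n) * (\<integral>h. ?X m h * cnj (?X n h) \<partial>M))"
    by (subst Bochner_Integration.integral_sum, intro haar_integrable SU2_continuous continuous_on_cnj)+ simp
  also have "\<dots> = (\<Sum>m<N. \<Sum>n<N. if n = m then of_real (coef (2 * t) m) * spin_char m (g ** conj_transpose g) else 0)"
  proof (intro sum.cong refl)
    fix m n
    have "complex_of_real (coef t m * coef t m) * (x / of_nat (m + 1)) = of_real (coef (2 * t) m) * x" for x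
      by (simp add: power2_eq_square add.commute flip: coef_square)
    then show "of_real (coef t m * coef t n) * (\<integral>h. ?X m h * cnj (?X n h) \<partial>M)
        = (if n = m then of_real (coef (2 * t) m) * spin_char m (g ** conj_transpose g) else 0)"
      unfolding X by simp
  qed
  also have "\<dots> = (\<Sum>n<N. of_real (coef (2 * t) n) * spin_char n (g ** conj_transpose g))" by simp
  finally show ?thesis .
qed

text \<open>The partial sums are bounded on SU(2) by one constant B, which is integrable for a
  probability measure; dominated convergence carries the finite identity to the limit.\<close>

lemma psi_norm_sq_sums:
  assumes t: "t > 0" and det: "det g = 1"
  shows "(\<lambda>n. of_real (coef (2 * t) n) * spin_char n (g ** conj_transpose g)) sums of_real (psi_norm_sq M t g)"
proof -
  define R where "R = (\<Sum>i\<in>UNIV. \<Sum>j\<in>UNIV. cmod (g $ i $ j)) + 1"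
  have R: "R > 0" unfolding R_def by (intro add_nonneg_pos sum_nonneg) auto
  note sm = summable_coef[OF t R]
  define B where "B = (\<Sum>n. coef t n * ((real n + 1) * R ^ n))"
  define S where "S = (\<lambda>N h. \<Sum>n<N. of_real (coef t n) * spin_char n (g ** conj_transpose h))"
  have b: "cmod (of_real (coef t n) * spin_char n (g ** conj_transpose h)) \<le> coef t n * ((real n + 1) * R ^ n)"
    if "h \<in> SU2" for n h
    using mult_left_mono[OF spin_char_SU2_bound[OF that det, of n], of "coef t n"] coef_pos[of t n]
    by (simp add: norm_mult R_def)
  have S: "(\<lambda>N. S N h) \<longlonglongrightarrow> psi t g h" if h: "h \<in> SU2" for h
    unfolding S_def psi_eq matrix_inv_SU2[OF h]
    by (rule summable_LIMSEQ, rule summable_comparison_test'[OF sm]) (rule b[OF h])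
  have SB: "cmod (S N h) \<le> B" if h: "h \<in> SU2" for N h
  proof -
    have "cmod (S N h) \<le> (\<Sum>n<N. coef t n * ((real n + 1) * R ^ n))"
      unfolding S_def by (intro sum_norm_le b h)
    also have "\<dots> \<le> B" unfolding B_def using R coef_pos[of t]
      by (intro sum_le_suminf sm) (auto intro!: mult_nonneg_nonneg less_imp_le)
    finally show ?thesis .
  qed
  have Sc: "continuous_on SU2 (S N)" for N unfolding S_def by (intro SU2_continuous)
  have sq: "z * cnj z = of_real ((cmod z)\<^sup>2)" for z by (simp only: complex_norm_square)
  interpret prob_space M by (rule haar_prob)
  have Sm: "S N \<in> borel_measurable M" for N by (rule haar_measurable[OF Sc])
  have pm: "(\<lambda>h. psi t g h) \<in> borel_measurable M"
    by (rule borel_measurable_LIMSEQ_metric[OF Sm]) (use S haar_space in auto)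
  have "(\<lambda>N. \<integral>h. S N h * cnj (S N h) \<partial>M) \<longlonglongrightarrow> (\<integral>h. of_real ((cmod (psi t g h))\<^sup>2) \<partial>M)"
  proof (rule integral_dominated_convergence[where w="\<lambda>_. B\<^sup>2"])
    show "AE h in M. (\<lambda>N. S N h * cnj (S N h)) \<longlonglongrightarrow> of_real ((cmod (psi t g h))\<^sup>2)"
      unfolding sq using S haar_space by (intro AE_I2 tendsto_intros) auto
    show "AE h in M. norm (S N h * cnj (S N h)) \<le> B\<^sup>2" for N
      unfolding sq norm_of_real using power_mono[OF SB norm_ge_zero, of _ N 2] haar_space by (intro AE_I2) simp
    show "(\<lambda>h. S N h * cnj (S N h)) \<in> borel_measurable M" for N
      unfolding sq using Sm by measurable
  qed (use pm in \<open>auto\<close>)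
  also have "(\<integral>h. of_real ((cmod (psi t g h))\<^sup>2) \<partial>M) = complex_of_real (psi_norm_sq M t g)"
    unfolding psi_norm_sq_def by (rule integral_complex_of_real)
  finally show ?thesis
    unfolding sums_def S_def haar_norm_partial_sum[OF det] .
qed

end


section \<open>Exponentials of Pauli matrices\<close>

lemma bounded_linear_cscale: "bounded_linear (\<lambda>c. cscale c A)"
  by (intro linear_conv_bounded_linear[THEN iffD1] linearI)
     (auto simp: cscale_def vec_eq_iff algebra_simps)

lemma cscale_entry [simp]: "cscale c A $ i $ j = c * A $ i $ j"
  by (simp add: cscale_def)

text \<open>Even powers are multiples of the identity and odd ones of A. The half sums and
  differences of z^n and (-z)^n select the parity and add up to \<open>cosh\<close> and
  \<open>sinh\<close>.\<close>

lemma matrix_power_square_root: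
  assumes A: "A ** A = cscale (z\<^sup>2) (mat 1)" and z: "z \<noteq> 0"
  shows "(((**) A) ^^ n) (mat 1) =
    cscale ((z ^ n + (- z) ^ n) / 2) (mat 1) + cscale ((z ^ n - (- z) ^ n) / (2 * z)) A"
proof (induction n)
  case 0
  then show ?case by (simp add: cscale_def vec_eq_iff)
next
  case (Suc n)
  have sc: "A ** cscale c B = cscale c (A ** B)" for c and B :: "complex^2^2"
    by (simp add: cscale_def matrix_matrix_mult_def vec_eq_iff sum_distrib_left mult_ac)
  have 1: "(z ^ n - (- z) ^ n) / (2 * z) * z\<^sup>2 = (z ^ Suc n + (- z) ^ Suc n) / 2"
    using z by (simp add: field_simps power2_eq_square)
  have 2: "(z ^ n + (- z) ^ n) / 2 = (z ^ Suc n - (- z) ^ Suc n) / (2 * z)"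
    using z by (simp add: field_simps)
  have "(((**) A) ^^ Suc n) (mat 1) = A ** (cscale ((z ^ n + (- z) ^ n) / 2) (mat 1) + cscale ((z ^ n - (- z) ^ n) / (2 * z)) A)"
    using Suc by simp
  also have "\<dots> = cscale ((z ^ n + (- z) ^ n) / 2) A + cscale ((z ^ n - (- z) ^ n) / (2 * z)) (cscale (z\<^sup>2) (mat 1))"
    unfolding matrix_add_ldistrib sc A by simp
  also have "cscale ((z ^ n - (- z) ^ n) / (2 * z)) (cscale (z\<^sup>2) (mat 1)) = cscale ((z ^ Suc n + (- z) ^ Suc n) / 2) (mat 1)"
    unfolding 1[symmetric] by (simp add: cscale_def vec_eq_iff mult.assoc)
  finally show ?case unfolding 2 by (simp only: add.commute)
qed

text \<open>For z = 0 the quotient \<open>sinh z / z\<close> is 0, not 1, so a nonzero nilpotent A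
  would violate the formula; the second premise excludes it.\<close>

lemma matrix_exp_square_root:
  assumes A: "A ** A = cscale (z\<^sup>2) (mat 1)" and z: "z = 0 \<Longrightarrow> A = 0"
  shows "matrix_exp A = cscale (cosh z) (mat 1) + cscale (sinh z / z) A"
proof (cases "z = 0")
  case True
  then have "A = 0" by (rule z)
  have "(((**) 0) ^^ n) (mat 1) = (if n = 0 then mat 1 else 0 :: complex^2^2)" for n
    by (induction n) auto
  then have "(\<lambda>n. (1 / fact n) *\<^sub>R (((**) A) ^^ n) (mat 1)) = (\<lambda>n. if n = 0 then mat 1 else 0)"
    using \<open>A = 0\<close> by auto
  moreover have "(\<lambda>n. if n = 0 then mat 1 else 0 :: complex^2^2) sums (mat 1)"
    using sums_single[of 0 "\<lambda>_. mat 1 :: complex^2^2"] by simp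
  ultimately have "matrix_exp A = mat 1" by (simp add: matrix_exp_def sums_iff)
  then show ?thesis using True by (simp add: cscale_def vec_eq_iff)
next
  case False
  have e: "(\<lambda>n. z ^ n /\<^sub>R fact n) sums exp z" for z :: complex by (rule exp_converges)
  have c: "(\<lambda>n. (z ^ n /\<^sub>R fact n + (- z) ^ n /\<^sub>R fact n) / 2) sums cosh z"
    unfolding cosh_field_def by (intro sums_divide sums_add e)
  have s: "(\<lambda>n. (z ^ n /\<^sub>R fact n - (- z) ^ n /\<^sub>R fact n) / 2 / z) sums (sinh z / z)"
    unfolding sinh_field_def by (intro sums_divide sums_diff e)
  have "(\<lambda>n. cscale ((z ^ n /\<^sub>R fact n + (- z) ^ n /\<^sub>R fact n) / 2) (mat 1) + cscale ((z ^ n /\<^sub>R fact n - (- z) ^ n /\<^sub>R fact n) / 2 / z) A)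
    sums (cscale (cosh z) (mat 1) + cscale (sinh z / z) A)"
    by (intro sums_add bounded_linear.sums[OF bounded_linear_cscale] c s)
  moreover have "cscale ((z ^ n /\<^sub>R fact n + (- z) ^ n /\<^sub>R fact n) / 2) (mat 1) + cscale ((z ^ n /\<^sub>R fact n - (- z) ^ n /\<^sub>R fact n) / 2 / z) A
     = (1 / fact n) *\<^sub>R (((**) A) ^^ n) (mat 1)" for n
  proof -
    have 1: "(z ^ n /\<^sub>R fact n + (- z) ^ n /\<^sub>R fact n) / 2 = (1 / fact n) *\<^sub>R ((z ^ n + (- z) ^ n) / 2)"
      by (simp add: scaleR_conv_of_real field_simps)
    have 2: "(z ^ n /\<^sub>R fact n - (- z) ^ n /\<^sub>R fact n) / 2 / z = (1 / fact n) *\<^sub>R ((z ^ n - (- z) ^ n) / (2 * z))"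
      by (simp add: scaleR_conv_of_real field_simps)
    show ?thesis
      unfolding 1 2 matrix_power_square_root[OF A False] scaleR_add_right
      by (simp only: linear_scale[OF bounded_linear.linear[OF bounded_linear_cscale]])
  qed
  ultimately show ?thesis by (simp add: matrix_exp_def sums_iff)
qed

lemma tau_vec_entry:
  "tau_vec v $ 1 $ 1 = - \<i> * of_real (v $ 3)" "tau_vec v $ 1 $ 2 = - \<i> * of_real (v $ 1) - of_real (v $ 2)"
  "tau_vec v $ 2 $ 1 = - \<i> * of_real (v $ 1) + of_real (v $ 2)" "tau_vec v $ 2 $ 2 = \<i> * of_real (v $ 3)"
  unfolding tau_vec_def sum_3 vector_add_component by (simp_all add: tau_def pauli_def complex_eq_iff)

lemma norm_square_3: "(norm v)\<^sup>2 = (v $ 1)\<^sup>2 + (v $ 2)\<^sup>2 + (v $ 3)\<^sup>2" for v :: "real^3"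
  by (simp only: power2_norm_eq_inner inner_vec_def sum_3 inner_real_def) (simp add: power2_eq_square)

lemma inner_3: "u \<bullet> v = u $ 1 * v $ 1 + u $ 2 * v $ 2 + u $ 3 * v $ 3" for u v :: "real^3"
  by (simp add: inner_vec_def sum_3)

text \<open>\<open>tau_vec v\<close> squares to minus the squared norm of v. Leaving c and the root
  z open covers both the hermitian case, z = p / 2, and the unitary one, z = i theta.\<close>

lemma matrix_exp_tau_vec:
  assumes z: "z\<^sup>2 = - c\<^sup>2 * of_real ((norm v)\<^sup>2)" and c: "c \<noteq> 0"
  shows "matrix_exp (cscale c (tau_vec v)) = cscale (cosh z) (mat 1) + cscale (sinh z / z * c) (tau_vec v)"
proof -
  have "matrix_exp (cscale c (tau_vec v)) = cscale (cosh z) (mat 1) + cscale (sinh z / z) (cscale c (tau_vec v))"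
  proof (rule matrix_exp_square_root)
    show "cscale c (tau_vec v) ** cscale c (tau_vec v) = cscale (z\<^sup>2) (mat 1)"
      unfolding z norm_square_3
      by (simp add: matrix_eq_2x2 mult_2x2 tau_vec_entry mat_def power2_eq_square algebra_simps)
    assume "z = 0"
    then have "v = 0" using z c by simp
    then show "cscale c (tau_vec v) = 0" by (simp add: matrix_eq_2x2 tau_vec_entry)
  qed
  then show ?thesis by (simp add: matrix_eq_2x2 mult.assoc)
qed

section \<open>Complexified quaternions\<close>

text \<open>A complexified quaternion with scalar part a and vector part b v. Both H and h have this
  form, and the trace of a product reduces to a scalar product of vectors.\<close>

definition quat :: "complex \<Rightarrow> complex \<Rightarrow> real^3 \<Rightarrow> complex^2^2" where
  "quat a b v = cscale a (mat 1) + cscale b (tau_vec v)"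

lemma quat_entry:
  "quat a b v $ 1 $ 1 = a - b * (\<i> * of_real (v $ 3))" "quat a b v $ 1 $ 2 = - b * (\<i> * of_real (v $ 1) + of_real (v $ 2))"
  "quat a b v $ 2 $ 1 = - b * (\<i> * of_real (v $ 1) - of_real (v $ 2))" "quat a b v $ 2 $ 2 = a + b * (\<i> * of_real (v $ 3))"
  by (simp_all add: quat_def tau_vec_entry mat_def algebra_simps)

lemma det_quat: "det (quat a b v) = a\<^sup>2 + b\<^sup>2 * of_real ((norm v)\<^sup>2)"
  unfolding norm_square_3 by (simp add: det_2 quat_entry power2_eq_square algebra_simps)

lemma conj_transpose_quat: "conj_transpose (quat a b v) = quat (cnj a) (- cnj b) v"
  by (simp add: matrix_eq_2x2 quat_entry conj_transpose_def algebra_simps)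

lemma quat_mult_same: "quat a b v ** quat c d v = quat (a * c - b * d * of_real ((norm v)\<^sup>2)) (a * d + b * c) v"
  unfolding norm_square_3 by (simp add: matrix_eq_2x2 mult_2x2 quat_entry power2_eq_square algebra_simps)

lemma trace_quat_mult:
  "(quat a b u ** quat c d v) $ 1 $ 1 + (quat a b u ** quat c d v) $ 2 $ 2 = 2 * (a * c - b * d * of_real (u \<bullet> v))"
  unfolding inner_3 by (simp add: mult_2x2 quat_entry algebra_simps)

lemma quat_id: "quat 1 0 v = mat 1"
  by (simp add: quat_def matrix_eq_2x2)

text \<open>At p = 0 the coefficient is 0 by the division convention; it multiplies the zero vector,
  so the formula still gives the identity.\<close>

lemma matrix_exp_hermitian:
  fixes v :: "real^3"
  defines "p \<equiv> norm v"
  shows "matrix_exp (cscale (- \<i> / 2) (tau_vec v)) = quat (of_real (cosh (p / 2))) (- \<i> * of_real (sinh (p / 2) / p)) v"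
proof -
  have c: "cosh (complex_of_real (p / 2)) = of_real (cosh (p / 2))" "sinh (complex_of_real (p / 2)) = of_real (sinh (p / 2))"
    by (simp_all add: cosh_def sinh_def scaleR_conv_of_real flip: exp_of_real)
  have "matrix_exp (cscale (- \<i> / 2) (tau_vec v)) = cscale (cosh (complex_of_real (p / 2))) (mat 1)
     + cscale (sinh (complex_of_real (p / 2)) / complex_of_real (p / 2) * (- \<i> / 2)) (tau_vec v)"
    by (rule matrix_exp_tau_vec) (auto simp: p_def power_divide power_mult_distrib)
  then show ?thesis unfolding quat_def c by (simp add: mult_ac)
qed

lemma matrix_exp_unitary:
  fixes v :: "real^3"
  defines "th \<equiv> norm v"
  shows "matrix_exp (tau_vec v) = quat (of_real (cos th)) (of_real (sin th / th)) v"
proof -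
  have c: "cosh (\<i> * complex_of_real th) = of_real (cos th)" "sinh (\<i> * complex_of_real th) = \<i> * of_real (sin th)"
    by (simp_all add: cosh_conv_cos sinh_conv_sin cos_of_real sin_of_real)
  have "matrix_exp (cscale 1 (tau_vec v)) = cscale (cosh (\<i> * complex_of_real th)) (mat 1)
     + cscale (sinh (\<i> * complex_of_real th) / (\<i> * complex_of_real th) * 1) (tau_vec v)"
    by (rule matrix_exp_tau_vec) (auto simp: th_def power_mult_distrib)
  moreover have "cscale 1 (tau_vec v) = tau_vec v" by (simp add: matrix_eq_2x2)
  ultimately show ?thesis unfolding quat_def c by simp
qed

lemma coherent_state_matrices:
  fixes pv thetav :: "real^3" and alpha :: real
  defines "p \<equiv> norm pv" and "th \<equiv> norm thetav"
  assumes al: "p \<noteq> 0 \<and> th \<noteq> 0 \<longrightarrow> cos alpha = (pv \<bullet> thetav) / (p * th)"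
    and H: "H = matrix_exp (cscale (- \<i> / 2) (tau_vec pv))"
    and h: "h = matrix_exp (tau_vec thetav)"
  shows "det H = 1" "(H ** conj_transpose H) $ 1 $ 1 + (H ** conj_transpose H) $ 2 $ 2 = 2 * of_real (cosh p)"
    and "h \<in> SU2"
    and "(H ** conj_transpose h) $ 1 $ 1 + (H ** conj_transpose h) $ 2 $ 2 =
       2 * cnj (Complex (cosh (p / 2) * cos th) (sinh (p / 2) * sin th * cos alpha))"
proof -
  define s where "s = sinh (p / 2) / p"
  define r where "r = sin th / th"
  have H: "H = quat (of_real (cosh (p / 2))) (- \<i> * of_real s) pv"
    unfolding H s_def p_def by (rule matrix_exp_hermitian)
  have h: "h = quat (of_real (cos th)) (of_real r) thetav"
    unfolding h r_def th_def by (rule matrix_exp_unitary)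
  have sp: "s * p = sinh (p / 2)" by (simp add: s_def)
  have rt: "r * th = sin th" by (simp add: r_def)
  have sp2: "s\<^sup>2 * p\<^sup>2 = (sinh (p / 2))\<^sup>2" by (simp add: power_mult_distrib flip: sp)
  have rt2: "r\<^sup>2 * th\<^sup>2 = (sin th)\<^sup>2" by (simp add: power_mult_distrib flip: rt)
  have "det H = of_real ((cosh (p / 2))\<^sup>2 - s\<^sup>2 * p\<^sup>2)"
    unfolding H det_quat by (simp add: power_mult_distrib p_def)
  then show "det H = 1" unfolding sp2 by (simp add: cosh_square_eq)
  have "conj_transpose H = H" unfolding H conj_transpose_quat by simp
  then have "(H ** conj_transpose H) $ 1 $ 1 + (H ** conj_transpose H) $ 2 $ 2 = 2 * of_real ((cosh (p / 2))\<^sup>2 + s\<^sup>2 * p\<^sup>2)"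
    unfolding H by (simp only: trace_quat_mult) (simp add: power2_eq_square p_def dot_square_norm)
  also have "(cosh (p / 2))\<^sup>2 + s\<^sup>2 * p\<^sup>2 = cosh p"
    unfolding sp2 using cosh_double[of "p / 2"] by simp
  finally show "(H ** conj_transpose H) $ 1 $ 1 + (H ** conj_transpose H) $ 2 $ 2 = 2 * of_real (cosh p)" .
  have n: "complex_of_real (cos th) * of_real (cos th) - of_real r * - of_real r * of_real ((norm thetav)\<^sup>2) = 1"
  proof -
    have "complex_of_real (cos th) * of_real (cos th) - of_real r * - of_real r * of_real ((norm thetav)\<^sup>2)
      = of_real ((cos th)\<^sup>2 + r\<^sup>2 * th\<^sup>2)"
      by (simp add: th_def power2_eq_square)
    then show ?thesis unfolding rt2 by simp
  qed
  have "det h = of_real ((cos th)\<^sup>2 + r\<^sup>2 * th\<^sup>2)"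
    unfolding h det_quat by (simp add: th_def)
  then have "det h = 1" unfolding rt2 by simp
  moreover have "h ** conj_transpose h = quat 1 0 thetav" "conj_transpose h ** h = quat 1 0 thetav"
    unfolding h conj_transpose_quat quat_mult_same using n by (simp_all add: mult_ac)
  ultimately show "h \<in> SU2" by (simp add: SU2_def quat_id)
  have "(H ** conj_transpose h) $ 1 $ 1 + (H ** conj_transpose h) $ 2 $ 2 =
     2 * (of_real (cosh (p / 2) * cos th) - \<i> * of_real (s * r * (pv \<bullet> thetav)))"
    unfolding H h conj_transpose_quat trace_quat_mult by simp
  \<comment> \<open>If p or theta is 0, both sides vanish for every alpha; the angle may then be
    arbitrary.\<close>
  also have "s * r * (pv \<bullet> thetav) = sinh (p / 2) * sin th * cos alpha"
  proof (cases "p = 0 \<or> th = 0")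
    case True
    then show ?thesis by (auto simp: s_def r_def)
  next
    case False
    then have "pv \<bullet> thetav = p * th * cos alpha" using al by (simp add: field_simps)
    then show ?thesis by (simp flip: sp rt)
  qed
  finally show "(H ** conj_transpose h) $ 1 $ 1 + (H ** conj_transpose h) $ 2 $ 2 =
       2 * cnj (Complex (cosh (p / 2) * cos th) (sinh (p / 2) * sin th * cos alpha))"
    by (simp add: complex_eq_iff)
qed


section \<open>Asymptotics of the coherent states\<close>

text \<open>The character as a function of w for trace 2 cosh w. The finite sum, unlike sinh ((n +
  1) w) / sinh w, makes sense at the zeros of \<open>sinh\<close>.\<close>

definition chi :: "nat \<Rightarrow> complex \<Rightarrow> complex" where
  "chi n w = (\<Sum>k\<le>n. exp (of_nat k * w) * exp (- (of_nat (n - k) * w)))"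

definition wave :: "real \<Rightarrow> complex \<Rightarrow> complex" where
  "wave t w = (\<Sum>n. of_real (coef t n) * chi n w)"

lemma sinh_chi: "sinh w * chi n w = sinh (of_nat (Suc n) * w)"
proof -
  have "chi n w = (\<Sum>k<Suc n. exp w ^ k * exp (- w) ^ (n - k))"
    unfolding chi_def lessThan_Suc_atMost
    by (intro sum.cong refl) (simp only: mult_minus_right[symmetric] exp_of_nat_mult)
  then have "(exp w - exp (- w)) * chi n w = exp w ^ Suc n - exp (- w) ^ Suc n"
    by (simp only: diff_power_eq_sum[symmetric])
  also have "\<dots> = exp (of_nat (Suc n) * w) - exp (- (of_nat (Suc n) * w))"
    by (simp only: mult_minus_right[symmetric] exp_of_nat_mult)
  finally show ?thesis by (simp only: sinh_field_def times_divide_eq_left)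
qed

lemma chi_bound:
  assumes "\<bar>Re w\<bar> \<le> r"
  shows "cmod (chi n w) \<le> (real n + 1) * exp r ^ n"
proof -
  have "cmod (chi n w) \<le> (\<Sum>k\<le>n. exp r ^ n)"
    unfolding chi_def
  proof (rule sum_norm_le)
    fix k assume k: "k \<in> {..n}"
    have "real k * Re w \<le> real k * r" "real (n - k) * (- Re w) \<le> real (n - k) * r"
      using assms by (intro mult_left_mono; simp add: abs_le_iff)+
    then have "real k * Re w - real (n - k) * Re w \<le> real k * r + real (n - k) * r" by simp
    also have "\<dots> = real n * r" using k by (simp add: of_nat_diff algebra_simps)
    finally have le: "real k * Re w - real (n - k) * Re w \<le> real n * r" .
    have "cmod (exp (of_nat k * w) * exp (- (of_nat (n - k) * w))) = exp (real k * Re w - real (n - k) * Re w)"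
      by (simp only: norm_mult norm_exp_eq_Re exp_add[symmetric]) simp
    also have "\<dots> \<le> exp (real n * r)" using le by simp
    finally show "cmod (exp (of_nat k * w) * exp (- (of_nat (n - k) * w))) \<le> exp r ^ n"
      by (simp only: exp_of_nat_mult)
  qed
  then show ?thesis by (simp add: add.commute)
qed

lemma wave_term_bound:
  assumes "\<bar>Re w\<bar> \<le> r"
  shows "cmod (of_real (coef t n) * chi n w) \<le> coef t n * ((real n + 1) * exp r ^ n)"
  using mult_left_mono[OF chi_bound[OF assms, of n], of "coef t n"] coef_pos[of t n] by (simp add: norm_mult)

lemma wave_sums:
  assumes "t > 0" shows "(\<lambda>n. of_real (coef t n) * chi n w) sums wave t w"
  unfolding wave_def
  by (rule summable_sums, rule summable_comparison_test'[OF summable_coef[OF assms exp_gt_zero[of "\<bar>Re w\<bar>"]]])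
     (rule wave_term_bound, simp)

text \<open>Supplies the values at the zeros of \<open>sinh\<close>, where a formula for
  \<open>sinh w * wave t w\<close> says nothing about \<open>wave\<close>.\<close>

lemma isCont_wave:
  assumes "t > 0" shows "isCont (wave t) w"
proof -
  let ?S = "ball w 1"
  define r where "r = \<bar>Re w\<bar> + 1"
  have "continuous_on ?S (wave t)"
    unfolding wave_def[abs_def]
  proof (rule uniform_limit_theorem[OF _ Weierstrass_m_test])
    show "\<forall>\<^sub>F n in sequentially. continuous_on ?S (\<lambda>w. \<Sum>i<n. of_real (coef t i) * chi i w)"
      unfolding chi_def by (intro always_eventually allI continuous_intros)
    show "summable (\<lambda>n. coef t n * ((real n + 1) * exp r ^ n))"
      by (rule summable_coef) (use assms in auto)
    fix n v assume "v \<in> ?S"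
    then have "cmod (v - w) < 1" by (simp add: dist_norm norm_minus_commute)
    then have "\<bar>Re v\<bar> \<le> r" using abs_Re_le_cmod[of "v - w"] unfolding r_def by simp
    then show "cmod (of_real (coef t n) * chi n v) \<le> coef t n * ((real n + 1) * exp r ^ n)" by (rule wave_term_bound)
  qed simp
  then show ?thesis by (simp add: continuous_on_eq_continuous_at)
qed

lemma psi_eq_wave:
  assumes "det g = 1" "h \<in> SU2"
    and "(g ** conj_transpose h) $ 1 $ 1 + (g ** conj_transpose h) $ 2 $ 2 = 2 * cosh w"
  shows "psi t g h = wave t w"
proof -
  have "det (g ** conj_transpose h) = 1" using assms SU2D(3) by (simp add: det_mul det_conj_transpose)
  from spin_char_cosh[OF this assms(3)] show ?thesis
    unfolding psi_eq wave_def matrix_inv_SU2[OF assms(2)] by (simp only: chi_def)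
qed

lemma psi_norm_sq_eq_wave:
  assumes "normalized_haar_SU2 M" "t > 0" "det g = 1"
    and "(g ** conj_transpose g) $ 1 $ 1 + (g ** conj_transpose g) $ 2 $ 2 = 2 * cosh w"
  shows "of_real (psi_norm_sq M t g) = wave (2 * t) w"
proof -
  have "det (g ** conj_transpose g) = 1" using assms by (simp add: det_mul det_conj_transpose)
  from psi_norm_sq_sums[OF assms(1-3)] show ?thesis
    unfolding spin_char_cosh[OF \<open>det (g ** conj_transpose g) = 1\<close> assms(4)] wave_def chi_def[symmetric]
    by (simp add: sums_iff)
qed

text \<open>exp (t/8) comes from n (n + 2) = (n + 1)^2 - 1, the 1/2 from \<open>sinh\<close>, sqrt
  (8 pi / t) from Poisson summation with a = t/8, and 4/t = 1/(2a) from differentiating the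
  Gaussian.\<close>

definition amp :: "real \<Rightarrow> real" where
  "amp t = exp (t / 8) / 2 * sqrt (8 * pi / t) * (4 / t)"

text \<open>k is real so that a shift of w by i pi can be absorbed into half-integral k.\<close>

definition dual_term :: "real \<Rightarrow> real \<Rightarrow> complex \<Rightarrow> complex" where
  "dual_term t k w = (w + 2 * of_real pi * \<i> * of_real k) * exp (2 * (w + 2 * of_real pi * \<i> * of_real k)\<^sup>2 / of_real t)"

lemma dual_term_minus: "dual_term t k (- w) = - dual_term t (- k) w"
  by (simp add: dual_term_def power2_eq_square algebra_simps)

lemma sinh_wave:
  assumes t: "t > 0"
  shows "summable (\<lambda>n. dual_term t (real n) w)" "summable (\<lambda>n. dual_term t (- real n) w)"
    "sinh w * wave t w = of_real (amp t) * ((\<Sum>n. dual_term t (real n) w) + (\<Sum>n. dual_term t (- real n) w) - dual_term t 0 w)"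
proof -
  define a where "a = t / 8"
  have a: "a > 0" using t by (simp add: a_def)
  let ?D = "\<lambda>n w. (w + 2 * of_real pi * \<i> * of_nat n) / (2 * of_real a) * gauss_half a n w"
  have D: "?D n w = of_real (4 / t) * dual_term t (real n) w" for n w
    using t by (simp add: gauss_half_def dual_term_def a_def mult_ac)
  obtain L M where L: "(\<lambda>n. of_nat n * theta_half a n w) sums L" and M: "(\<lambda>n. of_nat n * theta_half a n (-w)) sums M"
    and s1: "summable (\<lambda>n. ?D n w)" and s2: "summable (\<lambda>n. ?D n (-w))"
    and eq: "L - M = of_real (sqrt (pi / a)) * ((\<Sum>n. ?D n w) - (\<Sum>n. ?D n (-w)) - ?D 0 w)"
    by (rule poisson_gaussian_derivative[OF a, of w])
  have nz: "complex_of_real (4 / t) \<noteq> 0" using t by simp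
  have s1': "summable (\<lambda>n. dual_term t (real n) w)"
    using s1 unfolding D by (subst (asm) summable_cmult_iff) (use nz in auto)
  have "summable (\<lambda>n. - dual_term t (- real n) w)"
    using s2 unfolding D dual_term_minus by (subst (asm) summable_cmult_iff) (use nz in auto)
  then have s2': "summable (\<lambda>n. dual_term t (- real n) w)" by (simp add: summable_minus_iff)
  show "summable (\<lambda>n. dual_term t (real n) w)" "summable (\<lambda>n. dual_term t (- real n) w)" by fact+
  \<comment> \<open>Reindexing by the dimension n + 1 is harmless because the weight n kills the
    term at 0.\<close>
  have "(\<lambda>n. of_real (exp (t / 8) / 2) * (of_nat (Suc n) * theta_half a (Suc n) w - of_nat (Suc n) * theta_half a (Suc n) (- w)))
     sums (of_real (exp (t / 8) / 2) * (L - M))"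
    by (intro sums_mult, subst sums_Suc_iff[where f="\<lambda>n. of_nat n * theta_half a n w - of_nat n * theta_half a n (- w)"])
       (use sums_diff[OF L M] in simp)
  moreover have "of_real (exp (t / 8) / 2) * (of_nat (Suc n) * theta_half a (Suc n) w - of_nat (Suc n) * theta_half a (Suc n) (- w))
     = sinh w * (of_real (coef t n) * chi n w)" for n
  proof -
    have ce: "coef t n = real (Suc n) * (exp (t / 8) * exp (- a * (real (Suc n))\<^sup>2))"
      unfolding coef_def a_def exp_add[symmetric] by (simp add: power2_eq_square algebra_simps)
    have "sinh w * (of_real (coef t n) * chi n w) = of_real (coef t n) * sinh (of_nat (Suc n) * w)"
      by (simp only: mult.left_commute[of "sinh w"] sinh_chi)
    also have "\<dots> = of_real (real (Suc n) * (exp (t / 8) * exp (- a * (real (Suc n))\<^sup>2))) *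
      ((exp (of_nat (Suc n) * w) - exp (- (of_nat (Suc n) * w))) / 2)"
      unfolding ce by (simp only: sinh_field_def)
    finally have 1: "sinh w * (of_real (coef t n) * chi n w) = of_real (real (Suc n) * (exp (t / 8) * exp (- a * (real (Suc n))\<^sup>2))) *
      ((exp (of_nat (Suc n) * w) - exp (- (of_nat (Suc n) * w))) / 2)" .
    have th: "theta_half a (Suc n) v = exp (of_nat (Suc n) * v) * of_real (exp (- a * (real (Suc n))\<^sup>2))" for v
      unfolding theta_half_def by (simp add: exp_diff exp_minus divide_inverse flip: exp_of_real del: of_nat_Suc)
    show ?thesis unfolding 1 th mult_minus_right of_real_mult of_real_divide of_real_of_nat_eq of_real_numeral
      by (simp only: left_diff_distrib right_diff_distrib diff_divide_distrib times_divide_eq_left times_divide_eq_right mult_ac)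
  qed
  ultimately have "(\<lambda>n. sinh w * (of_real (coef t n) * chi n w)) sums (of_real (exp (t / 8) / 2) * (L - M))" by simp
  from sums_unique2[OF sums_mult[OF wave_sums[OF t]] this]
  have "sinh w * wave t w = of_real (exp (t / 8) / 2) * (L - M)" .
  also have "L - M = of_real (sqrt (pi / a)) * of_real (4 / t) *
     ((\<Sum>n. dual_term t (real n) w) + (\<Sum>n. dual_term t (- real n) w) - dual_term t 0 w)"
    unfolding eq D dual_term_minus
    using suminf_mult[OF s1', of "of_real (4 / t)"] suminf_mult[OF s2', of "of_real (4 / t)"]
      suminf_minus[OF summable_mult[OF s2', of "of_real (4 / t)"]]
    by (simp add: algebra_simps)
  finally show "sinh w * wave t w = of_real (amp t) * ((\<Sum>n. dual_term t (real n) w) + (\<Sum>n. dual_term t (- real n) w) - dual_term t 0 w)"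
    by (simp add: amp_def a_def mult_ac)
qed

section \<open>Paired terms of the dual series\<close>

lemma norm_cosh_le: "cmod (cosh u) \<le> exp \<bar>Re u\<bar>"
proof -
  have "cmod (cosh u) \<le> (cmod (exp u) + cmod (exp (- u))) / 2"
    unfolding cosh_field_def using norm_triangle_ineq[of "exp u" "exp (- u)"] by (simp add: norm_divide)
  also have "\<dots> \<le> exp \<bar>Re u\<bar>" by (simp add: norm_exp_eq_Re) (smt (verit) exp_le_cancel_iff)
  finally show ?thesis .
qed

text \<open>The mean value estimate on a vertical strip keeps a factor |u|; it is this factor that
  later produces |w|.\<close>

lemma norm_sinh_le: "cmod (sinh u) \<le> cmod u * exp \<bar>Re u\<bar>"
proof -
  let ?S = "{z. Re z \<le> \<bar>Re u\<bar>} \<inter> {z. - \<bar>Re u\<bar> \<le> Re z}"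
  have "cmod (sinh u - sinh 0) \<le> exp \<bar>Re u\<bar> * cmod (u - 0)"
  proof (rule field_differentiable_bound[of ?S])
    show "convex ?S" by (intro convex_Int convex_halfspace_Re_le convex_halfspace_Re_ge)
    show "(sinh has_field_derivative cosh z) (at z within ?S)" for z :: complex
      by (auto intro!: derivative_eq_intros)
    show "cmod (cosh z) \<le> exp \<bar>Re u\<bar>" if "z \<in> ?S" for z
      using that norm_cosh_le[of z] by (smt (verit) Int_iff exp_le_cancel_iff mem_Collect_eq)
  qed auto
  then show ?thesis by (simp add: mult.commute)
qed

text \<open>With the common Gaussian E taken out, the pair is E (2 w cosh u + 4 pi i k sinh u), and
  u is a multiple of w. Each summand is thus bounded by a multiple of |w|.\<close>

lemma dual_term_pair_bound:
  assumes t: "t > 0" and k: "k \<ge> 0"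
  shows "cmod (dual_term t k w + dual_term t (- k) w) \<le>
    cmod w * exp ((2 * ((Re w)\<^sup>2 - (Im w)\<^sup>2) - 8 * pi\<^sup>2 * k\<^sup>2 + 8 * pi * k * \<bar>Im w\<bar>) / t) * (2 + 32 * pi\<^sup>2 * k\<^sup>2 / t)"
proof -
  define u where "u = 8 * of_real pi * \<i> * of_real k * w / of_real t"
  define E where "E = exp (2 * w\<^sup>2 / of_real t) * of_real (exp (- 8 * pi\<^sup>2 * k\<^sup>2 / t))"
  have 1: "exp (2 * (w + 2 * of_real pi * \<i> * of_real k)\<^sup>2 / of_real t) = E * exp u"
    unfolding E_def u_def exp_of_real[symmetric] exp_add[symmetric]
    by (rule arg_cong[where f=exp]) (simp add: power2_eq_square algebra_simps add_divide_distrib diff_divide_distrib)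
  have 2: "exp (2 * (w + 2 * of_real pi * \<i> * of_real (- k))\<^sup>2 / of_real t) = E * exp (- u)"
    unfolding E_def u_def exp_of_real[symmetric] exp_add[symmetric]
    by (rule arg_cong[where f=exp]) (simp add: power2_eq_square algebra_simps add_divide_distrib diff_divide_distrib)
  have "dual_term t k w + dual_term t (- k) w = E * (2 * w * cosh u + 4 * of_real pi * \<i> * of_real k * sinh u)"
    unfolding dual_term_def 1 2 cosh_field_def sinh_field_def by (simp add: field_simps)
  also have "cmod \<dots> \<le> cmod E * (2 * cmod w * exp \<bar>Re u\<bar> + 4 * pi * k * (cmod u * exp \<bar>Re u\<bar>))"
    unfolding norm_mult[of E]
  proof (intro mult_left_mono norm_ge_zero order_trans[OF norm_triangle_ineq] add_mono)
    show "cmod (2 * w * cosh u) \<le> 2 * cmod w * exp \<bar>Re u\<bar>"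
      using mult_left_mono[OF norm_cosh_le[of u], of "2 * cmod w"] by (simp add: norm_mult)
    show "cmod (4 * of_real pi * \<i> * of_real k * sinh u) \<le> 4 * pi * k * (cmod u * exp \<bar>Re u\<bar>)"
      using mult_left_mono[OF norm_sinh_le[of u], of "4 * pi * k"] k by (simp add: norm_mult)
  qed
  also have "cmod u = 8 * pi * k * cmod w / t" using t k by (simp add: u_def norm_mult norm_divide)
  also have "Re u = - (8 * pi * k * Im w / t)" by (simp add: u_def)
  also have "\<bar>- (8 * pi * k * Im w / t)\<bar> = 8 * pi * k * \<bar>Im w\<bar> / t" using t k by (simp add: abs_mult)
  also have "cmod E = exp (2 * ((Re w)\<^sup>2 - (Im w)\<^sup>2) / t + - 8 * pi\<^sup>2 * k\<^sup>2 / t)"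
  proof -
    have "Re (2 * w\<^sup>2 / of_real t) = 2 * ((Re w)\<^sup>2 - (Im w)\<^sup>2) / t" by (simp add: power2_eq_square)
    then show ?thesis by (simp only: E_def norm_mult norm_exp_eq_Re norm_of_real abs_exp_cancel exp_add)
  qed
  also have "exp (2 * ((Re w)\<^sup>2 - (Im w)\<^sup>2) / t + - 8 * pi\<^sup>2 * k\<^sup>2 / t) *
      (2 * cmod w * exp (8 * pi * k * \<bar>Im w\<bar> / t) + 4 * pi * k * (8 * pi * k * cmod w / t * exp (8 * pi * k * \<bar>Im w\<bar> / t)))
    = cmod w * exp (2 * ((Re w)\<^sup>2 - (Im w)\<^sup>2) / t + - 8 * pi\<^sup>2 * k\<^sup>2 / t + 8 * pi * k * \<bar>Im w\<bar> / t) * (2 + 32 * pi\<^sup>2 * k\<^sup>2 / t)"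
    unfolding exp_add by (simp add: power2_eq_square algebra_simps)
  also have "2 * ((Re w)\<^sup>2 - (Im w)\<^sup>2) / t + - 8 * pi\<^sup>2 * k\<^sup>2 / t + 8 * pi * k * \<bar>Im w\<bar> / t
     = (2 * ((Re w)\<^sup>2 - (Im w)\<^sup>2) - 8 * pi\<^sup>2 * k\<^sup>2 + 8 * pi * k * \<bar>Im w\<bar>) / t"
    by (simp add: diff_divide_distrib add_divide_distrib)
  finally show ?thesis .
qed

text \<open>For y = pi^2 k^2 / (8t) the polynomial factor of the pair bound is 2 + 256 y. Half of
  the decay exp (-2y) pays for it; 258 is 2 + 256.\<close>

lemma linear_times_exp_bound:
  fixes y :: real assumes "y \<ge> 0"
  shows "(2 + 256 * y) * exp (- (2 * y)) \<le> 258 * exp (- y)"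
proof -
  have "2 + 256 * y \<le> 258 * exp y" using exp_ge_add_one_self[of y] assms by linarith
  then have "(2 + 256 * y) * exp (- (2 * y)) \<le> 258 * exp y * exp (- (2 * y))" by (intro mult_right_mono) auto
  also have "\<dots> = 258 * exp (- y)" by (simp flip: exp_add)
  finally show ?thesis .
qed

text \<open>258 times the geometric series of exp (-c n / t) over n >= 1.\<close>

definition tail :: "real \<Rightarrow> real \<Rightarrow> real" where
  "tail c t = 258 * (exp (- c / t) / (1 - exp (- c / t)))"

lemma tail_sums:
  assumes "c > 0" "t > 0"
  shows "(\<lambda>n. 258 * exp (- (c / t) * real (Suc n))) sums tail c t"
proof -
  have "exp (- c / t) < 1" using assms by simp
  then have "(\<lambda>n. 258 * (exp (- c / t) * exp (- c / t) ^ n)) sums (258 * (exp (- c / t) * (1 / (1 - exp (- c / t)))))"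
    by (intro sums_mult geometric_sums) auto
  moreover have "exp (- c / t) * exp (- c / t) ^ n = exp (- (c / t) * real (Suc n))" for n
  proof -
    have "exp (- c / t) * exp (- c / t) ^ n = exp (- c / t) ^ Suc n" by simp
    also have "\<dots> = exp (real (Suc n) * (- c / t))" by (simp only: exp_of_nat_mult)
    finally show ?thesis by (simp add: mult.commute)
  qed
  ultimately show ?thesis by (simp add: tail_def)
qed

lemma wave_near_zero:
  assumes t: "t > 0" and w: "\<bar>Im w\<bar> \<le> 31 * pi / 32"
  shows "cmod (sinh w * wave t w - of_real (amp t) * (w * exp (2 * w\<^sup>2 / of_real t))) \<le>
     amp t * (cmod w * exp (2 * ((Re w)\<^sup>2 - (Im w)\<^sup>2) / t)) * tail (pi\<^sup>2 / 8) t"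
proof -
  let ?B = "cmod w * exp (2 * ((Re w)\<^sup>2 - (Im w)\<^sup>2) / t)"
  let ?d = "\<lambda>n. dual_term t (real (Suc n)) w + dual_term t (- real (Suc n)) w"
  note s = sinh_wave[OF t, of w]
  have sd: "summable ?d"
    by (intro summable_add; subst summable_Suc_iff[where f="\<lambda>n. dual_term t (real n) w"] summable_Suc_iff[where f="\<lambda>n. dual_term t (- real n) w"]; rule s)
  have amp: "amp t > 0" using t by (simp add: amp_def)
  have "(\<Sum>n. dual_term t (real n) w) + (\<Sum>n. dual_term t (- real n) w) - dual_term t 0 w
     = dual_term t 0 w + (\<Sum>n. ?d n)"
  proof -
    have "(\<Sum>n. dual_term t (real n) w) = dual_term t 0 w + (\<Sum>n. dual_term t (real (Suc n)) w)"
      "(\<Sum>n. dual_term t (- real n) w) = dual_term t 0 w + (\<Sum>n. dual_term t (- real (Suc n)) w)"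
      using suminf_split_head[OF s(1)] suminf_split_head[OF s(2)] by (simp_all del: of_nat_Suc)
    moreover have "(\<Sum>n. ?d n) = (\<Sum>n. dual_term t (real (Suc n)) w) + (\<Sum>n. dual_term t (- real (Suc n)) w)"
      by (rule suminf_add[symmetric]; subst summable_Suc_iff[where f="\<lambda>n. dual_term t (real n) w"] summable_Suc_iff[where f="\<lambda>n. dual_term t (- real n) w"]; rule s)
    ultimately show ?thesis by simp
  qed
  then have "sinh w * wave t w - of_real (amp t) * (w * exp (2 * w\<^sup>2 / of_real t)) = of_real (amp t) * (\<Sum>n. ?d n)"
    unfolding s(3) by (simp add: dual_term_def algebra_simps)
  moreover have "cmod (\<Sum>n. ?d n) \<le> ?B * tail (pi\<^sup>2 / 8) t"
  proof -
    have bound: "cmod (?d n) \<le> ?B * (258 * exp (- (pi\<^sup>2 / 8 / t) * real (Suc n)))" for n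
    proof -
      define k where "k = real (Suc n)"
      have k: "k \<ge> 1" by (simp add: k_def)
      define y where "y = pi\<^sup>2 * k\<^sup>2 / (8 * t)"
      have y: "y \<ge> 0" using t by (simp add: y_def)
      have kk: "k \<le> k\<^sup>2" using k by (simp add: power2_eq_square)
      \<comment> \<open>The origin of 31/32: the cross term consumes 31/4 of the available 8 pi^2
        k^2, and the remaining pi^2 k^2 / 4 is 2 y t.\<close>
      have "8 * pi * k * \<bar>Im w\<bar> \<le> 8 * pi * k * (31 * pi / 32)" using w k by (intro mult_left_mono) auto
      also have "\<dots> = 31 / 4 * pi\<^sup>2 * k" by (simp add: power2_eq_square)
      also have "\<dots> \<le> 31 / 4 * pi\<^sup>2 * k\<^sup>2" using kk by (intro mult_left_mono) auto
      finally have "(2 * ((Re w)\<^sup>2 - (Im w)\<^sup>2) - 8 * pi\<^sup>2 * k\<^sup>2 + 8 * pi * k * \<bar>Im w\<bar>) / t \<le> (2 * ((Re w)\<^sup>2 - (Im w)\<^sup>2) - pi\<^sup>2 * k\<^sup>2 / 4) / t"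
        using t by (intro divide_right_mono) auto
      also have "\<dots> = 2 * ((Re w)\<^sup>2 - (Im w)\<^sup>2) / t + - (2 * y)" using t by (simp add: y_def field_simps)
      finally have e: "exp ((2 * ((Re w)\<^sup>2 - (Im w)\<^sup>2) - 8 * pi\<^sup>2 * k\<^sup>2 + 8 * pi * k * \<bar>Im w\<bar>) / t)
          \<le> exp (2 * ((Re w)\<^sup>2 - (Im w)\<^sup>2) / t) * exp (- (2 * y))" by (simp flip: exp_add)
      have "cmod (?d n) \<le> cmod w * exp ((2 * ((Re w)\<^sup>2 - (Im w)\<^sup>2) - 8 * pi\<^sup>2 * k\<^sup>2 + 8 * pi * k * \<bar>Im w\<bar>) / t) * (2 + 32 * pi\<^sup>2 * k\<^sup>2 / t)"
        unfolding k_def[symmetric] by (rule dual_term_pair_bound[OF t]) (use k in simp)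
      also have "32 * pi\<^sup>2 * k\<^sup>2 / t = 256 * y" by (simp add: y_def)
      also have "cmod w * exp ((2 * ((Re w)\<^sup>2 - (Im w)\<^sup>2) - 8 * pi\<^sup>2 * k\<^sup>2 + 8 * pi * k * \<bar>Im w\<bar>) / t) * (2 + 256 * y)
         \<le> cmod w * (exp (2 * ((Re w)\<^sup>2 - (Im w)\<^sup>2) / t) * exp (- (2 * y))) * (2 + 256 * y)"
        using y by (intro mult_right_mono mult_left_mono e) auto
      also have "\<dots> = ?B * ((2 + 256 * y) * exp (- (2 * y)))" by (simp add: mult_ac)
      also have "\<dots> \<le> ?B * (258 * exp (- y))" by (intro mult_left_mono linear_times_exp_bound y) auto
      also have "\<dots> \<le> ?B * (258 * exp (- (pi\<^sup>2 / 8 / t) * k))"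
      proof -
        have "pi\<^sup>2 / 8 / t * k \<le> y" using mult_left_mono[OF kk, of "pi\<^sup>2 / 8 / t"] t by (simp add: y_def mult_ac)
        then show ?thesis by (intro mult_left_mono) auto
      qed
      finally show ?thesis by (simp only: k_def)
    qed
    have ts: "(\<lambda>n. ?B * (258 * exp (- (pi\<^sup>2 / 8 / t) * real (Suc n)))) sums (?B * tail (pi\<^sup>2 / 8) t)"
      by (intro sums_mult tail_sums t) simp
    have "cmod (\<Sum>n. ?d n) \<le> (\<Sum>n. ?B * (258 * exp (- (pi\<^sup>2 / 8 / t) * real (Suc n))))"
      by (rule norm_suminf_le[OF bound sums_summable[OF ts]])
    then show ?thesis using sums_unique[OF ts] by simp
  qed
  ultimately show ?thesis using amp mult_left_mono[of "cmod (\<Sum>n. ?d n)" "?B * tail (pi\<^sup>2 / 8) t" "amp t"]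
    by (simp add: norm_mult mult.assoc)
qed

text \<open>In v = w - i pi the indices n and -1-n become opposite half-integers. For k = 1/2 the
  pair already has the exponent on the right with no decay to spare, so the factor exp (pi^2 / (4t))
  is added to pay for the polynomial factor.\<close>

lemma wave_near_pi:
  assumes t: "t > 0" and v: "\<bar>Im v\<bar> \<le> pi / 32"
  shows "cmod (sinh v * wave t (v + \<i> * of_real pi)) \<le>
     amp t * (cmod v * exp (2 * ((Re v)\<^sup>2 - (pi - \<bar>Im v\<bar>)\<^sup>2) / t)) * (exp (pi\<^sup>2 / (4 * t)) * tail (pi\<^sup>2 / 32) t)"
proof -
  let ?w = "v + \<i> * of_real pi"
  let ?B = "cmod v * (exp (2 * ((Re v)\<^sup>2 - (pi - \<bar>Im v\<bar>)\<^sup>2) / t) * exp (pi\<^sup>2 / (4 * t)))"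
  let ?d = "\<lambda>n. dual_term t (real n + 1 / 2) v + dual_term t (- (real n + 1 / 2)) v"
  note s = sinh_wave[OF t, of ?w]
  have amp: "amp t > 0" using t by (simp add: amp_def)
  have d1: "dual_term t (real n) ?w = dual_term t (real n + 1 / 2) v"
    and d2: "dual_term t (- real (Suc n)) ?w = dual_term t (- (real n + 1 / 2)) v" for n
    by (simp_all add: dual_term_def algebra_simps)
  have "(\<Sum>n. dual_term t (real n) ?w) + (\<Sum>n. dual_term t (- real n) ?w) - dual_term t 0 ?w = (\<Sum>n. ?d n)"
  proof -
    have "(\<Sum>n. dual_term t (- real n) ?w) = dual_term t 0 ?w + (\<Sum>n. dual_term t (- real (Suc n)) ?w)"
      using suminf_split_head[OF s(2)] by (simp_all del: of_nat_Suc)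
    moreover have "(\<Sum>n. dual_term t (real n) ?w + dual_term t (- real (Suc n)) ?w) =
        (\<Sum>n. dual_term t (real n) ?w) + (\<Sum>n. dual_term t (- real (Suc n)) ?w)"
      by (rule suminf_add[symmetric], rule s, subst summable_Suc_iff[where f="\<lambda>n. dual_term t (- real n) ?w"], rule s)
    ultimately show ?thesis unfolding d1 d2 by simp
  qed
  moreover have "sinh ?w = - sinh v" by (simp add: sinh_add sinh_conv_sin[of "\<i> * of_real pi"] cosh_conv_cos[of "\<i> * of_real pi"])
  ultimately have "- (sinh v * wave t ?w) = of_real (amp t) * (\<Sum>n. ?d n)"
    using s(3) by simp
  then have "cmod (- (sinh v * wave t ?w)) = cmod (of_real (amp t) * (\<Sum>n. ?d n))" by simp
  then have "cmod (sinh v * wave t ?w) = amp t * cmod (\<Sum>n. ?d n)"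
    using amp by (simp only: norm_minus_cancel norm_mult[of "of_real (amp t)"] norm_of_real abs_of_pos)
  moreover have "cmod (\<Sum>n. ?d n) \<le> ?B * tail (pi\<^sup>2 / 32) t"
  proof -
    have bound: "cmod (?d n) \<le> ?B * (258 * exp (- (pi\<^sup>2 / 32 / t) * real (Suc n)))" for n
    proof -
      define k where "k = real n + 1 / 2"
      define b where "b = \<bar>Im v\<bar>"
      have k: "k \<ge> 1 / 2" by (simp add: k_def)
      define y where "y = pi\<^sup>2 * k\<^sup>2 / (8 * t)"
      have y: "y \<ge> 0" using t by (simp add: y_def)
      have kk: "k / 2 \<le> k\<^sup>2" using mult_right_mono[of "1 / 2" k k] k by (simp add: power2_eq_square)
      \<comment> \<open>The comparison of exponents reduces to 4 pi b (2k - 1) <= pi^2 (31 k^2 / 4 -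
        7/4). At k = 1/2 the left side is 0 and the right side 3 pi^2 / 16.\<close>
      have "4 * pi * b * (2 * k - 1) \<le> 4 * pi * (pi / 32) * (2 * k - 1)"
        using v k by (intro mult_right_mono mult_left_mono) (auto simp: b_def)
      also have "\<dots> = pi\<^sup>2 * ((2 * k - 1) / 8)" by (simp add: power2_eq_square)
      also have "\<dots> \<le> pi\<^sup>2 * (31 / 4 * k\<^sup>2 - 7 / 4)"
        using kk k by (intro mult_left_mono) auto
      finally have "- 2 * b\<^sup>2 - 8 * pi\<^sup>2 * k\<^sup>2 + 8 * pi * k * b \<le> - 2 * (pi - b)\<^sup>2 + pi\<^sup>2 / 4 - pi\<^sup>2 * k\<^sup>2 / 4"
        by (simp add: power2_eq_square algebra_simps)
      then have "2 * ((Re v)\<^sup>2 - (Im v)\<^sup>2) - 8 * pi\<^sup>2 * k\<^sup>2 + 8 * pi * k * b \<le> 2 * ((Re v)\<^sup>2 - (pi - b)\<^sup>2) + pi\<^sup>2 / 4 - pi\<^sup>2 * k\<^sup>2 / 4"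
        by (simp add: b_def)
      then have "(2 * ((Re v)\<^sup>2 - (Im v)\<^sup>2) - 8 * pi\<^sup>2 * k\<^sup>2 + 8 * pi * k * b) / t \<le> (2 * ((Re v)\<^sup>2 - (pi - b)\<^sup>2) + pi\<^sup>2 / 4 - pi\<^sup>2 * k\<^sup>2 / 4) / t"
        using t by (intro divide_right_mono) auto
      also have "\<dots> = 2 * ((Re v)\<^sup>2 - (pi - b)\<^sup>2) / t + pi\<^sup>2 / (4 * t) + - (2 * y)"
        using t by (simp add: y_def add_divide_distrib diff_divide_distrib)
      finally have e: "exp ((2 * ((Re v)\<^sup>2 - (Im v)\<^sup>2) - 8 * pi\<^sup>2 * k\<^sup>2 + 8 * pi * k * b) / t)
          \<le> exp (2 * ((Re v)\<^sup>2 - (pi - b)\<^sup>2) / t) * exp (pi\<^sup>2 / (4 * t)) * exp (- (2 * y))" by (simp flip: exp_add)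
      have "cmod (?d n) \<le> cmod v * exp ((2 * ((Re v)\<^sup>2 - (Im v)\<^sup>2) - 8 * pi\<^sup>2 * k\<^sup>2 + 8 * pi * k * b) / t) * (2 + 32 * pi\<^sup>2 * k\<^sup>2 / t)"
        unfolding k_def[symmetric] b_def by (rule dual_term_pair_bound[OF t]) (use k in simp)
      also have "32 * pi\<^sup>2 * k\<^sup>2 / t = 256 * y" by (simp add: y_def)
      also have "cmod v * exp ((2 * ((Re v)\<^sup>2 - (Im v)\<^sup>2) - 8 * pi\<^sup>2 * k\<^sup>2 + 8 * pi * k * b) / t) * (2 + 256 * y)
         \<le> cmod v * (exp (2 * ((Re v)\<^sup>2 - (pi - b)\<^sup>2) / t) * exp (pi\<^sup>2 / (4 * t)) * exp (- (2 * y))) * (2 + 256 * y)"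
        using y by (intro mult_right_mono mult_left_mono e) auto
      also have "\<dots> = ?B * ((2 + 256 * y) * exp (- (2 * y)))" by (simp add: mult_ac b_def)
      also have "\<dots> \<le> ?B * (258 * exp (- y))" by (intro mult_left_mono linear_times_exp_bound y) auto
      also have "\<dots> \<le> ?B * (258 * exp (- (pi\<^sup>2 / 32 / t) * real (Suc n)))"
      proof -
        \<comment> \<open>Half-integers only give k^2 >= (n + 1) / 4, whence pi^2 / 32 in place of
          pi^2 / 8.\<close>
        have "real (Suc n) / 4 \<le> k\<^sup>2" by (simp add: k_def power2_eq_square algebra_simps)
        from mult_left_mono[OF this, of "pi\<^sup>2 / 8 / t"] have "pi\<^sup>2 / 32 / t * real (Suc n) \<le> y"
          using t by (simp add: y_def mult_ac)
        then show ?thesis by (intro mult_left_mono) auto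
      qed
      finally show ?thesis .
    qed
    have ts: "(\<lambda>n. ?B * (258 * exp (- (pi\<^sup>2 / 32 / t) * real (Suc n)))) sums (?B * tail (pi\<^sup>2 / 32) t)"
      by (intro sums_mult tail_sums t) simp
    have "cmod (\<Sum>n. ?d n) \<le> (\<Sum>n. ?B * (258 * exp (- (pi\<^sup>2 / 32 / t) * real (Suc n))))"
      by (rule norm_suminf_le[OF bound sums_summable[OF ts]])
    then show ?thesis using sums_unique[OF ts] by simp
  qed
  ultimately show ?thesis using amp mult_left_mono[of "cmod (\<Sum>n. ?d n)" "?B * tail (pi\<^sup>2 / 32) t" "amp t"]
    by (simp add: mult_ac)
qed


section \<open>The inverse hyperbolic cosine and the density bounds\<close>

lemma norm_sinh_squared: "(cmod (sinh u))\<^sup>2 = (sinh (Re u))\<^sup>2 + (sin (Im u))\<^sup>2"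
proof -
  have "sinh u = - \<i> * sin (\<i> * u)" by (simp add: sinh_conv_sin)
  then have "cmod (sinh u) = cmod (sin (\<i> * u))" by (simp add: norm_mult)
  then have "(cmod (sinh u))\<^sup>2 = (exp (2 * Re u) + inverse (exp (2 * Re u)) - 2 * cos (2 * Im u)) / 4"
    using norm_sin_squared[of "\<i> * u"] by simp
  also have "cos (2 * Im u) = 1 - 2 * (sin (Im u))\<^sup>2" by (rule cos_double_sin)
  also have "(exp (2 * Re u) + inverse (exp (2 * Re u)) - 2 * (1 - 2 * (sin (Im u))\<^sup>2)) / 4 = (sinh (Re u))\<^sup>2 + (sin (Im u))\<^sup>2"
  proof -
    have "exp (2 * Re u) = exp (Re u) * exp (Re u)" by (simp flip: exp_add)
    then show ?thesis by (simp add: sinh_field_def power2_eq_square exp_minus field_simps)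
  qed
  finally show ?thesis .
qed

text \<open>The constant 1/3 is weaker than possible, so as to agree with the one for
  \<open>sin\<close> in \<open>cosh_minus_one_bound\<close>.\<close>

lemma sinh_squared_ge: "(a / 3)\<^sup>2 \<le> (sinh a)\<^sup>2" for a :: real
proof -
  have pos: "a / 3 \<le> sinh a" if "a \<ge> 0" for a :: real
  proof -
    have "1 + a \<le> exp a" by (rule exp_ge_add_one_self)
    moreover have "exp (- a) \<le> 1" using that by simp
    ultimately have le: "a \<le> exp a - exp (- a)" by linarith
    have "a / 3 \<le> a / 2" using that by simp
    also have "\<dots> \<le> (exp a - exp (- a)) / 2" using le by (rule divide_right_mono) simp
    also have "\<dots> = sinh a" by (rule sinh_field_def[symmetric])
    finally show ?thesis .
  qed
  show ?thesis
  proof (cases "a \<ge> 0")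
    case True
    then show ?thesis using pos[of a] by (intro power_mono) auto
  next
    case False
    then have "(- a / 3)\<^sup>2 \<le> (sinh (- a))\<^sup>2" using pos[of "- a"] by (intro power_mono) auto
    then show ?thesis by simp
  qed
qed

lemma sin_squared_ge: "(b / 3)\<^sup>2 \<le> (sin b)\<^sup>2" if "\<bar>b\<bar> \<le> pi / 2" for b :: real
proof -
  have pos: "b / 3 \<le> sin b" if b: "b \<ge> 0" "b \<le> pi / 2" for b :: real
  proof -
    have "\<bar>sin b - b\<bar> \<le> \<bar>b\<bar> ^ 3 / 6"
      using Maclaurin_sin_bound[of b 3] by (simp add: eval_nat_numeral sin_coeff_def)
    \<comment> \<open>b <= 2 gives b^3 / 6 <= 2b / 3, so the cubic remainder leaves b / 3.\<close>
    moreover have "b ^ 3 \<le> 4 * b"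
    proof -
      have "b \<le> 2" using b pi_less_4 by simp
      then have "b * b \<le> 2 * 2" using b by (intro mult_mono) auto
      then have "b * b * b \<le> 4 * b" using b by (intro mult_right_mono) auto
      then show ?thesis by (simp add: power3_eq_cube)
    qed
    ultimately show ?thesis using b unfolding abs_of_nonneg[OF b(1)] by linarith
  qed
  show ?thesis
  proof (cases "b \<ge> 0")
    case True
    then show ?thesis using pos[of b] that by (intro power_mono) auto
  next
    case False
    then have "(- b / 3)\<^sup>2 \<le> (sin (- b))\<^sup>2" using pos[of "- b"] that by (intro power_mono) auto
    then show ?thesis by simp
  qed
qed

text \<open>cosh w - 1 = 2 sinh^2 (w/2), and halving puts the imaginary part into [-pi/2, pi/2],
  where \<open>sin\<close> is bounded below. This quantifies that w tends to 0 as cosh w tends to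
  1.\<close>

lemma cosh_minus_one_bound:
  assumes "\<bar>Im w\<bar> \<le> pi"
  shows "(cmod w)\<^sup>2 \<le> 18 * cmod (cosh w - 1)"
proof -
  define u where "u = w / 2"
  have "cosh (2 * u) - 1 = 2 * (sinh u)\<^sup>2" by (simp add: cosh_double cosh_square_eq)
  then have "cosh w - 1 = 2 * (sinh u)\<^sup>2" by (simp add: u_def)
  then have "cmod (cosh w - 1) = 2 * (cmod (sinh u))\<^sup>2" by (simp add: norm_mult norm_power)
  moreover have "(Re u / 3)\<^sup>2 + (Im u / 3)\<^sup>2 \<le> (cmod (sinh u))\<^sup>2"
    unfolding norm_sinh_squared using assms by (intro add_mono sinh_squared_ge sin_squared_ge) (simp add: u_def)
  moreover have "(cmod w)\<^sup>2 = 36 * ((Re u / 3)\<^sup>2 + (Im u / 3)\<^sup>2)"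
    by (simp add: cmod_power2 u_def power_divide)
  ultimately show ?thesis by simp
qed

lemma cosh_eq_one: "cosh w = 1 \<Longrightarrow> \<bar>Im w\<bar> \<le> pi \<Longrightarrow> w = 0"
  using cosh_minus_one_bound[of w] by simp

lemma cosh_add_ipi: "cosh (w + \<i> * of_real pi) = - cosh w" "cosh (w - \<i> * of_real pi) = - cosh w"
  and sinh_add_ipi: "sinh (w - \<i> * of_real pi) = - sinh w"
proof -
  have "cosh (\<i> * of_real pi) = -1" "sinh (\<i> * of_real pi) = 0"
    by (simp_all add: cosh_conv_cos sinh_conv_sin)
  then show "cosh (w + \<i> * of_real pi) = - cosh w" "cosh (w - \<i> * of_real pi) = - cosh w" "sinh (w - \<i> * of_real pi) = - sinh w"
    by (simp_all add: cosh_add cosh_diff sinh_diff)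
qed

lemma sinh_eq_0_strip:
  assumes "sinh w = 0" "\<bar>Im w\<bar> < pi"
  shows "w = 0"
proof -
  have "(cosh w)\<^sup>2 = 1" using assms(1) by (simp add: cosh_square_eq)
  then consider "cosh w = 1" | "cosh w = -1" by (auto simp: power2_eq_1_iff)
  then show ?thesis
  proof cases
    case 1
    then show ?thesis using assms(2) by (intro cosh_eq_one) auto
  next
    case 2
    show ?thesis
    proof (cases "Im w \<ge> 0")
      case True
      have "w - \<i> * of_real pi = 0" using 2 True assms(2) by (intro cosh_eq_one) (auto simp: cosh_add_ipi)
      then show ?thesis using assms(2) by simp
    next
      case False
      have "w + \<i> * of_real pi = 0" using 2 False assms(2) by (intro cosh_eq_one) (auto simp: cosh_add_ipi)
      then have "Im (w + \<i> * of_real pi) = 0" by simp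
      then show ?thesis using assms(2) by simp
    qed
  qed
qed

text \<open>The predicate under the definite description in \<open>Arcosh\<close>.\<close>

definition is_arcosh :: "complex \<Rightarrow> complex \<Rightarrow> bool" where
  "is_arcosh x w \<longleftrightarrow> cosh w = x \<and> 0 \<le> Im w \<and> Im w \<le> pi \<and> (x \<in> \<real> \<and> cmod x > 1 \<longrightarrow> Re w > 0)"

lemma cosh_of_real: "cosh (complex_of_real r) = of_real (cosh r)"
  by (simp add: cosh_def scaleR_conv_of_real flip: exp_of_real)

lemma sinh_of_real: "sinh (complex_of_real r) = of_real (sinh r)"
  by (simp add: sinh_def scaleR_conv_of_real flip: exp_of_real)

text \<open>One of the two values i Arccos x and -i Arccos x always lies in the strip. For real x
  with |x| > 1 the sign of the real part matters, so the real \<open>arcosh\<close> is used, shifted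
  by i pi for negative x.\<close>

lemma is_arcosh_exists: "\<exists>w. is_arcosh x w"
proof (cases "x \<in> \<real> \<and> cmod x > 1")
  case False
  have c: "cosh (\<i> * Arccos x) = x" "cosh (- (\<i> * Arccos x)) = x" by (simp_all add: cosh_conv_cos)
  have "\<bar>Re (Arccos x)\<bar> \<le> pi" using Re_Arccos_bounds[of x] by auto
  then have "is_arcosh x (\<i> * Arccos x) \<or> is_arcosh x (- (\<i> * Arccos x))"
    using False c unfolding is_arcosh_def by (cases "Re (Arccos x) \<ge> 0") auto
  then show ?thesis by blast
next
  case True
  then obtain r where r: "x = of_real r" "\<bar>r\<bar> > 1" by (auto elim!: Reals_cases)
  have ar: "arcosh \<bar>r\<bar> > 0" "cosh (arcosh \<bar>r\<bar>) = \<bar>r\<bar>"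
    using r(2) arcosh_real_gt_1_iff[of "\<bar>r\<bar>"] cosh_arcosh_real[of "\<bar>r\<bar>"] by auto
  show ?thesis
  proof (cases "r > 0")
    case True
    then show ?thesis using ar r
      by (intro exI[of _ "of_real (arcosh \<bar>r\<bar>)"]) (auto simp: is_arcosh_def cosh_of_real)
  next
    case False
    then show ?thesis using ar r
      by (intro exI[of _ "of_real (arcosh \<bar>r\<bar>) + \<i> * of_real pi"]) (auto simp: is_arcosh_def cosh_of_real cosh_add_ipi)
  qed
qed

text \<open>The strip leaves w = v or a reflection with Im w = Im v equal to 0 or pi. In the latter
  case x is real with |x| = cosh (Re w), and the sign convention decides unless Re w = 0.\<close>

lemma is_arcosh_unique:
  assumes "is_arcosh x w" "is_arcosh x v"
  shows "w = v"
proof -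
  have w: "cosh w = x" "0 \<le> Im w" "Im w \<le> pi" and v: "cosh v = x" "0 \<le> Im v" "Im v \<le> pi"
    using assms by (auto simp: is_arcosh_def)
  have "cos (\<i> * w) = cos (\<i> * v)" using w v by (simp add: cosh_conv_cos)
  then obtain n where n: "n \<in> \<int>" and c: "\<i> * w = \<i> * v + of_real (2 * n * pi) \<or> \<i> * w = - (\<i> * v) + of_real (2 * n * pi)"
    unfolding complex_cos_eq by blast
  obtain k :: int where k: "n = of_int k" using n by (auto elim: Ints_cases)
  from c show ?thesis
  proof
    assume e: "\<i> * w = \<i> * v + of_real (2 * n * pi)"
    then have "Re w = Re v" "Im v - Im w = 2 * n * pi" by (auto simp: complex_eq_iff)
    then have "2 * n * pi \<le> 1 * pi" "- 1 * pi \<le> 2 * n * pi" using w v by linarith+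
    then have "2 * n \<le> 1" "- 1 \<le> 2 * n" by (simp_all only: mult_le_cancel_right) auto
    then have "n = 0" unfolding k by simp
    then show ?thesis using e by simp
  next
    assume e: "\<i> * w = - (\<i> * v) + of_real (2 * n * pi)"
    then have r: "Re w = - Re v" and i: "Im w + Im v = - (2 * n * pi)" by (auto simp: complex_eq_iff)
    have "2 * n * pi \<le> 0 * pi" "- 2 * pi \<le> 2 * n * pi" using i w v by linarith+
    then have "2 * n \<le> 0" "- 2 \<le> 2 * n" by (simp_all only: mult_le_cancel_right) auto
    then have "k \<le> 0" "- 1 \<le> k" unfolding k by simp_all
    then have "k = 0 \<or> k = - 1" by linarith
    then have "n = 0 \<or> n = - 1" unfolding k by auto
    then have im: "Im w = Im v \<and> (Im w = 0 \<or> Im w = pi)" using i w v by auto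
    show ?thesis
    proof (cases "Re w = 0")
      case True
      then show ?thesis using r im by (simp add: complex_eq_iff)
    next
      case False
      have "w = of_real (Re w) \<or> w = of_real (Re w) + \<i> * of_real pi" using im by (auto simp: complex_eq_iff)
      then have x: "x = of_real (cosh (Re w)) \<or> x = - of_real (cosh (Re w))"
        using w(1) cosh_of_real[of "Re w"] cosh_add_ipi(1)[of "of_real (Re w)"] by metis
      have "1\<^sup>2 < (cosh (Re w))\<^sup>2" using False by (simp add: cosh_square_eq)
      then have "cosh (Re w) > 1" by (rule power2_less_imp_less) simp
      then have "x \<in> \<real> \<and> cmod x > 1" using x by auto
      then have "Re w > 0" "Re v > 0" using assms by (auto simp: is_arcosh_def)
      then show ?thesis using r by simp
    qed
  qed
qed

lemma Arcosh: "cosh (Arcosh x) = x" "0 \<le> Im (Arcosh x)" "Im (Arcosh x) \<le> pi"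
proof -
  have "is_arcosh x (THE w. is_arcosh x w)"
    by (rule theI') (use is_arcosh_exists is_arcosh_unique in blast)
  then have "is_arcosh x (Arcosh x)" unfolding Arcosh_def is_arcosh_def .
  then show "cosh (Arcosh x) = x" "0 \<le> Im (Arcosh x)" "Im (Arcosh x) \<le> pi" by (auto simp: is_arcosh_def)
qed

lemma tendsto_ratio_sinh: "((\<lambda>w::complex. w / sinh w) \<longlongrightarrow> 1) (at 0)"
proof -
  have "(sinh has_field_derivative 1) (at (0::complex))" by (auto intro!: derivative_eq_intros)
  then have "((\<lambda>w::complex. sinh w / w) \<longlongrightarrow> 1) (at 0)"
    by (simp add: has_field_derivative_iff)
  from tendsto_inverse[OF this] show ?thesis by (simp add: divide_inverse mult.commute)
qed

text \<open>The continuous extension of |w / sinh w|^2 to w = 0.\<close>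

definition ratio_sq :: "complex \<Rightarrow> real" where
  "ratio_sq w = (if w = 0 then 1 else (cmod w)\<^sup>2 / (cmod (sinh w))\<^sup>2)"

lemma tendsto_ratio_sq:
  assumes V: "(V \<longlongrightarrow> 0) (at z0)" and ev: "\<forall>\<^sub>F z in at z0. V z \<noteq> 0 \<and> (sinh (V z))\<^sup>2 = z\<^sup>2 - 1"
  shows "((\<lambda>z. (cmod (V z))\<^sup>2 / cmod (z\<^sup>2 - 1)) \<longlongrightarrow> 1) (at (z0::complex))"
proof -
  have "filterlim V (at 0) (at z0)"
    using V ev by (auto simp: filterlim_at elim: eventually_mono)
  then have "((\<lambda>z. V z / sinh (V z)) \<longlongrightarrow> 1) (at z0)" by (rule filterlim_compose[OF tendsto_ratio_sinh])
  then have "((\<lambda>z. (cmod (V z / sinh (V z)))\<^sup>2) \<longlongrightarrow> (cmod 1)\<^sup>2) (at z0)" by (intro tendsto_intros)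
  moreover have "\<forall>\<^sub>F z in at z0. (cmod (V z / sinh (V z)))\<^sup>2 = (cmod (V z))\<^sup>2 / cmod (z\<^sup>2 - 1)"
    using ev
  proof eventually_elim
    case (elim z)
    then have "cmod (z\<^sup>2 - 1) = (cmod (sinh (V z)))\<^sup>2" by (metis norm_power)
    then show ?case by (simp add: norm_divide power_divide)
  qed
  ultimately show ?thesis by (simp add: tendsto_cong)
qed

text \<open>Used with V = \<open>Arcosh\<close> at c = 1 and V = \<open>Arcosh\<close> - i pi at c =
  -1. V jumps across the real axis arbitrarily near c, but |V|^2 <= 18 |c z - 1| still forces the
  limit 0.\<close>

lemma arcosh_tendsto:
  assumes "\<And>z. cosh (V z) = c * z" "\<And>z. \<bar>Im (V z)\<bar> \<le> pi" "c = 1 \<or> c = -1"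
  shows "((\<lambda>z. (cmod (V z))\<^sup>2 / cmod (z\<^sup>2 - 1)) \<longlongrightarrow> 1) (at c)"
proof (rule tendsto_ratio_sq)
  have "((\<lambda>z. 18 * cmod (c * z - 1)) \<longlongrightarrow> 18 * cmod (c * c - 1)) (at c)" by (intro tendsto_intros)
  moreover have "18 * cmod (c * c - 1) = 0" using assms(3) by auto
  ultimately have "((\<lambda>z. 18 * cmod (c * z - 1)) \<longlongrightarrow> 0) (at c)" by (simp only:)
  then have "((\<lambda>z. (cmod (V z))\<^sup>2) \<longlongrightarrow> 0) (at c)"
    by (rule Lim_null_comparison[rotated]) (use cosh_minus_one_bound[OF assms(2)] assms(1) in auto)
  then have "((\<lambda>z. sqrt ((cmod (V z))\<^sup>2)) \<longlongrightarrow> sqrt 0) (at c)" by (rule tendsto_real_sqrt)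
  then show "(V \<longlongrightarrow> 0) (at c)" by (simp add: tendsto_norm_zero_iff)
  have "V z \<noteq> 0" if "z \<noteq> c" for z
  proof
    assume "V z = 0"
    then have "c * (c * z) = c" using assms(1)[of z] by simp
    moreover have "c * c = 1" using assms(3) by auto
    ultimately show False using that by (simp flip: mult.assoc)
  qed
  moreover have "(sinh (V z))\<^sup>2 = z\<^sup>2 - 1" for z
    using assms(1)[of z] assms(3) by (auto simp: sinh_square_eq)
  ultimately show "\<forall>\<^sub>F z in at c. V z \<noteq> 0 \<and> (sinh (V z))\<^sup>2 = z\<^sup>2 - 1"
    by (auto simp: eventually_at_filter)
qed

lemma Arcosh_norm_sinh: "cmod (x\<^sup>2 - 1) = (cmod (sinh (Arcosh x)))\<^sup>2"
proof -
  have "(sinh (Arcosh x))\<^sup>2 = x\<^sup>2 - 1" by (simp add: sinh_square_eq Arcosh)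
  then show ?thesis by (metis norm_power)
qed

text \<open>The premise keeps x away from -1, where the quotient has a genuine pole; at 1 the
  singularity is removable. The companion lemma exchanges the two points.\<close>

lemma extend_Arcosh:
  assumes "Im (Arcosh x) < pi"
  shows "extend_pm1 (\<lambda>z. (cmod (Arcosh z))\<^sup>2 / cmod (z\<^sup>2 - 1)) x = ratio_sq (Arcosh x)"
proof (cases "Arcosh x = 0")
  case True
  then have x: "x = 1" using Arcosh(1)[of x] by simp
  have "((\<lambda>z. (cmod (Arcosh z))\<^sup>2 / cmod (z\<^sup>2 - 1)) \<longlongrightarrow> 1) (at 1)"
  proof (rule arcosh_tendsto)
    show "\<bar>Im (Arcosh z)\<bar> \<le> pi" for z using Arcosh[of z] by simp
  qed (simp_all add: Arcosh)
  then have "Lim (at 1) (\<lambda>z. (cmod (Arcosh z))\<^sup>2 / cmod (z\<^sup>2 - 1)) = 1" by (intro tendsto_Lim) auto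
  then show ?thesis using x True by (simp add: extend_pm1_def ratio_sq_def)
next
  case False
  have "x \<noteq> 1" using False cosh_eq_one[of "Arcosh x"] Arcosh[of x] by auto
  moreover have "x \<noteq> - 1"
  proof
    assume "x = - 1"
    then have "sinh (Arcosh x) = 0" using Arcosh_norm_sinh[of x] by simp
    then show False using sinh_eq_0_strip[of "Arcosh x"] assms False Arcosh[of x] by auto
  qed
  ultimately show ?thesis using False by (simp add: extend_pm1_def ratio_sq_def Arcosh_norm_sinh)
qed

lemma extend_Arcosh_pi:
  assumes "Im (Arcosh x) > 0"
  shows "extend_pm1 (\<lambda>z. (cmod (Arcosh z - \<i> * of_real pi))\<^sup>2 / cmod (z\<^sup>2 - 1)) x = ratio_sq (Arcosh x - \<i> * of_real pi)"
proof (cases "Arcosh x - \<i> * of_real pi = 0")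
  case True
  then have "- x = 1" using Arcosh(1)[of x] cosh_add_ipi(2)[of "Arcosh x"] by simp
  then have x: "x = - 1" by (metis minus_minus)
  have "((\<lambda>z. (cmod (Arcosh z - \<i> * of_real pi))\<^sup>2 / cmod (z\<^sup>2 - 1)) \<longlongrightarrow> 1) (at (- 1))"
  proof (rule arcosh_tendsto)
    show "\<bar>Im (Arcosh z - \<i> * of_real pi)\<bar> \<le> pi" for z using Arcosh[of z] by simp
  qed (simp_all add: Arcosh cosh_add_ipi)
  then have "Lim (at (- 1)) (\<lambda>z. (cmod (Arcosh z - \<i> * of_real pi))\<^sup>2 / cmod (z\<^sup>2 - 1)) = 1" by (intro tendsto_Lim) auto
  then show ?thesis using x True by (simp add: extend_pm1_def ratio_sq_def)
next
  case False
  let ?v = "Arcosh x - \<i> * of_real pi"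
  have n: "cmod (x\<^sup>2 - 1) = (cmod (sinh ?v))\<^sup>2" by (simp add: Arcosh_norm_sinh sinh_add_ipi)
  have "x \<noteq> - 1" using False cosh_eq_one[of ?v] Arcosh[of x] by (auto simp: cosh_add_ipi)
  moreover have "x \<noteq> 1"
  proof
    assume "x = 1"
    then have "sinh ?v = 0" using n by simp
    then show False using sinh_eq_0_strip[of ?v] assms False Arcosh[of x] by auto
  qed
  ultimately show ?thesis using False by (simp add: extend_pm1_def ratio_sq_def n)
qed

text \<open>Since c < pi, the only zero of \<open>sinh\<close> in the strip is 0. There the premise
  reads 0 <= 0, so the bound is obtained as a limit from the punctured neighbourhood.\<close>

lemma ratio_sq_bound:
  assumes f: "isCont f 0" and g: "isCont g 0" and c: "0 < c" "c < pi"
    and le: "\<And>w. \<bar>Im w\<bar> \<le> c \<Longrightarrow> cmod (sinh w * f w) \<le> cmod w * g w" and w: "\<bar>Im w\<bar> \<le> c"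
  shows "(cmod (f w))\<^sup>2 \<le> ratio_sq w * (g w)\<^sup>2"
proof -
  have ne: "cmod (f w) \<le> cmod (w / sinh w) * g w" if "w \<noteq> 0" "\<bar>Im w\<bar> \<le> c" for w
  proof -
    have "sinh w \<noteq> 0" using sinh_eq_0_strip[of w] that c by auto
    then show ?thesis using le[OF that(2)] by (simp add: norm_mult norm_divide field_simps)
  qed
  show ?thesis
  proof (cases "w = 0")
    case False
    from power_mono[OF ne[OF False w] norm_ge_zero, of 2] show ?thesis
      using False by (simp add: ratio_sq_def power_mult_distrib norm_divide power_divide)
  next
    case True
    have "((\<lambda>w. cmod (f w)) \<longlongrightarrow> cmod (f 0)) (at 0)" using f by (intro tendsto_norm) (simp add: isCont_def)
    moreover have "((\<lambda>w. cmod (w / sinh w) * g w) \<longlongrightarrow> cmod 1 * g 0) (at 0)"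
      using g by (intro tendsto_mult tendsto_norm tendsto_ratio_sinh) (simp add: isCont_def)
    moreover have "\<forall>\<^sub>F w in at 0. cmod (f w) \<le> cmod (w / sinh w) * g w"
      unfolding eventually_at
    proof (intro exI[of _ c] conjI ballI impI)
      fix w :: complex assume "w \<noteq> 0 \<and> dist w 0 < c"
      then show "cmod (f w) \<le> cmod (w / sinh w) * g w"
        using abs_Im_le_cmod[of w] by (intro ne) auto
    qed (rule c)
    ultimately have "cmod (f 0) \<le> cmod 1 * g 0" by (intro tendsto_le[of "at 0"]) auto
    then show ?thesis using True power_mono[of "cmod (f 0)" "g 0" 2] by (simp add: ratio_sq_def)
  qed
qed

section \<open>Bounds for the series and decay of the error terms\<close>

lemma tail_pos: "c > 0 \<Longrightarrow> t > 0 \<Longrightarrow> tail c t > 0"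
  by (simp add: tail_def)

lemma amp_pos: "t > 0 \<Longrightarrow> amp t > 0"
  by (simp add: amp_def)

lemma wave_upper_zero:
  assumes t: "t > 0" and w: "\<bar>Im w\<bar> \<le> 31 * pi / 32"
  shows "(cmod (wave t w))\<^sup>2 \<le> (amp t)\<^sup>2 * ratio_sq w * exp (4 * ((Re w)\<^sup>2 - (Im w)\<^sup>2) / t) * (1 + tail (pi\<^sup>2 / 8) t)\<^sup>2"
proof -
  let ?g = "\<lambda>w. amp t * exp (2 * ((Re w)\<^sup>2 - (Im w)\<^sup>2) / t) * (1 + tail (pi\<^sup>2 / 8) t)"
  have "(cmod (wave t w))\<^sup>2 \<le> ratio_sq w * (?g w)\<^sup>2"
  proof (rule ratio_sq_bound[OF isCont_wave[OF t] _ _ _ _ w])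
    show "isCont ?g 0" using t by (intro continuous_intros) auto
    fix w assume w: "\<bar>Im w\<bar> \<le> 31 * pi / 32"
    let ?m = "of_real (amp t) * (w * exp (2 * w\<^sup>2 / of_real t))"
    have m: "cmod ?m = amp t * (cmod w * exp (2 * ((Re w)\<^sup>2 - (Im w)\<^sup>2) / t))"
      using amp_pos[OF t] by (simp add: norm_mult norm_exp_eq_Re power2_eq_square)
    have "cmod (sinh w * wave t w) \<le> cmod ?m + cmod (sinh w * wave t w - ?m)"
      by (rule norm_triangle_sub)
    also have "\<dots> \<le> amp t * (cmod w * exp (2 * ((Re w)\<^sup>2 - (Im w)\<^sup>2) / t)) +
        amp t * (cmod w * exp (2 * ((Re w)\<^sup>2 - (Im w)\<^sup>2) / t)) * tail (pi\<^sup>2 / 8) t"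
      using wave_near_zero[OF t w] m by simp
    also have "\<dots> = cmod w * ?g w" by (simp add: algebra_simps)
    finally show "cmod (sinh w * wave t w) \<le> cmod w * ?g w" .
  qed auto
  also have "(?g w)\<^sup>2 = (amp t)\<^sup>2 * exp (4 * ((Re w)\<^sup>2 - (Im w)\<^sup>2) / t) * (1 + tail (pi\<^sup>2 / 8) t)\<^sup>2"
    by (simp add: power_mult_distrib flip: exp_double)
  finally show ?thesis by (simp add: mult_ac)
qed

lemma wave_upper_pi:
  assumes t: "t > 0" and v: "\<bar>Im v\<bar> \<le> pi / 32"
  shows "(cmod (wave t (v + \<i> * of_real pi)))\<^sup>2 \<le> (amp t)\<^sup>2 * ratio_sq v * exp (4 * ((Re v)\<^sup>2 - (pi - \<bar>Im v\<bar>)\<^sup>2) / t) *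
    (exp (pi\<^sup>2 / (2 * t)) * (tail (pi\<^sup>2 / 32) t)\<^sup>2)"
proof -
  let ?g = "\<lambda>v. amp t * exp (2 * ((Re v)\<^sup>2 - (pi - \<bar>Im v\<bar>)\<^sup>2) / t) * (exp (pi\<^sup>2 / (4 * t)) * tail (pi\<^sup>2 / 32) t)"
  have "(cmod (wave t (v + \<i> * of_real pi)))\<^sup>2 \<le> ratio_sq v * (?g v)\<^sup>2"
  proof (rule ratio_sq_bound[OF _ _ _ _ _ v])
    show "isCont (\<lambda>v. wave t (v + \<i> * of_real pi)) 0"
      by (rule isCont_o2[OF _ isCont_wave[OF t]]) (intro continuous_intros)
    show "isCont ?g 0" using t by (intro continuous_intros) auto
    fix w assume w: "\<bar>Im w\<bar> \<le> pi / 32"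
    show "cmod (sinh w * wave t (w + \<i> * of_real pi)) \<le> cmod w * ?g w"
      using wave_near_pi[OF t w] by (simp add: mult_ac)
  qed auto
  also have "(?g v)\<^sup>2 = (amp t)\<^sup>2 * exp (4 * ((Re v)\<^sup>2 - (pi - \<bar>Im v\<bar>)\<^sup>2) / t) * (exp (pi\<^sup>2 / (2 * t)) * (tail (pi\<^sup>2 / 32) t)\<^sup>2)"
    by (simp add: power_mult_distrib flip: exp_double)
  finally show ?thesis by (simp add: mult_ac)
qed

text \<open>Reverse triangle inequality against the leading term; p = 0 is the limit from the right.
  At time 2t this bounds the squared norm from below.\<close>

lemma wave_lower_real:
  assumes t: "t > 0" and p: "p \<ge> 0"
  shows "amp t * p_over_sinh p * exp (2 * p\<^sup>2 / t) * (1 - tail (pi\<^sup>2 / 8) t) \<le> cmod (wave t (of_real p))"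
proof -
  have pos: "amp t * (p / sinh p) * exp (2 * p\<^sup>2 / t) * (1 - tail (pi\<^sup>2 / 8) t) \<le> cmod (wave t (of_real p))" if p: "p > 0" for p
  proof -
    have sp: "sinh p > 0" using p by simp
    let ?w = "complex_of_real p"
    let ?m = "of_real (amp t) * (?w * exp (2 * ?w\<^sup>2 / of_real t))"
    have m: "cmod ?m = amp t * p * exp (2 * p\<^sup>2 / t)"
      using amp_pos[OF t] p by (simp add: norm_mult norm_exp_eq_Re)
    have "cmod ?m - cmod (sinh ?w * wave t ?w) \<le> cmod (sinh ?w * wave t ?w - ?m)"
      by (metis norm_minus_commute norm_triangle_ineq2)
    also have "\<dots> \<le> amp t * p * exp (2 * p\<^sup>2 / t) * tail (pi\<^sup>2 / 8) t"
      using wave_near_zero[OF t, of ?w] p by (simp add: mult_ac)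
    finally have "amp t * p * exp (2 * p\<^sup>2 / t) * (1 - tail (pi\<^sup>2 / 8) t) \<le> sinh p * cmod (wave t ?w)"
      using sp unfolding m by (simp add: norm_mult sinh_of_real algebra_simps)
    then show ?thesis using sp by (simp add: field_simps)
  qed
  show ?thesis
  proof (cases "p = 0")
    case False
    then show ?thesis using pos[of p] p by (simp add: p_over_sinh_def)
  next
    case True
    have "((\<lambda>p. p / sinh p) \<longlongrightarrow> 1) (at_right (0::real))"
    proof -
      have "(sinh has_field_derivative 1) (at (0::real))" by (auto intro!: derivative_eq_intros)
      then have "((\<lambda>w::real. sinh w / w) \<longlongrightarrow> 1) (at 0)" by (simp add: has_field_derivative_iff)
      from tendsto_inverse[OF this] have "((\<lambda>w::real. w / sinh w) \<longlongrightarrow> 1) (at 0)" by (simp add: divide_inverse mult.commute)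
      then show ?thesis by (rule tendsto_within_subset) simp
    qed
    then have "((\<lambda>p. amp t * (p / sinh p) * exp (2 * p\<^sup>2 / t) * (1 - tail (pi\<^sup>2 / 8) t)) \<longlongrightarrow>
        amp t * 1 * exp (2 * 0\<^sup>2 / t) * (1 - tail (pi\<^sup>2 / 8) t)) (at_right 0)"
      by (intro tendsto_intros) (use t in auto)
    moreover have "((\<lambda>p. cmod (wave t (of_real p))) \<longlongrightarrow> cmod (wave t (of_real 0))) (at_right 0)"
      by (intro tendsto_norm isCont_tendsto_compose[OF isCont_wave[OF t]] tendsto_intros)
    moreover have "\<forall>\<^sub>F p in at_right 0. amp t * (p / sinh p) * exp (2 * p\<^sup>2 / t) * (1 - tail (pi\<^sup>2 / 8) t) \<le> cmod (wave t (of_real p))"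
      using eventually_at_right_less[of 0] by eventually_elim (rule pos)
    ultimately have "amp t * 1 * exp (2 * 0\<^sup>2 / t) * (1 - tail (pi\<^sup>2 / 8) t) \<le> cmod (wave t (of_real 0))"
      by (intro tendsto_le[of "at_right 0"]) auto
    then show ?thesis using True by (simp add: p_over_sinh_def)
  qed
qed

text \<open>The prefactor of the theorem: \<open>amp t\<close> enters squared through |psi|^2 and
  \<open>amp (2 * t)\<close> through the norm, and the factors exp (t/4) cancel.\<close>

lemma amp_ratio:
  assumes t: "t > 0"
  shows "(amp t)\<^sup>2 = 16 * sqrt pi / t powr (3 / 2) * amp (2 * t)"
proof -
  have e: "(exp (t / 8))\<^sup>2 = exp (2 * t / 8)" by (simp flip: exp_double)
  have p: "t powr (3 / 2) = t * sqrt t"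
  proof -
    have "t powr (3 / 2) = t powr (1 + 1 / 2)" by simp
    also have "\<dots> = t * sqrt t" unfolding powr_add using t by (simp add: powr_half_sqrt)
    finally show ?thesis .
  qed
  have s1: "(sqrt (8 * pi / t))\<^sup>2 = 8 * pi / t" using t by simp
  have s2: "sqrt (8 * pi / (2 * t)) = 2 * sqrt pi / sqrt t"
  proof -
    have "8 * pi / (2 * t) = 2\<^sup>2 * pi / t" by simp
    then show ?thesis by (simp only: real_sqrt_divide real_sqrt_mult real_sqrt_abs abs_numeral)
  qed
  have "(amp t)\<^sup>2 = exp (2 * t / 8) / 4 * (8 * pi / t) * (16 / t\<^sup>2)"
    unfolding amp_def power_mult_distrib power_divide e s1 by simp
  also have "\<dots> = exp (2 * t / 8) * (32 * (sqrt pi * sqrt pi) / (t * (sqrt t * sqrt t) * t))"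
    using t by (simp add: power2_eq_square mult_ac)
  also have "\<dots> = 16 * sqrt pi / (t * sqrt t) * (exp (2 * t / 8) / 2 * (2 * sqrt pi / sqrt t) * (4 / (2 * t)))"
    using t by (simp add: field_simps)
  finally show ?thesis unfolding amp_def[of "2 * t"] s2 p .
qed

text \<open>For t < 1 the denominator of the geometric sum stays above 1 - exp (-c).\<close>

lemma tail_le:
  assumes "c > 0" "0 < t" "t < 1"
  shows "tail c t \<le> 258 / (1 - exp (- c)) * exp (- c / t)"
proof -
  have "c / 1 \<le> c / t" using assms by (intro divide_left_mono) auto
  then have "exp (- c / t) \<le> exp (- c)" by simp
  moreover have "exp (- c) < 1" using assms by simp
  ultimately have "exp (- c / t) / (1 - exp (- c / t)) \<le> exp (- c / t) / (1 - exp (- c))"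
    by (intro divide_left_mono) auto
  then show ?thesis by (simp add: tail_def)
qed

lemma exp_decayingI:
  assumes "c > 0" "\<And>t. 0 < t \<Longrightarrow> f t > 0" "B > 0" "\<And>t. 0 < t \<Longrightarrow> t < 1 \<Longrightarrow> f t \<le> B * exp (- c / t)"
  shows "exp_decaying f"
  unfolding exp_decaying_def using assms by (intro exI[of _ B] exI[of _ c] exI[of _ 1]) auto

lemma exp_decaying_tail: "c > 0 \<Longrightarrow> exp_decaying (tail c)"
  by (rule exp_decayingI[OF _ tail_pos _ tail_le]) simp_all

lemma tail_square_le:
  assumes "c > 0" "0 < t" "t < 1"
  shows "(tail c t)\<^sup>2 \<le> (258 / (1 - exp (- c)))\<^sup>2 * exp (- c / t)"
proof -
  let ?B = "258 / (1 - exp (- c))"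
  have B: "?B > 0" using assms by simp
  have "(tail c t)\<^sup>2 \<le> (?B * exp (- c / t))\<^sup>2"
    using tail_le[OF assms] tail_pos[of c t] assms by (intro power_mono) auto
  also have "\<dots> = ?B\<^sup>2 * (exp (- c / t) * exp (- c / t))" by (simp add: power2_eq_square)
  also have "\<dots> \<le> ?B\<^sup>2 * (exp (- c / t) * 1)" using assms by (intro mult_left_mono) auto
  finally show ?thesis by simp
qed

lemma exp_decaying_tail_square: "c > 0 \<Longrightarrow> exp_decaying (\<lambda>t. (tail c t)\<^sup>2)"
  by (rule exp_decayingI[OF _ zero_less_power[OF tail_pos] _ tail_square_le]) simp_all

lemma exp_decaying_tail_shift:
  assumes c: "c > 0" shows "exp_decaying (\<lambda>t. (1 + tail c t)\<^sup>2 - 1)"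
proof -
  let ?B = "258 / (1 - exp (- c))"
  have e: "(1 + x)\<^sup>2 - 1 = 2 * x + x\<^sup>2" for x :: real by (simp add: power2_eq_square algebra_simps)
  show ?thesis
    unfolding e
  proof (rule exp_decayingI[OF c, of _ "2 * ?B + ?B\<^sup>2"])
    show "2 * tail c t + (tail c t)\<^sup>2 > 0" if "t > 0" for t
      using tail_pos[OF c that] by (simp add: add_pos_pos)
    show "2 * ?B + ?B\<^sup>2 > 0" using c by (simp add: add_pos_pos)
    fix t :: real assume t: "0 < t" "t < 1"
    then show "2 * tail c t + (tail c t)\<^sup>2 \<le> (2 * ?B + ?B\<^sup>2) * exp (- c / t)"
      using tail_le[OF c t] tail_square_le[OF c t] by (simp add: ring_distribs)
  qed
qed


section \<open>From the series to the density\<close>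

lemma ratio_sq_cnj: "ratio_sq (- cnj w) = ratio_sq w"
proof -
  have "sinh (cnj w) = cnj (sinh w)" by (simp add: sinh_field_def exp_cnj)
  then have "cmod (sinh (- cnj w)) = cmod (sinh w)" by simp
  then show ?thesis by (simp add: ratio_sq_def)
qed

lemma p_over_sinh_pos: "p \<ge> 0 \<Longrightarrow> p_over_sinh p > 0"
  by (simp add: p_over_sinh_def)

text \<open>R, E and X stay open because the two ranges of phi share the denominator and differ only
  in the bound for the numerator.\<close>

lemma density_bound:
  assumes haar: "normalized_haar_SU2 M" and t: "t > 0" and K: "tail (pi\<^sup>2 / 16) t < 1"
    and H: "det H = 1" "(H ** conj_transpose H) $ 1 $ 1 + (H ** conj_transpose H) $ 2 $ 2 = 2 * of_real (cosh p)" "p \<ge> 0"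
    and U: "(cmod (psi t H h))\<^sup>2 \<le> (amp t)\<^sup>2 * R * exp (4 * E / t) * X"
  shows "prob_density M t H h \<le>
    (16 * sqrt pi / t powr (3 / 2) * R * exp ((4 * E - p\<^sup>2) / t) * X) / (p_over_sinh p * (1 - tail (pi\<^sup>2 / 16) t))"
proof -
  define N where "N = psi_norm_sq M t H"
  define L where "L = amp (2 * t) * p_over_sinh p * exp (p\<^sup>2 / t) * (1 - tail (pi\<^sup>2 / 16) t)"
  have t2: "2 * t > 0" using t by simp
  have "of_real N = wave (2 * t) (of_real p)"
    unfolding N_def by (rule psi_norm_sq_eq_wave[OF haar t H(1)]) (simp add: H(2) cosh_of_real)
  moreover have "N \<ge> 0" unfolding N_def psi_norm_sq_def by simp
  ultimately have N: "N = cmod (wave (2 * t) (of_real p))" by (metis abs_of_nonneg norm_of_real)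
  \<comment> \<open>Doubling the time halves the constant in the tail: this is the K of the
    theorem.\<close>
  have "tail (pi\<^sup>2 / 8) (2 * t) = tail (pi\<^sup>2 / 16) t" by (simp add: tail_def)
  then have LN: "L \<le> N" using wave_lower_real[OF t2 H(3)] unfolding L_def N by simp
  have Lpos: "L > 0" unfolding L_def using K by (intro mult_pos_pos amp_pos t2 p_over_sinh_pos H) auto
  have "prob_density M t H h = (cmod (psi t H h))\<^sup>2 / N" by (simp add: prob_density_def N_def)
  also have "\<dots> \<le> (cmod (psi t H h))\<^sup>2 / L" using LN Lpos by (intro divide_left_mono) auto
  also have "\<dots> \<le> ((amp t)\<^sup>2 * R * exp (4 * E / t) * X) / L" using U Lpos by (intro divide_right_mono) auto
  also have "\<dots> = (16 * sqrt pi / t powr (3 / 2) * R * (exp (4 * E / t) / exp (p\<^sup>2 / t)) * X) / (p_over_sinh p * (1 - tail (pi\<^sup>2 / 16) t))"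
    unfolding amp_ratio[OF t] L_def using amp_pos[OF t2] by (simp add: mult_ac)
  also have "exp (4 * E / t) / exp (p\<^sup>2 / t) = exp ((4 * E - p\<^sup>2) / t)"
    by (simp add: diff_divide_distrib flip: exp_diff)
  finally show ?thesis .
qed

lemma coherent_density_bounds:
  fixes pv thetav :: "real^3"
  assumes haar: "normalized_haar_SU2 M" and t: "t > 0" and K: "tail (pi\<^sup>2 / 16) t < 1"
    and p: "p = norm pv" and th: "theta = norm thetav" "theta \<le> pi"
    and al: "p \<noteq> 0 \<and> theta \<noteq> 0 \<longrightarrow> cos alpha = (pv \<bullet> thetav) / (p * theta)"
    and H: "H = matrix_exp (cscale (- \<i> / 2) (tau_vec pv))"
    and h: "h = matrix_exp (tau_vec thetav)"
    and x: "x = Complex (cosh (p / 2) * cos theta) (sinh (p / 2) * sin theta * cos alpha)"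
    and s: "s = Re (Arcosh x)" and phi: "phi = Im (Arcosh x)"
    and dsq: "delta_sq = p\<^sup>2 / 4 - s\<^sup>2 + phi\<^sup>2 - theta\<^sup>2"
  shows "phi \<le> 31 * pi / 32 \<Longrightarrow> prob_density M t H h \<le>
      (16 * sqrt pi / t powr (3 / 2)
        * extend_pm1 (\<lambda>z. (cmod (Arcosh z))\<^sup>2 / cmod (z\<^sup>2 - 1)) x
        * exp (- (4 * (theta\<^sup>2 + delta_sq)) / t) * (1 + ((1 + tail (pi\<^sup>2 / 8) t)\<^sup>2 - 1)))
      / (p_over_sinh p * (1 - tail (pi\<^sup>2 / 16) t))"
    and "31 * pi / 32 \<le> phi \<Longrightarrow> prob_density M t H h \<le>
      (16 * sqrt pi / t powr (3 / 2)
        * extend_pm1 (\<lambda>z. (cmod (Arcosh z - \<i> * of_real pi))\<^sup>2 / cmod (z\<^sup>2 - 1)) x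
        * exp (- (2 * (theta\<^sup>2 + 2 * delta_sq)) / t) * (1 + (tail (pi\<^sup>2 / 32) t)\<^sup>2))
      / (p_over_sinh p * (1 - tail (pi\<^sup>2 / 16) t))"
proof -
  \<comment> \<open>The trace of \<open>H h\<^sup>-\<^sup>1\<close> is \<open>2 cnj x\<close>; the sign keeps the imaginary part in \<open>[0, \<pi>]\<close>.\<close>
  define w where "w = - cnj (Arcosh x)"
  note A = Arcosh[of x]
  have w: "Re w = - s" "Im w = phi" by (simp_all add: w_def s phi)
  have p0: "p \<ge> 0" by (simp add: p)
  note cs = coherent_state_matrices[of pv thetav alpha, folded p th(1), OF al H h, folded x]
  have "cosh w = cnj (cosh (Arcosh x))" by (simp add: w_def cosh_field_def exp_cnj add.commute)
  then have "cosh w = cnj x" by (simp only: A(1))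
  with cs(4) have "(H ** conj_transpose h) $ 1 $ 1 + (H ** conj_transpose h) $ 2 $ 2 = 2 * cosh w" by simp
  then have psi: "psi t H h = wave t w" by (rule psi_eq_wave[OF cs(1,3)])
  note bound = density_bound[OF haar t K cs(1,2) p0]
  show "prob_density M t H h \<le>
      (16 * sqrt pi / t powr (3 / 2)
        * extend_pm1 (\<lambda>z. (cmod (Arcosh z))\<^sup>2 / cmod (z\<^sup>2 - 1)) x
        * exp (- (4 * (theta\<^sup>2 + delta_sq)) / t) * (1 + ((1 + tail (pi\<^sup>2 / 8) t)\<^sup>2 - 1)))
      / (p_over_sinh p * (1 - tail (pi\<^sup>2 / 16) t))" if le: "phi \<le> 31 * pi / 32"
  proof -
    have "\<bar>Im w\<bar> \<le> 31 * pi / 32" using le A w phi by simp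
    from wave_upper_zero[OF t this]
    have "(cmod (psi t H h))\<^sup>2 \<le> (amp t)\<^sup>2 * ratio_sq w * exp (4 * (s\<^sup>2 - phi\<^sup>2) / t) * (1 + tail (pi\<^sup>2 / 8) t)\<^sup>2"
      unfolding psi w by simp
    note b = bound[OF this]
    have "4 * (s\<^sup>2 - phi\<^sup>2) - p\<^sup>2 = - (4 * (theta\<^sup>2 + delta_sq))" by (simp add: dsq)
    moreover have "31 * pi / 32 < pi" using pi_gt_zero by simp
    then have "Im (Arcosh x) < pi" using le phi by linarith
    then have "ratio_sq w = extend_pm1 (\<lambda>z. (cmod (Arcosh z))\<^sup>2 / cmod (z\<^sup>2 - 1)) x"
      by (simp only: w_def ratio_sq_cnj extend_Arcosh)
    ultimately show ?thesis using b by simp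
  qed
  show "prob_density M t H h \<le>
      (16 * sqrt pi / t powr (3 / 2)
        * extend_pm1 (\<lambda>z. (cmod (Arcosh z - \<i> * of_real pi))\<^sup>2 / cmod (z\<^sup>2 - 1)) x
        * exp (- (2 * (theta\<^sup>2 + 2 * delta_sq)) / t) * (1 + (tail (pi\<^sup>2 / 32) t)\<^sup>2))
      / (p_over_sinh p * (1 - tail (pi\<^sup>2 / 16) t))" if ge: "31 * pi / 32 \<le> phi"
  proof -
    define v where "v = w - \<i> * of_real pi"
    have v: "v = - cnj (Arcosh x - \<i> * of_real pi)" by (simp add: v_def w_def)
    have iv: "\<bar>Im v\<bar> = pi - phi" "pi - \<bar>Im v\<bar> = phi" using A w phi by (auto simp: v_def)
    \<comment> \<open>Re x has two descriptions, cosh s cos phi and cosh (p/2) cos theta; the sign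
      of the first is transferred to cos theta.\<close>
    have "Re x < 0"
    proof -
      have "x = cosh (of_real s + \<i> * of_real phi)"
        using A(1) complex_eq[of "Arcosh x"] by (simp add: s phi)
      then have "Re x = cosh s * cos phi"
        by (simp add: cosh_add cosh_of_real cosh_conv_cos[of "\<i> * _"] sinh_conv_sin[of "\<i> * _"] cos_of_real sin_of_real
            sinh_of_real)
      moreover have "cos phi < 0"
      proof -
        have "pi / 2 < 31 * pi / 32" using pi_gt_zero by simp
        then have "0 < phi - pi / 2" using ge by linarith
        moreover have "phi - pi / 2 < pi" using A phi pi_gt_zero by linarith
        ultimately have "sin (phi - pi / 2) > 0" by (rule sin_gt_zero)
        then show ?thesis by (simp add: sin_diff)
      qed
      ultimately show ?thesis by (simp add: mult_pos_neg)
    qed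
    then have "cosh (p / 2) * cos theta < 0" by (simp add: x)
    then have "cos theta < 0" using cosh_real_pos[of "p / 2"] by (auto simp: mult_less_0_iff)
    moreover have "theta \<ge> 0" by (simp add: th)
    ultimately have "pi / 2 \<le> theta" using cos_ge_zero[of theta] pi_ge_zero by force
    then have "(pi / 2)\<^sup>2 \<le> theta\<^sup>2" by (rule power_mono) simp
    then have "2 * (pi / 2)\<^sup>2 / t \<le> 2 * theta\<^sup>2 / t" using t by (intro divide_right_mono) auto
    moreover have "2 * (pi / 2)\<^sup>2 / t = pi\<^sup>2 / (2 * t)" by (simp add: power_divide)
    ultimately have "pi\<^sup>2 / (2 * t) \<le> 2 * theta\<^sup>2 / t" by (simp only:)
    \<comment> \<open>exp (2 theta^2 / t) is exactly what separates the exponent in (ii) from -4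
      (theta^2 + delta^2) / t, so it is available to absorb the loss.\<close>
    then have e: "exp (pi\<^sup>2 / (2 * t)) \<le> exp (2 * theta\<^sup>2 / t)" by simp
    have "\<bar>Im v\<bar> \<le> pi / 32" using iv ge by simp
    from wave_upper_pi[OF t this]
    have "(cmod (psi t H h))\<^sup>2 \<le> (amp t)\<^sup>2 * ratio_sq v * exp (4 * (s\<^sup>2 - phi\<^sup>2) / t) * (exp (pi\<^sup>2 / (2 * t)) * (tail (pi\<^sup>2 / 32) t)\<^sup>2)"
      unfolding psi iv by (simp add: v_def w)
    note b = bound[OF this]
    have r: "ratio_sq v = extend_pm1 (\<lambda>z. (cmod (Arcosh z - \<i> * of_real pi))\<^sup>2 / cmod (z\<^sup>2 - 1)) x"
    proof -
      have "31 * pi / 32 > 0" using pi_gt_zero by simp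
      then have "Im (Arcosh x) > 0" using ge phi by linarith
      then show ?thesis by (simp only: v ratio_sq_cnj extend_Arcosh_pi)
    qed
    have r0: "ratio_sq v \<ge> 0" by (simp add: ratio_sq_def)
    \<comment> \<open>The squared tail is enlarged to 1 plus itself to reach the form 1 +
      K''.\<close>
    have "exp ((4 * (s\<^sup>2 - phi\<^sup>2) - p\<^sup>2) / t) * (exp (pi\<^sup>2 / (2 * t)) * (tail (pi\<^sup>2 / 32) t)\<^sup>2) \<le>
       exp ((4 * (s\<^sup>2 - phi\<^sup>2) - p\<^sup>2) / t) * (exp (2 * theta\<^sup>2 / t) * (1 + (tail (pi\<^sup>2 / 32) t)\<^sup>2))"
      by (intro mult_left_mono mult_mono e) auto
    also have "\<dots> = exp (- (2 * (theta\<^sup>2 + 2 * delta_sq)) / t) * (1 + (tail (pi\<^sup>2 / 32) t)\<^sup>2)"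
      unfolding mult.assoc[symmetric] exp_add[symmetric]
      by (rule arg_cong2[where f="(*)"], rule arg_cong[where f=exp]) (simp_all add: dsq flip: add_divide_distrib)
    finally have ee: "exp ((4 * (s\<^sup>2 - phi\<^sup>2) - p\<^sup>2) / t) * (exp (pi\<^sup>2 / (2 * t)) * (tail (pi\<^sup>2 / 32) t)\<^sup>2) \<le>
      exp (- (2 * (theta\<^sup>2 + 2 * delta_sq)) / t) * (1 + (tail (pi\<^sup>2 / 32) t)\<^sup>2)" .
    have "0 < p_over_sinh p * (1 - tail (pi\<^sup>2 / 16) t)" using p_over_sinh_pos[OF p0] K by simp
    then have "16 * sqrt pi / t powr (3 / 2) * ratio_sq v * (exp ((4 * (s\<^sup>2 - phi\<^sup>2) - p\<^sup>2) / t) * (exp (pi\<^sup>2 / (2 * t)) * (tail (pi\<^sup>2 / 32) t)\<^sup>2))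
        / (p_over_sinh p * (1 - tail (pi\<^sup>2 / 16) t))
      \<le> 16 * sqrt pi / t powr (3 / 2) * ratio_sq v * (exp (- (2 * (theta\<^sup>2 + 2 * delta_sq)) / t) * (1 + (tail (pi\<^sup>2 / 32) t)\<^sup>2))
        / (p_over_sinh p * (1 - tail (pi\<^sup>2 / 16) t))"
      using r0 by (intro divide_right_mono mult_left_mono ee) auto
    with b show ?thesis unfolding r by (simp only: mult.assoc order_trans)
  qed
qed


theorem theorem4p3:
  fixes mu :: "(complex^2^2) measure"
  assumes haar: "normalized_haar_SU2 mu"
  shows "\<exists>K K' K'' :: real \<Rightarrow> real.
    (\<forall>t>0. K t > 0 \<and> K' t > 0 \<and> K'' t > 0) \<and>
    exp_decaying K \<and> exp_decaying K' \<and> exp_decaying K'' \<and>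
    (\<forall>t>0. K t < 1 \<longrightarrow>
      (\<forall>(pv :: real^3) (thetav :: real^3) (p :: real) (theta :: real) (alpha :: real)
         (H :: complex^2^2) (h :: complex^2^2) (x :: complex) (s :: real) (phi :: real)
         (delta_sq :: real).
        p = norm pv \<longrightarrow>
        theta = norm thetav \<longrightarrow> theta \<le> pi \<longrightarrow>
        0 \<le> alpha \<longrightarrow> alpha \<le> pi \<longrightarrow>
        (p \<noteq> 0 \<and> theta \<noteq> 0 \<longrightarrow> cos alpha = (pv \<bullet> thetav) / (p * theta)) \<longrightarrow>
        H = matrix_exp (cscale (- \<i> / 2) (tau_vec pv)) \<longrightarrow>
        h = matrix_exp (tau_vec thetav) \<longrightarrow>
        x = Complex (cosh (p / 2) * cos theta) (sinh (p / 2) * sin theta * cos alpha) \<longrightarrow>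
        s = Re (Arcosh x) \<longrightarrow> phi = Im (Arcosh x) \<longrightarrow>
        delta_sq = p\<^sup>2 / 4 - s\<^sup>2 + phi\<^sup>2 - theta\<^sup>2 \<longrightarrow>
        (0 \<le> phi \<and> phi \<le> 31 * pi / 32 \<longrightarrow>
          prob_density mu t H h \<le>
            (16 * sqrt pi / t powr (3 / 2)
              * extend_pm1 (\<lambda>z. (cmod (Arcosh z))\<^sup>2 / cmod (z\<^sup>2 - 1)) x
              * exp (- (4 * (theta\<^sup>2 + delta_sq)) / t) * (1 + K' t))
            / (p_over_sinh p * (1 - K t))) \<and>
        (31 * pi / 32 \<le> phi \<and> phi \<le> pi \<longrightarrow>
          prob_density mu t H h \<le>
            (16 * sqrt pi / t powr (3 / 2)
              * extend_pm1 (\<lambda>z. (cmod (Arcosh z - \<i> * of_real pi))\<^sup>2 / cmod (z\<^sup>2 - 1)) x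
              * exp (- (2 * (theta\<^sup>2 + 2 * delta_sq)) / t) * (1 + K'' t))
            / (p_over_sinh p * (1 - K t)))))"
proof (rule exI[of _ "tail (pi\<^sup>2 / 16)"], rule exI[of _ "\<lambda>t. (1 + tail (pi\<^sup>2 / 8) t)\<^sup>2 - 1"],
    rule exI[of _ "\<lambda>t. (tail (pi\<^sup>2 / 32) t)\<^sup>2"], intro conjI)
  \<comment> \<open>Of the three witnesses, K is the relative error of the norm at time 2t, 1 + K'
    is the square of 1 plus the relative error near phi = 0, and K'' is the squared tail of the
    half-integral pairs.\<close>
  show "\<forall>t>0. tail (pi\<^sup>2 / 16) t > 0 \<and> (1 + tail (pi\<^sup>2 / 8) t)\<^sup>2 - 1 > 0 \<and> (tail (pi\<^sup>2 / 32) t)\<^sup>2 > 0"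
  proof (intro allI impI conjI)
    fix t :: real assume t: "t > 0"
    show "tail (pi\<^sup>2 / 16) t > 0" "(tail (pi\<^sup>2 / 32) t)\<^sup>2 > 0"
      by (intro zero_less_power tail_pos t; simp)+
    have "1\<^sup>2 < (1 + tail (pi\<^sup>2 / 8) t)\<^sup>2"
      using tail_pos[of "pi\<^sup>2 / 8" t] t by (intro power_strict_mono) auto
    then show "(1 + tail (pi\<^sup>2 / 8) t)\<^sup>2 - 1 > 0" by simp
  qed
  show "exp_decaying (tail (pi\<^sup>2 / 16))" by (rule exp_decaying_tail) simp
  show "exp_decaying (\<lambda>t. (1 + tail (pi\<^sup>2 / 8) t)\<^sup>2 - 1)" by (rule exp_decaying_tail_shift) simp
  show "exp_decaying (\<lambda>t. (tail (pi\<^sup>2 / 32) t)\<^sup>2)" by (rule exp_decaying_tail_square) simp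
qed (intro allI impI conjI; elim conjE; rule coherent_density_bounds[OF haar]; assumption)

end
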